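(* Let $L_\pm$ be a splitting of $L=L(G)$ with $L_+=L_+(G)$ such that the $2$-cocycle $w(\xi,\eta)=\langle\partial_\lambda\xi,\eta\rangle_{-1}$ is compatible with the splitting, let $\{J_j\mid j\ge1\}$ be a vacuum sequence in $\mathcal L_+$, and let $C$ be a local group homomorphism from $S^1$ to $G$. Consider the action of $\mathcal V_+$ on $L_-$ given by the vector fields $$Z_\ell(f)=-\left(\lambda^{\ell+1}f_\lambda f^{-1}+\lambda^\ell f\,C'(1)f^{-1}\right)_-f,\qquad\ell\ge-1,$$ where $C'(1)=\frac{dC}{d\lambda}\big|_{\lambda=1}$. Then the induced $\mathcal V_+$-action on reduced frames $M$ and on tau functions $\tau=\tau_f$ is, for $\ell\ge-1$, $$(\delta_\ell M)M^{-1}=-\left(\lambda^\ell E\left(\lambda f_\lambda f^{-1}+fC'(1)f^{-1}\right)E^{-1}\right)_-,$$ $$\delta_\ell(\ln\tau)=\left\langle\lambda^\ell E\left(\lambda f_\lambda f^{-1}+fC'(1)f^{-1}\right)E^{-1},\ \lambda E_\lambda E^{-1}\right\rangle_0.$$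
   Context: $G$ is a complex (matrix) Lie group with Lie algebra $\mathfrak g$ carrying an ad-invariant non-degenerate symmetric bilinear form $(\cdot,\cdot)$ (for classical algebras, $\mathrm{tr}(AB)$). $L(G)$ is the group of smooth loops $S^1\to G$ with loop parameter $\lambda$, $\mathcal L$ its Lie algebra. $L_+(G)$ is the subgroup of loops that are boundary values of holomorphic maps from $|\lambda|<1$ to $G$. A splitting consists of subgroups $L_\pm$ with Lie algebras $\mathcal L_\pm$ such that $L_+\cap L_-=\{e\}$ and $\mathcal L=\mathcal L_+\oplus\mathcal L_-$; $\xi_\pm$ are the projections. $\langle\xi,\eta\rangle_k$ is the coefficient of $\lambda^k$ in $(\xi(\lambda),\eta(\lambda))$. $w$ is compatible with the splitting if it vanishes on $\mathcal L_+\times\mathcal L_+$ and on $\mathcal L_-\times\mathcal L_-$. A vacuum sequence is a linearly independent commuting sequence in $\mathcal L_+$. A local group homomorphism $C$ is a smooth map defined on $\{e^{i\theta}:|\theta|<\epsilon\}$ for some $\epsilon>0$, multiplicative wherever defined. $\mathcal V_+$ is the Lie algebra spanned by $\xi_j$, $j\ge-1$, with $[\xi_j,\xi_k]=(k-j)\xi_{j+k}$. Let $V(t)=\exp\left(\sum_{j=1}^Nt_jJ_j\right)$. For $f\in L_-$ and $t$ near $0\in\mathbb R^N$, factor $V(t)f^{-1}=M(t)^{-1}E(t)$ with $M(t)\in L_-$ (the reduced frame) and $E(t)\in L_+$ (the frame). $\delta_\ell M$ and $\delta_\ell\ln\tau$ denote the variations (derivatives, with $t$ fixed) of $M$ and $\ln\tau_f$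 when $f$ varies with $\delta f=Z_\ell(f)$. The tau function is $\tau_f(t)=\mu(V(t)f^{-1})$, where $\mu$ is defined as follows. The left invariant form defined by $w$ is assumed to represent a class in $H^2(L,2\pi i\mathbb Z)$. On $(L_+L_-)\cap(L_-L_+)$ write uniquely $g=f_+f_-^{-1}=g_-^{-1}g_+$ with $f_\pm,g_\pm\in L_\pm$, and let $\gamma_\pm$ (resp. $\tilde\gamma_\pm$) be paths in $L_\pm$ from $e$ to $f_\pm$ (resp. $g_\pm$). Then $\mu(g)=\exp\left(\int_\Omega w\right)$, where $\Omega$ is any surface in $L$ whose oriented boundary is $\gamma_+*(f_+\gamma_-^{-1})$ followed by the reverse of $\tilde\gamma_-^{-1}*(g_-^{-1}\tilde\gamma_+)$. *)

theory Defs
  imports "HOL-Analysis.Analysis"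
begin

(* Maps of class C^n and C^infinity.  A map is smooth on an arbitrary set S if it is C^infinity
   on some open neighbourhood of S. *)

primrec Ck_on :: "nat \<Rightarrow> 'a::euclidean_space set \<Rightarrow> ('a \<Rightarrow> 'b::real_normed_vector) \<Rightarrow> bool" where
  "Ck_on 0 U f = continuous_on U f"
| "Ck_on (Suc n) U f =
     ((\<forall>x\<in>U. f differentiable (at x)) \<and> (\<forall>v. Ck_on n U (\<lambda>x. frechet_derivative f (at x) v)))"

definition smooth_on :: "'a::euclidean_space set \<Rightarrow> ('a \<Rightarrow> 'b::real_normed_vector) \<Rightarrow> bool" where
  "smooth_on S f \<longleftrightarrow> (\<exists>U. open U \<and> S \<subseteq> U \<and> (\<forall>n. Ck_on n U f))"


section \<open>Matrix Lie groups\<close>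

definition cscale :: "complex \<Rightarrow> complex^'n^'n \<Rightarrow> complex^'n^'n" (infixr "*\<^sub>C" 75) where
  "c *\<^sub>C A = (\<chi> i j. c * A $ i $ j)"

definition commutator :: "complex^'n^'n \<Rightarrow> complex^'n^'n \<Rightarrow> complex^'n^'n" where
  "commutator A B = A ** B - B ** A"

definition mexp :: "complex^'n^'n \<Rightarrow> complex^'n^'n" where
  "mexp A = (\<Sum>k. (1 / fact k) *\<^sub>R (((**) A ^^ k) (mat 1)))"

definition matrix_lie_algebra :: "(complex^'n^'n) set \<Rightarrow> (complex^'n^'n) set" where
  "matrix_lie_algebra G =
     {X. \<exists>\<gamma> \<epsilon>. \<epsilon> > 0 \<and> smooth_on {-\<epsilon><..<\<epsilon>} \<gamma> \<and> (\<forall>s\<in>{-\<epsilon><..<\<epsilon>}. \<gamma> s \<in> G) \<and>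
        \<gamma> 0 = mat 1 \<and> (\<gamma> has_vector_derivative X) (at (0::real))}"

(* A closed subgroup of GL(n,C) whose Lie algebra is a complex subspace. *)
definition complex_matrix_lie_group :: "(complex^'n^'n) set \<Rightarrow> bool" where
  "complex_matrix_lie_group G \<longleftrightarrow>
     G \<subseteq> {A. invertible A} \<and> mat 1 \<in> G \<and>
     (\<forall>A\<in>G. \<forall>B\<in>G. A ** B \<in> G) \<and> (\<forall>A\<in>G. matrix_inv A \<in> G) \<and>
     closedin (top_of_set {A. invertible A}) G \<and>
     (\<forall>X\<in>matrix_lie_algebra G. \<i> *\<^sub>C X \<in> matrix_lie_algebra G)"

definition invariant_form ::
  "(complex^'n^'n) set \<Rightarrow> (complex^'n^'n \<Rightarrow> complex^'n^'n \<Rightarrow> complex) \<Rightarrow> bool" where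
  "invariant_form \<gg> B \<longleftrightarrow>
     (\<forall>X\<in>\<gg>. \<forall>Y\<in>\<gg>. \<forall>Z\<in>\<gg>. B (X + Y) Z = B X Z + B Y Z) \<and>
     (\<forall>X\<in>\<gg>. \<forall>Y\<in>\<gg>. \<forall>c. B (c *\<^sub>C X) Y = c * B X Y) \<and>
     (\<forall>X\<in>\<gg>. \<forall>Y\<in>\<gg>. B X Y = B Y X) \<and>
     (\<forall>X\<in>\<gg>. (\<forall>Y\<in>\<gg>. B X Y = 0) \<longrightarrow> X = 0) \<and>
     (\<forall>X\<in>\<gg>. \<forall>Y\<in>\<gg>. \<forall>Z\<in>\<gg>. B (commutator Z X) Y + B X (commutator Z Y) = 0)"


section \<open>Loop groups and splittings\<close>

(* A loop on the circle is represented by the 2 pi-periodic function of the angle \<theta>, where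
   \<lambda> = cis \<theta>. *)
type_synonym 'n loop = "real \<Rightarrow> complex^'n^'n"

definition lone :: "'n::finite loop" where
  "lone = (\<lambda>\<theta>. mat 1)"

definition lmul :: "'n::finite loop \<Rightarrow> 'n loop \<Rightarrow> 'n loop" (infixl "\<odot>" 70) where
  "f \<odot> g = (\<lambda>\<theta>. f \<theta> ** g \<theta>)"

definition linv :: "'n::finite loop \<Rightarrow> 'n loop" where
  "linv f = (\<lambda>\<theta>. matrix_inv (f \<theta>))"

definition ladd :: "'n::finite loop \<Rightarrow> 'n loop \<Rightarrow> 'n loop" (infixl "\<oplus>" 65) where
  "\<xi> \<oplus> \<eta> = (\<lambda>\<theta>. \<xi> \<theta> + \<eta> \<theta>)"

definition lneg :: "'n::finite loop \<Rightarrow> 'n loop" where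
  "lneg \<xi> = (\<lambda>\<theta>. - \<xi> \<theta>)"

(* Multiplication by the scalar function \<lambda>^k. *)
definition lpow :: "int \<Rightarrow> 'n::finite loop \<Rightarrow> 'n loop" where
  "lpow k \<xi> = (\<lambda>\<theta>. (cis \<theta> powi k) *\<^sub>C \<xi> \<theta>)"

(* Since \<lambda> = exp(i \<theta>), d/d\<lambda> = (i \<lambda>)^(-1) d/d\<theta>. *)
definition dlam :: "'n::finite loop \<Rightarrow> 'n loop" where
  "dlam \<xi> = (\<lambda>\<theta>. (1 / (\<i> * cis \<theta>)) *\<^sub>C vector_derivative \<xi> (at \<theta>))"

definition smooth_loops :: "(complex^'n^'n) set \<Rightarrow> 'n::finite loop set" where
  "smooth_loops S = {f. smooth_on UNIV f \<and> (\<forall>\<theta>. f (\<theta> + 2 * pi) = f \<theta>) \<and> (\<forall>\<theta>. f \<theta> \<in> S)}"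

definition loop_group :: "(complex^'n^'n) set \<Rightarrow> 'n::finite loop set" where
  "loop_group G = smooth_loops G"

definition loop_algebra :: "(complex^'n^'n) set \<Rightarrow> 'n::finite loop set" where
  "loop_algebra G = smooth_loops (matrix_lie_algebra G)"

definition loop_plus :: "(complex^'n^'n) set \<Rightarrow> 'n::finite loop set" where
  "loop_plus G = {f \<in> loop_group G. \<exists>F. continuous_on (cball 0 1) F \<and>
     (\<forall>i j. (\<lambda>z. F z $ i $ j) holomorphic_on ball 0 1) \<and> (\<forall>z\<in>ball 0 1. F z \<in> G) \<and>
     (\<forall>\<theta>. f \<theta> = F (cis \<theta>))}"

(* Smooth curves in a group H of loops.  A map from a finite-dimensional manifold into the Frechet
   manifold of smooth loops is smooth iff it is jointly smooth in the parameter and in \<theta>. *)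
definition loop_curve :: "real \<Rightarrow> 'n::finite loop set \<Rightarrow> (real \<Rightarrow> 'n loop) \<Rightarrow> bool" where
  "loop_curve \<epsilon> H \<gamma> \<longleftrightarrow>
     smooth_on ({-\<epsilon><..<\<epsilon>} \<times> UNIV) (\<lambda>(s,\<theta>). \<gamma> s \<theta>) \<and> (\<forall>s\<in>{-\<epsilon><..<\<epsilon>}. \<gamma> s \<in> H)"

(* The velocity at parameter 0 of a curve of loops, taken with \<theta> fixed. *)
definition variation :: "(real \<Rightarrow> 'n::finite loop) \<Rightarrow> 'n loop" where
  "variation \<gamma> = (\<lambda>\<theta>. vector_derivative (\<lambda>s. \<gamma> s \<theta>) (at 0))"

definition lie_algebra :: "'n::finite loop set \<Rightarrow> 'n loop set" where
  "lie_algebra H = {variation \<gamma> |\<gamma> \<epsilon>. \<epsilon> > 0 \<and> loop_curve \<epsilon> H \<gamma> \<and> \<gamma> 0 = lone}"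

definition loop_subgroup :: "(complex^'n^'n) set \<Rightarrow> 'n::finite loop set \<Rightarrow> bool" where
  "loop_subgroup G H \<longleftrightarrow> H \<subseteq> loop_group G \<and> lone \<in> H \<and>
     (\<forall>f\<in>H. \<forall>g\<in>H. f \<odot> g \<in> H) \<and> (\<forall>f\<in>H. linv f \<in> H)"

definition splitting ::
  "(complex^'n^'n) set \<Rightarrow> 'n::finite loop set \<Rightarrow> 'n loop set \<Rightarrow> bool" where
  "splitting G Lp Lm \<longleftrightarrow> loop_subgroup G Lp \<and> loop_subgroup G Lm \<and> Lp \<inter> Lm = {lone} \<and>
     loop_algebra G = {\<xi> \<oplus> \<eta> |\<xi> \<eta>. \<xi> \<in> lie_algebra Lp \<and> \<eta> \<in> lie_algebra Lm} \<and>
     lie_algebra Lp \<inter> lie_algebra Lm = {\<lambda>\<theta>. 0}"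

definition proj_minus :: "'n::finite loop set \<Rightarrow> 'n loop set \<Rightarrow> 'n loop \<Rightarrow> 'n loop" where
  "proj_minus Lp Lm \<zeta> =
     (THE \<eta>. \<eta> \<in> lie_algebra Lm \<and> (\<exists>\<xi>\<in>lie_algebra Lp. \<zeta> = \<xi> \<oplus> \<eta>))"


section \<open>The cocycle\<close>

(* The coefficient of \<lambda>^k in B(\<xi>(\<lambda>), \<eta>(\<lambda>)). *)
definition pairing ::
  "(complex^'n^'n \<Rightarrow> complex^'n^'n \<Rightarrow> complex) \<Rightarrow> int \<Rightarrow> 'n::finite loop \<Rightarrow> 'n loop \<Rightarrow> complex" where
  "pairing B k \<xi> \<eta> =
     (1 / (2 * pi)) * integral {0..2 * pi} (\<lambda>\<theta>. cis (- of_int k * \<theta>) * B (\<xi> \<theta>) (\<eta> \<theta>))"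

definition cocycle ::
  "(complex^'n^'n \<Rightarrow> complex^'n^'n \<Rightarrow> complex) \<Rightarrow> 'n::finite loop \<Rightarrow> 'n loop \<Rightarrow> complex" where
  "cocycle B \<xi> \<eta> = pairing B (-1) (dlam \<xi>) \<eta>"

definition compatible ::
  "('n::finite loop \<Rightarrow> 'n loop \<Rightarrow> complex) \<Rightarrow> 'n loop set \<Rightarrow> 'n loop set \<Rightarrow> bool" where
  "compatible w Lp Lm \<longleftrightarrow>
     (\<forall>\<xi>\<in>lie_algebra Lp. \<forall>\<eta>\<in>lie_algebra Lp. w \<xi> \<eta> = 0) \<and>
     (\<forall>\<xi>\<in>lie_algebra Lm. \<forall>\<eta>\<in>lie_algebra Lm. w \<xi> \<eta> = 0)"


section \<open>Surfaces in the loop group and the tau function\<close>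

(* Compact oriented surfaces in L are given by smooth cubical 2-chains: integral combinations of
   smooth maps from the unit square to L. *)
type_synonym 'n square = "real \<Rightarrow> real \<Rightarrow> 'n loop"
type_synonym 'n surface = "(int \<times> 'n square) list"

definition is_surface :: "'n::finite loop set \<Rightarrow> 'n surface \<Rightarrow> bool" where
  "is_surface L \<Omega> \<longleftrightarrow> (\<forall>(n,\<sigma>)\<in>set \<Omega>.
     smooth_on ({0..1} \<times> {0..1} \<times> UNIV) (\<lambda>(a,b,\<theta>). \<sigma> a b \<theta>) \<and>
     (\<forall>a\<in>{0..1}. \<forall>b\<in>{0..1}. \<sigma> a b \<in> L))"

(* The integral of the pullback of the left invariant 2-form with value w at the identity. *)
definition square_integral ::
  "('n::finite loop \<Rightarrow> 'n loop \<Rightarrow> complex) \<Rightarrow> 'n square \<Rightarrow> complex" where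
  "square_integral w \<sigma> = integral (cbox (0,0) (1,1)) (\<lambda>(a,b).
     w (linv (\<sigma> a b) \<odot> (\<lambda>\<theta>. vector_derivative (\<lambda>a'. \<sigma> a' b \<theta>) (at a)))
       (linv (\<sigma> a b) \<odot> (\<lambda>\<theta>. vector_derivative (\<lambda>b'. \<sigma> a b' \<theta>) (at b))))"

definition surface_integral ::
  "('n::finite loop \<Rightarrow> 'n loop \<Rightarrow> complex) \<Rightarrow> 'n surface \<Rightarrow> complex" where
  "surface_integral w \<Omega> = (\<Sum>(n,\<sigma>)\<leftarrow>\<Omega>. of_int n * square_integral w \<sigma>)"

(* A 1-chain is a formal integral combination of paths parametrised by [0,1]; it is represented by
   the function assigning to each path its coefficient.  Constant paths are degenerate and
   disregarded, as in normalized cubical chains. *)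
definition edge :: "(real \<Rightarrow> 'n::finite loop) \<Rightarrow> (real \<Rightarrow> 'n loop) \<Rightarrow> int" where
  "edge \<gamma> e = (if (\<forall>r\<in>{0..1}. \<gamma> r = e r) \<and> \<not> (\<forall>r\<in>{0..1}. e r = e 0) then 1 else 0)"

(* Counterclockwise boundary of the square. *)
definition square_boundary :: "'n::finite square \<Rightarrow> (real \<Rightarrow> 'n loop) \<Rightarrow> int" where
  "square_boundary \<sigma> e =
     edge (\<lambda>a. \<sigma> a 0) e + edge (\<lambda>b. \<sigma> 1 b) e - edge (\<lambda>a. \<sigma> a 1) e - edge (\<lambda>b. \<sigma> 0 b) e"

definition surface_boundary :: "'n::finite surface \<Rightarrow> (real \<Rightarrow> 'n loop) \<Rightarrow> int" where
  "surface_boundary \<Omega> e = (\<Sum>(n,\<sigma>)\<leftarrow>\<Omega>. n * square_boundary \<sigma> e)"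

(* The class of the left invariant form lies in H^2(L, 2 pi i Z): its periods over all closed
   surfaces are in 2 pi i Z. *)
definition integral_class ::
  "('n::finite loop \<Rightarrow> 'n loop \<Rightarrow> complex) \<Rightarrow> 'n loop set \<Rightarrow> bool" where
  "integral_class w L \<longleftrightarrow> (\<forall>\<Omega>. is_surface L \<Omega> \<and> (\<forall>e. surface_boundary \<Omega> e = 0) \<longrightarrow>
     (\<exists>m::int. surface_integral w \<Omega> = 2 * pi * \<i> * of_int m))"

definition path_in ::
  "'n::finite loop set \<Rightarrow> 'n loop \<Rightarrow> 'n loop \<Rightarrow> (real \<Rightarrow> 'n loop) \<Rightarrow> bool" where
  "path_in H x y \<gamma> \<longleftrightarrow> smooth_on ({0..1} \<times> UNIV) (\<lambda>(r,\<theta>). \<gamma> r \<theta>) \<and>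
     (\<forall>r\<in>{0..1}. \<gamma> r \<in> H) \<and> \<gamma> 0 = x \<and> \<gamma> 1 = y"

(* z is the value exp(integral of w over \<Omega>) obtained at g from some admissible choice of paths
   \<gamma>p, \<gamma>m, \<gamma>p', \<gamma>m' (from the identity to fp, fm, gp, gm) and of a surface \<Omega>. *)
definition mu_value ::
  "('n::finite loop \<Rightarrow> 'n loop \<Rightarrow> complex) \<Rightarrow> 'n loop set \<Rightarrow> 'n loop set \<Rightarrow> 'n loop set \<Rightarrow>
     'n loop \<Rightarrow> complex \<Rightarrow> bool" where
  "mu_value w L Lp Lm g z \<longleftrightarrow>
     (\<exists>fp\<in>Lp. \<exists>fm\<in>Lm. \<exists>gp\<in>Lp. \<exists>gm\<in>Lm. \<exists>\<gamma>p \<gamma>m \<gamma>p' \<gamma>m' \<Omega>.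
        g = fp \<odot> linv fm \<and> g = linv gm \<odot> gp \<and>
        path_in Lp lone fp \<gamma>p \<and> path_in Lm lone fm \<gamma>m \<and>
        path_in Lp lone gp \<gamma>p' \<and> path_in Lm lone gm \<gamma>m' \<and>
        is_surface L \<Omega> \<and>
        (\<forall>e. surface_boundary \<Omega> e =
               edge \<gamma>p e + edge (\<lambda>r. fp \<odot> linv (\<gamma>m r)) e
               - edge (\<lambda>r. linv gm \<odot> \<gamma>p' r) e - edge (\<lambda>r. linv (\<gamma>m' r)) e) \<and>
        z = exp (surface_integral w \<Omega>))"

(* The value of exp(integral of w over \<Omega>) does not depend on the choice of paths and surface. *)
definition mu_well_defined ::
  "('n::finite loop \<Rightarrow> 'n loop \<Rightarrow> complex) \<Rightarrow> 'n loop set \<Rightarrow> 'n loop set \<Rightarrow> 'n loop set \<Rightarrow> bool" where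
  "mu_well_defined w L Lp Lm \<longleftrightarrow>
     (\<forall>g z z'. mu_value w L Lp Lm g z \<and> mu_value w L Lp Lm g z' \<longrightarrow> z = z')"

definition mu_domain ::
  "('n::finite loop \<Rightarrow> 'n loop \<Rightarrow> complex) \<Rightarrow> 'n loop set \<Rightarrow> 'n loop set \<Rightarrow> 'n loop set \<Rightarrow>
     'n loop set" where
  "mu_domain w L Lp Lm = {g. \<exists>z. mu_value w L Lp Lm g z}"

definition mu ::
  "('n::finite loop \<Rightarrow> 'n loop \<Rightarrow> complex) \<Rightarrow> 'n loop set \<Rightarrow> 'n loop set \<Rightarrow> 'n loop set \<Rightarrow>
     'n loop \<Rightarrow> complex" where
  "mu w L Lp Lm g = (THE z. mu_value w L Lp Lm g z)"

definition vacuum_sequence :: "'n::finite loop set \<Rightarrow> (nat \<Rightarrow> 'n loop) \<Rightarrow> bool" where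
  "vacuum_sequence Lp J \<longleftrightarrow>
     (\<forall>j\<ge>1. J j \<in> lie_algebra Lp) \<and>
     (\<forall>j\<ge>1. \<forall>k\<ge>1. \<forall>\<theta>. commutator (J j \<theta>) (J k \<theta>) = 0) \<and>
     (\<forall>N c. (\<forall>\<theta>. (\<Sum>j=1..N. c j *\<^sub>C J j \<theta>) = 0) \<longrightarrow> (\<forall>j\<in>{1..N}. c j = 0))"

(* V(t) = exp(t_1 J_1 + ... + t_N J_N); only the entries t_1, ..., t_N of t are used. *)
definition vacuum_frame :: "(nat \<Rightarrow> 'n::finite loop) \<Rightarrow> nat \<Rightarrow> (nat \<Rightarrow> real) \<Rightarrow> 'n loop" where
  "vacuum_frame J N t = (\<lambda>\<theta>. mexp (\<Sum>j=1..N. t j *\<^sub>R J j \<theta>))"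

definition tau ::
  "('n::finite loop \<Rightarrow> 'n loop \<Rightarrow> complex) \<Rightarrow> 'n loop set \<Rightarrow> 'n loop set \<Rightarrow> 'n loop set \<Rightarrow>
     (nat \<Rightarrow> 'n loop) \<Rightarrow> nat \<Rightarrow> 'n loop \<Rightarrow> (nat \<Rightarrow> real) \<Rightarrow> complex" where
  "tau w L Lp Lm J N f t = mu w L Lp Lm (vacuum_frame J N t \<odot> linv f)"

(* The derivative of ln \<phi> at 0, for a nonvanishing complex function \<phi>, computed with a local
   branch \<rho> of ln \<phi>. *)
definition has_log_variation :: "(real \<Rightarrow> complex) \<Rightarrow> complex \<Rightarrow> bool" where
  "has_log_variation \<phi> d \<longleftrightarrow>
     (\<exists>\<rho>. (\<forall>\<^sub>F u in nhds 0. exp (\<rho> u) = \<phi> u) \<and> (\<rho> has_vector_derivative d) (at 0))"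


section \<open>The Virasoro vector fields\<close>

definition circle_arc :: "real \<Rightarrow> complex set" where
  "circle_arc \<epsilon> = {cis \<theta> |\<theta>. \<bar>\<theta>\<bar> < \<epsilon>}"

definition local_group_hom :: "(complex^'n^'n) set \<Rightarrow> (complex \<Rightarrow> complex^'n^'n) \<Rightarrow> bool" where
  "local_group_hom G C \<longleftrightarrow> (\<exists>\<epsilon>>0. smooth_on {-\<epsilon><..<\<epsilon>} (\<lambda>\<theta>. C (cis \<theta>)) \<and>
     (\<forall>z\<in>circle_arc \<epsilon>. C z \<in> G) \<and>
     (\<forall>z\<in>circle_arc \<epsilon>. \<forall>z'\<in>circle_arc \<epsilon>. z * z' \<in> circle_arc \<epsilon> \<longrightarrow> C (z * z') = C z ** C z'))"

(* C'(1) = dC/d\<lambda> at \<lambda> = 1, as a constant loop. *)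
definition Cprime1 :: "(complex \<Rightarrow> complex^'n^'n) \<Rightarrow> 'n::finite loop" where
  "Cprime1 C = (\<lambda>\<theta>. dlam (\<lambda>\<phi>. C (cis \<phi>)) 0)"

definition virasoro_field ::
  "'n::finite loop set \<Rightarrow> 'n loop set \<Rightarrow> (complex \<Rightarrow> complex^'n^'n) \<Rightarrow> int \<Rightarrow> 'n loop \<Rightarrow> 'n loop" where
  "virasoro_field Lp Lm C l f =
     lneg (proj_minus Lp Lm
       (lpow (l + 1) (dlam f \<odot> linv f) \<oplus> lpow l (f \<odot> Cprime1 C \<odot> linv f))) \<odot> f"

end

(* Differentiating E = M V f^(-1) and splitting gives (delta M) M^(-1) = -Y_- with
   Y = E X E^(-1), where -X_- is the right logarithmic derivative of f.

   For tau, multiply the given paths from the identity to f(0), M(0), E(0) by f(bu) f(0)^(-1),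
   M(bu) M(0)^(-1), E(bu) E(0)^(-1), where b is the path parameter.  As u varies, each path sweeps
   out a square, and these squares change a surface for f(0) into one for f(u).  The squares lying
   in a translate of L_- contribute nothing by compatibility.  The remaining one contributes to
   first order the integral of w(p^(-1) Y p, p^(-1) p_b) db along the path p from e to E(0), the
   L_+ parts being killed by compatibility, and -<Y, p_lambda p^(-1)>_(-1) is a primitive of this
   integrand. *)

theory Submission
  imports Defs
begin

section \<open>Smooth maps\<close>

text \<open>The square that survives is swept by \<open>M(s)^(-1)\<close> times a path in
  \<open>Lp\<close>. Both factors move with \<open>s\<close>, so it lies in no fixed translate of
  either subgroup. Its width is proportional to \<open>u\<close>, hence its integral is
  \<open>u * K(u)\<close> with \<open>K\<close> continuous, and its derivative at \<open>0\<close>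
  is \<open>K(0)\<close>, an integral along a single path. The primitive of that integrand comes
  from the symmetry of mixed partial derivatives, which exchanges \<open>p_b\<close> and
  \<open>p_theta\<close>, combined with invariance of the form.

  Well-definedness of \<open>mu\<close> is a hypothesis, so one explicit surface for each
  \<open>u\<close> determines it, and membership in the domain is required at \<open>u = 0\<close>
  only.

  Two features of the definitions shape the details. Paths and squares take values in the groups
  over the closed unit interval, while smoothness holds on an unspecified neighbourhood.
  Neighbourhoods are therefore cut down to invertible values, and Lie algebra statements are proved
  at interior parameters, the rest being a null set or reached by continuity. Also, \<open>B\<close>
  is constrained on the Lie algebra alone, so calculus is done with a bilinear extension
  \<open>B_ext\<close>.\<close>

lemma Ck_on_cong:
  assumes "open U" "\<And>x. x \<in> U \<Longrightarrow> f x = g x" "Ck_on n U f"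
  shows "Ck_on n U g"
  using assms(2,3)
proof (induction n arbitrary: f g)
  case 0
  then show ?case using continuous_on_cong[of U U f g] by simp
next
  case (Suc n)
  have d: "(g has_derivative frechet_derivative f (at x)) (at x)" if "x \<in> U" for x
    using Suc.prems that assms(1)
    by (auto simp: frechet_derivative_works intro: has_derivative_transform_within_open)
  have e: "frechet_derivative g (at x) = frechet_derivative f (at x)" if "x \<in> U" for x
    using frechet_derivative_at[OF d[OF that]] by simp
  have "Ck_on n U (\<lambda>x. frechet_derivative g (at x) v)" for v
    using Suc.IH[of "\<lambda>x. frechet_derivative f (at x) v"] e Suc.prems by simp
  then show ?case using d by (auto simp: differentiable_def)
qed

lemma Ck_on_SucD: "Ck_on (Suc n) U f \<Longrightarrow> Ck_on n U f"
proof (induction n arbitrary: f)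
  case 0
  then show ?case
    by (auto intro!: continuous_at_imp_continuous_on differentiable_imp_continuous_within)
next
  case (Suc n)
  from Suc.prems have "f differentiable (at x)" if "x \<in> U" for x using that by simp
  moreover from Suc.prems have "Ck_on (Suc n) U (\<lambda>x. frechet_derivative f (at x) v)" for v by simp
  ultimately show ?case using Suc.IH by simp
qed

text \<open>\<open>Ck_on\<close> refers to the chosen \<open>frechet_derivative\<close>. On an open
  set the derivative is unique, so any explicit formula may stand in for it. Most closure properties
  below are inductions on \<open>n\<close> through this rule.\<close>

lemma Ck_on_SucI:
  assumes "open U" "\<And>x. x \<in> U \<Longrightarrow> (f has_derivative f' x) (at x)"
    and "\<And>v. Ck_on n U (\<lambda>x. f' x v)"
  shows "Ck_on (Suc n) U f"
proof -
  have "frechet_derivative f (at x) = f' x" if "x \<in> U" for x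
    using frechet_derivative_at[OF assms(2)[OF that]] by simp
  then have "Ck_on n U (\<lambda>x. frechet_derivative f (at x) v)" for v
    using Ck_on_cong[OF assms(1) _ assms(3)[of v]] by simp
  then show ?thesis using assms(2) by (auto simp: differentiable_def)
qed

lemma Ck_on_SucE:
  assumes "Ck_on (Suc n) U f" "x \<in> U"
  shows "(f has_derivative frechet_derivative f (at x)) (at x)"
  using assms by (simp add: frechet_derivative_works)

lemma Ck_on_const: "open U \<Longrightarrow> Ck_on n U (\<lambda>x. c)"
  by (induction n arbitrary: c) (auto intro!: Ck_on_SucI[where f'="\<lambda>x v. 0"])

lemma Ck_on_subset: "Ck_on n U f \<Longrightarrow> V \<subseteq> U \<Longrightarrow> Ck_on n V f"
  by (induction n arbitrary: f) (auto intro: continuous_on_subset)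

lemma Ck_on_add:
  "open U \<Longrightarrow> Ck_on n U f \<Longrightarrow> Ck_on n U g \<Longrightarrow> Ck_on n U (\<lambda>x. f x + g x)"
proof (induction n arbitrary: f g)
  case 0
  then show ?case by (simp add: continuous_on_add)
next
  case (Suc n)
  show ?case
    by (rule Ck_on_SucI[OF Suc.prems(1) has_derivative_add[OF Ck_on_SucE[OF Suc.prems(2)] Ck_on_SucE[OF Suc.prems(3)]]])
       (use Suc in auto)
qed

lemma Ck_on_linear:
  "open U \<Longrightarrow> bounded_linear h \<Longrightarrow> Ck_on n U f \<Longrightarrow> Ck_on n U (\<lambda>x. h (f x))"
proof (induction n arbitrary: f)
  case 0
  then show ?case by (simp add: bounded_linear.continuous_on)
next
  case (Suc n)
  show ?case
    by (rule Ck_on_SucI[OF Suc.prems(1) bounded_linear.has_derivative[OF Suc.prems(2) Ck_on_SucE[OF Suc.prems(3)]]])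
       (use Suc in auto)
qed

lemma Ck_on_bilinear:
  assumes "open U" "bounded_bilinear h"
  shows "Ck_on n U f \<Longrightarrow> Ck_on n U g \<Longrightarrow> Ck_on n U (\<lambda>x. h (f x) (g x))"
proof (induction n arbitrary: f g)
  case 0
  then show ?case using assms by (simp add: bounded_bilinear.continuous_on)
next
  case (Suc n)
  show ?case
  proof (rule Ck_on_SucI[OF assms(1) bounded_bilinear.FDERIV[OF assms(2) Ck_on_SucE[OF Suc.prems(1)] Ck_on_SucE[OF Suc.prems(2)]]])
    fix v
    show "Ck_on n U (\<lambda>x. h (f x) (frechet_derivative g (at x) v) + h (frechet_derivative f (at x) v) (g x))"
    proof (intro Ck_on_add assms Suc.IH)
      show "Ck_on n U f" "Ck_on n U g" by (fact Ck_on_SucD[OF Suc.prems(1)] Ck_on_SucD[OF Suc.prems(2)])+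
    qed (use Suc.prems in simp_all)
  qed
qed

lemma Ck_on_sum:
  "finite I \<Longrightarrow> open U \<Longrightarrow> (\<And>i. i \<in> I \<Longrightarrow> Ck_on n U (f i)) \<Longrightarrow> Ck_on n U (\<lambda>x. \<Sum>i\<in>I. f i x)"
  by (induction I rule: finite_induct) (auto intro: Ck_on_add Ck_on_const)

lemma Ck_on_prod:
  fixes f :: "'i \<Rightarrow> 'a::euclidean_space \<Rightarrow> complex"
  shows "finite I \<Longrightarrow> open U \<Longrightarrow> (\<And>i. i \<in> I \<Longrightarrow> Ck_on n U (f i)) \<Longrightarrow> Ck_on n U (\<lambda>x. \<Prod>i\<in>I. f i x)"
  by (induction I rule: finite_induct)
     (auto intro: Ck_on_bilinear[OF _ bounded_bilinear_mult] Ck_on_const)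

lemma Ck_on_compose:
  fixes g :: "'a::euclidean_space \<Rightarrow> 'b::euclidean_space"
  assumes "open U" "open V" "\<And>x. x \<in> U \<Longrightarrow> g x \<in> V"
  shows "Ck_on n V f \<Longrightarrow> Ck_on n U g \<Longrightarrow> Ck_on n U (\<lambda>x. f (g x))"
proof (induction n arbitrary: f)
  case 0
  then show ?case using assms continuous_on_compose2[of V f U g] by auto
next
  case (Suc n)
  let ?g = "\<lambda>x. frechet_derivative g (at x)" and ?f = "\<lambda>x. frechet_derivative f (at x)"
  show ?case
  proof (rule Ck_on_SucI[where f'="\<lambda>x v. ?f (g x) (?g x v)"])
    show "open U" by fact
    show "((\<lambda>x. f (g x)) has_derivative (\<lambda>v. ?f (g x) (?g x v))) (at x)" if "x \<in> U" for x
      using diff_chain_at[OF Ck_on_SucE[OF Suc.prems(2) that] Ck_on_SucE[OF Suc.prems(1)]] assms(3)[OF that]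
      by (simp add: o_def)
    fix v
    \<comment> \<open>In the chain rule the direction fed to the derivative of \<open>f\<close>
      varies with \<open>x\<close>, whereas the induction hypothesis treats fixed directions.
      Expanding in \<open>Basis\<close> leaves fixed directions with coefficients depending on
      \<open>x\<close>.\<close>
    have "Ck_on n U (\<lambda>x. \<Sum>i\<in>Basis. (?g x v \<bullet> i) *\<^sub>R ?f (g x) i)"
    proof (intro Ck_on_sum Ck_on_bilinear[OF _ bounded_bilinear_scaleR])
      fix i :: 'b
      show "Ck_on n U (\<lambda>x. ?g x v \<bullet> i)"
        using Suc.prems by (intro Ck_on_linear[OF _ bounded_linear_inner_left] assms) auto
      show "Ck_on n U (\<lambda>x. ?f (g x) i)"
        using Suc.prems by (intro Suc.IH Ck_on_SucD[OF Suc.prems(2)]) auto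
    qed (use assms in auto)
    moreover have "?f (g x) (?g x v) = (\<Sum>i\<in>Basis. (?g x v \<bullet> i) *\<^sub>R ?f (g x) i)" if "x \<in> U" for x
    proof -
      have "linear (?f (g x))"
        using Suc.prems(1) assms(3)[OF that] by (simp add: linear_frechet_derivative)
      then have "?f (g x) (\<Sum>i\<in>Basis. (?g x v \<bullet> i) *\<^sub>R i) = (\<Sum>i\<in>Basis. (?g x v \<bullet> i) *\<^sub>R ?f (g x) i)"
        by (simp add: linear_sum linear_scale)
      then show ?thesis by (simp add: euclidean_representation)
    qed
    ultimately show "Ck_on n U (\<lambda>x. ?f (g x) (?g x v))"
      using Ck_on_cong[OF assms(1)] by (metis (no_types, lifting))
  qed
qed

lemma Ck_on_inverse:
  fixes f :: "'a::euclidean_space \<Rightarrow> complex"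
  assumes "open U" "\<And>x. x \<in> U \<Longrightarrow> f x \<noteq> 0"
  shows "Ck_on n U f \<Longrightarrow> Ck_on n U (\<lambda>x. inverse (f x))"
proof (induction n)
  case 0
  then show ?case using assms by (auto intro: continuous_on_inverse)
next
  case (Suc n)
  show ?case
  proof (rule Ck_on_SucI[OF assms(1) Deriv.has_derivative_inverse[OF assms(2) Ck_on_SucE[OF Suc.prems]]])
    fix v
    have "Ck_on n U (\<lambda>x. inverse (f x) * frechet_derivative f (at x) v * inverse (f x))"
      using Suc Ck_on_SucD[OF Suc.prems] by (intro Ck_on_bilinear[OF assms(1) bounded_bilinear_mult]) auto
    then show "Ck_on n U (\<lambda>x. - (inverse (f x) * frechet_derivative f (at x) v * inverse (f x)))"
      by (rule Ck_on_linear[OF assms(1) bounded_linear_minus[OF bounded_linear_ident]])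
  qed
qed

section \<open>Smoothness of the determinant and of matrix inversion\<close>

lemma bounded_linear_axis: "bounded_linear (axis i :: 'a::euclidean_space \<Rightarrow> 'a^'n)"
  by (simp add: linear_conv_bounded_linear[symmetric] linear_iff vec_eq_iff axis_def)

lemma Ck_on_vec:
  fixes f :: "'n::finite \<Rightarrow> 'a::euclidean_space \<Rightarrow> 'b::euclidean_space"
  assumes "open U" "\<And>i. Ck_on n U (\<lambda>x. f i x)"
  shows "Ck_on n U (\<lambda>x. \<chi> i. f i x)"
proof -
  have "Ck_on n U (\<lambda>x. \<Sum>i\<in>UNIV. axis i (f i x))"
    using assms by (intro Ck_on_sum Ck_on_linear[OF _ bounded_linear_axis]) auto
  moreover have "(\<Sum>i\<in>UNIV. axis i (f i x)) = (\<chi> i. f i x)" for x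
    by (simp add: vec_eq_iff axis_def if_distrib sum.delta cong: if_cong)
  ultimately show ?thesis by simp
qed

lemma Ck_on_vec_nth: "open U \<Longrightarrow> Ck_on n U f \<Longrightarrow> Ck_on n U (\<lambda>x. f x $ i)"
  by (rule Ck_on_linear[OF _ bounded_linear_vec_nth])

lemma Ck_on_det:
  fixes A :: "'a::euclidean_space \<Rightarrow> complex^'n^'n"
  assumes "open U" "Ck_on n U A"
  shows "Ck_on n U (\<lambda>x. det (A x))"
  unfolding det_def
  by (intro Ck_on_sum Ck_on_bilinear[OF _ bounded_bilinear_mult] Ck_on_prod Ck_on_const Ck_on_vec_nth)
     (use assms in \<open>auto simp: finite_permutations\<close>)

lemma matrix_inv_right: "invertible A \<Longrightarrow> A ** matrix_inv A = mat 1"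
  and matrix_inv_left: "invertible A \<Longrightarrow> matrix_inv A ** A = mat 1"
  unfolding invertible_def matrix_inv_def by (metis (mono_tags, lifting) someI_ex)+

lemma matrix_inv_unique:
  fixes A :: "complex^'n^'n" assumes "A ** X = mat 1" shows "matrix_inv A = X"
proof -
  have "invertible A" using assms invertible_right_inverse by blast
  then have "matrix_inv A ** (A ** X) = X" by (simp add: matrix_mul_assoc matrix_inv_left)
  then show ?thesis by (simp add: assms)
qed

text \<open>Column \<open>l\<close> of the inverse solves the linear system with right hand side
  \<open>axis l 1\<close>, so Cramer's rule gives its entries as polynomials in the entries of
  \<open>A\<close> divided by \<open>det A\<close>. Smoothness of inversion rests on this
  formula.\<close>

lemma matrix_inv_cramer:
  fixes A :: "complex^'n^'n" assumes "invertible A"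
  shows "matrix_inv A = (\<chi> k l. det (\<chi> i j. if j = k then axis l 1 $ i else A $ i $ j) * inverse (det A))"
proof -
  have d: "det A \<noteq> 0" using assms by (simp add: invertible_det_nz)
  have "matrix_inv A *v axis l 1 = (\<chi> k. det (\<chi> i j. if j = k then axis l 1 $ i else A $ i $ j) / det A)" for l
    using cramer[OF d, of "matrix_inv A *v axis l 1" "axis l 1"] assms
    by (simp add: matrix_vector_mul_assoc matrix_inv_right)
  then have "(matrix_inv A *v axis l 1) $ k = det (\<chi> i j. if j = k then axis l 1 $ i else A $ i $ j) / det A" for k l
    by simp
  moreover have "(matrix_inv A *v axis l 1) $ k = matrix_inv A $ k $ l" for k l
    by (simp add: matrix_vector_mult_def axis_def if_distrib sum.delta cong: if_cong)
  ultimately have "matrix_inv A $ k $ l = det (\<chi> i j. if j = k then axis l 1 $ i else A $ i $ j) / det A" for k l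
    by simp
  then show ?thesis by (simp add: vec_eq_iff divide_inverse)
qed

lemma Ck_on_matrix_inv:
  fixes A :: "'a::euclidean_space \<Rightarrow> complex^'n^'n"
  assumes "open U" "\<And>x. x \<in> U \<Longrightarrow> invertible (A x)" "Ck_on n U A"
  shows "Ck_on n U (\<lambda>x. matrix_inv (A x))"
proof -
  let ?B = "\<lambda>k l x. (\<chi> i j. if j = k then axis l 1 $ i else A x $ i $ j) :: complex^'n^'n"
  have "Ck_on n U (\<lambda>x. if j = k then axis l 1 $ i else A x $ i $ j)" for i j k l
    using assms by (cases "j = k") (auto intro!: Ck_on_const Ck_on_vec_nth)
  then have B: "Ck_on n U (?B k l)" for k l
    by (intro Ck_on_vec assms(1))
  then have "Ck_on n U (\<lambda>x. \<chi> k l. det (?B k l x) * inverse (det (A x)))"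
    using assms
    by (intro Ck_on_vec Ck_on_bilinear[OF _ bounded_bilinear_mult] Ck_on_det[OF _ B] Ck_on_det[OF _ assms(3)] Ck_on_inverse)
       (auto simp: invertible_det_nz)
  then show ?thesis
    by (rule Ck_on_cong[OF assms(1), rotated]) (simp add: matrix_inv_cramer[OF assms(2)])
qed

text \<open>Openness is built in so that the closure rules chain without side conditions. Smoothness
  on an arbitrary set \<open>S\<close> then means \<open>Cinf_on\<close> on some neighbourhood of
  \<open>S\<close>.\<close>

definition Cinf_on :: "'a::euclidean_space set \<Rightarrow> ('a \<Rightarrow> 'b::real_normed_vector) \<Rightarrow> bool" where
  "Cinf_on U f \<longleftrightarrow> open U \<and> (\<forall>n. Ck_on n U f)"

lemma Cinf_on_open: "Cinf_on U f \<Longrightarrow> open U" by (simp add: Cinf_on_def)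

lemma Cinf_on_cong: "Cinf_on U f \<Longrightarrow> (\<And>x. x \<in> U \<Longrightarrow> f x = g x) \<Longrightarrow> Cinf_on U g"
  unfolding Cinf_on_def by (blast intro: Ck_on_cong)

lemma Cinf_on_subset: "Cinf_on U f \<Longrightarrow> open V \<Longrightarrow> V \<subseteq> U \<Longrightarrow> Cinf_on V f"
  unfolding Cinf_on_def by (blast intro: Ck_on_subset)

lemma Cinf_on_imp_continuous_on: "Cinf_on U f \<Longrightarrow> continuous_on U f"
  unfolding Cinf_on_def by (metis Ck_on.simps(1))

lemma Cinf_on_has_derivative:
  "Cinf_on U f \<Longrightarrow> x \<in> U \<Longrightarrow> (f has_derivative frechet_derivative f (at x)) (at x)"
  unfolding Cinf_on_def using Ck_on_SucE by blast

lemma Cinf_on_derivative: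
  "Cinf_on U f \<Longrightarrow> Cinf_on U (\<lambda>x. frechet_derivative f (at x) v)"
proof -
  assume "Cinf_on U f"
  then have "open U" "Ck_on (Suc n) U f" for n unfolding Cinf_on_def by blast+
  then show ?thesis by (simp add: Cinf_on_def)
qed

lemma Cinf_on_const: "open U \<Longrightarrow> Cinf_on U (\<lambda>x. c)"
  by (simp add: Cinf_on_def Ck_on_const)

lemma Cinf_on_add: "Cinf_on U f \<Longrightarrow> Cinf_on U g \<Longrightarrow> Cinf_on U (\<lambda>x. f x + g x)"
  by (simp add: Cinf_on_def Ck_on_add)

lemma Cinf_on_linear: "bounded_linear h \<Longrightarrow> Cinf_on U f \<Longrightarrow> Cinf_on U (\<lambda>x. h (f x))"
  by (simp add: Cinf_on_def Ck_on_linear)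

lemma Cinf_on_bilinear:
  "bounded_bilinear h \<Longrightarrow> Cinf_on U f \<Longrightarrow> Cinf_on U g \<Longrightarrow> Cinf_on U (\<lambda>x. h (f x) (g x))"
  by (simp add: Cinf_on_def Ck_on_bilinear)

lemma Cinf_on_compose:
  "Cinf_on V f \<Longrightarrow> Cinf_on U g \<Longrightarrow> (\<And>x. x \<in> U \<Longrightarrow> g x \<in> V) \<Longrightarrow> Cinf_on U (\<lambda>x. f (g x))"
  unfolding Cinf_on_def using Ck_on_compose by blast

lemma Cinf_on_ident: "open U \<Longrightarrow> Cinf_on U (\<lambda>x. x)"
  unfolding Cinf_on_def
proof (intro conjI allI)
  fix n show "Ck_on n U (\<lambda>x. x)" if "open U"
    using that by (cases n) (auto intro!: Ck_on_SucI[where f'="\<lambda>x v. v"] Ck_on_const)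
qed

lemma Cinf_on_fst: "open U \<Longrightarrow> Cinf_on U fst"
  using Cinf_on_linear[OF bounded_linear_fst Cinf_on_ident] .

lemma Cinf_on_snd: "open U \<Longrightarrow> Cinf_on U snd"
  using Cinf_on_linear[OF bounded_linear_snd Cinf_on_ident] .

lemma Cinf_on_Pair: "Cinf_on U f \<Longrightarrow> Cinf_on U g \<Longrightarrow> Cinf_on U (\<lambda>x. (f x, g x))"
proof -
  assume fg: "Cinf_on U f" "Cinf_on U g"
  have "bounded_linear (\<lambda>x::'b. (x, 0::'c))" "bounded_linear (\<lambda>y::'c. (0::'b, y))"
    by (auto intro: bounded_linear_Pair bounded_linear_ident bounded_linear_zero)
  then have "Cinf_on U (\<lambda>x. (f x, 0) + (0, g x))"
    using fg by (intro Cinf_on_add Cinf_on_linear[of "\<lambda>x. (x, 0)"] Cinf_on_linear[of "\<lambda>y. (0, y)"])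
  then show ?thesis by simp
qed

lemma Cinf_on_matrix_inv:
  fixes A :: "'a::euclidean_space \<Rightarrow> complex^'n^'n"
  shows "Cinf_on U A \<Longrightarrow> (\<And>x. x \<in> U \<Longrightarrow> invertible (A x)) \<Longrightarrow> Cinf_on U (\<lambda>x. matrix_inv (A x))"
  by (simp add: Cinf_on_def Ck_on_matrix_inv)

lemma smooth_on_iff_Cinf_on: "smooth_on S f \<longleftrightarrow> (\<exists>U. S \<subseteq> U \<and> Cinf_on U f)"
  unfolding smooth_on_def Cinf_on_def by auto

lemma smooth_on_open_iff: "open S \<Longrightarrow> smooth_on S f \<longleftrightarrow> Cinf_on S f"
  unfolding smooth_on_iff_Cinf_on using Cinf_on_subset by blast

section \<open>Derivatives along curves and symmetry of mixed partials\<close>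

lemma has_vector_derivative_along:
  assumes "Cinf_on U f" "g s \<in> U" "(g has_vector_derivative v) (at s)"
  shows "((\<lambda>s. f (g s)) has_vector_derivative frechet_derivative f (at (g s)) v) (at s)"
proof -
  note f = Cinf_on_has_derivative[OF assms(1,2)]
  then have "linear (frechet_derivative f (at (g s)))"
    using has_derivative_linear by blast
  then show ?thesis
    using diff_chain_at[OF assms(3)[unfolded has_vector_derivative_def] f]
    by (simp add: has_vector_derivative_def o_def linear_scale)
qed

text \<open>Both iterated derivatives are read off from
  \<open>F (x + s v + t w) - F (x + s v) = \<integral>\<^sub>0\<^sup>t D\<^sub>w F (x + s v + \<tau> w) d\<tau>\<close>: differentiate under the
  integral in \<open>s\<close>, then in \<open>t\<close>.\<close>

lemma Cinf_on_derivative_commute: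
  fixes F :: "'a::euclidean_space \<Rightarrow> 'b::banach"
  assumes F: "Cinf_on U F" and x: "x \<in> U"
  shows "frechet_derivative (\<lambda>y. frechet_derivative F (at y) v) (at x) w =
         frechet_derivative (\<lambda>y. frechet_derivative F (at y) w) (at x) v"
proof -
  define Dv where "Dv = (\<lambda>y. frechet_derivative F (at y) v)"
  define Dw where "Dw = (\<lambda>y. frechet_derivative F (at y) w)"
  define Dvw where "Dvw = (\<lambda>y. frechet_derivative Dw (at y) v)"
  have Dv: "Cinf_on U Dv" and Dw: "Cinf_on U Dw" and Dvw: "Cinf_on U Dvw"
    unfolding Dv_def Dw_def Dvw_def using F by (auto intro: Cinf_on_derivative)
  let ?p = "\<lambda>s t. x + s *\<^sub>R v + t *\<^sub>R w"
  have "open ((\<lambda>(s,t). ?p s t) -` U)"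
    by (intro open_vimage Cinf_on_open[OF F]) (auto simp: case_prod_beta intro!: continuous_intros)
  moreover have "(0,0) \<in> (\<lambda>(s,t). ?p s t) -` U" using x by simp
  ultimately obtain A A' where "open A" "open A'" "0 \<in> A" "0 \<in> A'" and AA: "A \<times> A' \<subseteq> (\<lambda>(s,t). ?p s t) -` U"
    by (auto elim!: open_prod_elim)
  then obtain d d' where "d > 0" "ball 0 d \<subseteq> A" and "d' > 0" "ball 0 d' \<subseteq> A'"
    using open_contains_ball by meson
  \<comment> \<open>Halving keeps the closed interval from \<open>-e\<close> to \<open>e\<close>
    inside both open balls.\<close>
  define e where "e = min d d' / 2"
  have e: "e > 0" using \<open>d > 0\<close> \<open>d' > 0\<close> by (simp add: e_def)
  have U: "?p s t \<in> U" if "s \<in> {-e..e}" "t \<in> {-e..e}" for s t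
  proof -
    have "\<bar>s\<bar> \<le> e" "\<bar>t\<bar> \<le> e" "e < d" "e < d'"
      using that \<open>d > 0\<close> \<open>d' > 0\<close> by (auto simp: e_def min_def)
    then have "s \<in> A" "t \<in> A'"
      using \<open>ball 0 d \<subseteq> A\<close> \<open>ball 0 d' \<subseteq> A'\<close> by (auto simp: subset_iff)
    then have "(s, t) \<in> (\<lambda>(s,t). ?p s t) -` U" using AA by (intro subsetD[OF AA] SigmaI)
    then show ?thesis by simp
  qed
  have ds: "((\<lambda>s. H (?p s t)) has_vector_derivative frechet_derivative H (at (?p s t)) v) (at s within T)"
    if "Cinf_on U H" "s \<in> {-e..e}" "t \<in> {-e..e}" for H :: "'a \<Rightarrow> 'b" and s t T
  proof -
    have p: "((\<lambda>s. ?p s t) has_vector_derivative v) (at s)"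
      by (auto intro!: derivative_eq_intros simp: has_vector_derivative_def)
    show ?thesis
      by (rule has_vector_derivative_at_within[OF has_vector_derivative_along[of U H "\<lambda>s. ?p s t", OF that(1) U[OF that(2,3)] p]])
  qed
  have dt: "((\<lambda>t. H (?p s t)) has_vector_derivative frechet_derivative H (at (?p s t)) w) (at t within T)"
    if "Cinf_on U H" "s \<in> {-e..e}" "t \<in> {-e..e}" for H :: "'a \<Rightarrow> 'b" and s t T
  proof -
    have p: "((\<lambda>t. ?p s t) has_vector_derivative w) (at t)"
      by (auto intro!: derivative_eq_intros simp: has_vector_derivative_def)
    show ?thesis
      by (rule has_vector_derivative_at_within[OF has_vector_derivative_along[of U H "\<lambda>t. ?p s t", OF that(1) U[OF that(2,3)] p]])
  qed
  have cont: "continuous_on ({-e..e} \<times> {-e..e}) (\<lambda>(s,t). H (?p s t))" if "Cinf_on U H" for H :: "'a \<Rightarrow> 'b"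
    unfolding case_prod_beta
    by (rule continuous_on_compose2[OF Cinf_on_imp_continuous_on[OF that]])
       (use U in \<open>auto intro!: continuous_intros\<close>)
  have cont1: "continuous_on {0..t} (\<lambda>t. H (?p s t))" if "Cinf_on U H" "s \<in> {-e..e}" "t \<le> e" for H :: "'a \<Rightarrow> 'b" and s t
    by (rule continuous_on_compose2[OF Cinf_on_imp_continuous_on[OF that(1)]])
       (use U that e in \<open>auto intro!: continuous_intros\<close>)
  have int: "F (?p s t) - F (?p s 0) = integral {0..t} (\<lambda>\<tau>. Dw (?p s \<tau>))"
    if "s \<in> {-e..e}" "t \<in> {0..e}" for s t
  proof -
    have "((\<lambda>\<tau>. Dw (?p s \<tau>)) has_integral F (?p s t) - F (?p s 0)) {0..t}"
      unfolding Dw_def by (rule fundamental_theorem_of_calculus) (use that e in \<open>auto intro!: dt F\<close>)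
    then show ?thesis by (simp add: integral_unique)
  qed
  have key: "Dv (?p 0 t) - Dv (?p 0 0) = integral {0..t} (\<lambda>\<tau>. Dvw (?p 0 \<tau>))" if t: "t \<in> {0..e}" for t
  proof -
    have 1: "((\<lambda>s. integral (cbox 0 t) (\<lambda>\<tau>. Dw (?p s \<tau>))) has_vector_derivative
        integral (cbox 0 t) (\<lambda>\<tau>. Dvw (?p 0 \<tau>))) (at 0 within {-e..e})"
    proof (rule leibniz_rule_vector_derivative)
      fix s \<tau> assume "s \<in> {-e..e}" "\<tau> \<in> cbox 0 t"
      then show "((\<lambda>s. Dw (?p s \<tau>)) has_vector_derivative Dvw (?p s \<tau>)) (at s within {-e..e})"
        unfolding Dvw_def using t e by (intro ds Dw) auto
    next
      fix s assume "s \<in> {-e..e}"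
      then show "(\<lambda>\<tau>. Dw (?p s \<tau>)) integrable_on cbox 0 t"
        using t by (intro integrable_continuous) (auto intro!: cont1 Dw)
    next
      show "continuous_on ({-e..e} \<times> cbox 0 t) (\<lambda>(s, \<tau>). Dvw (?p s \<tau>))"
        using t e by (intro continuous_on_subset[OF cont[OF Dvw]]) auto
    qed (use e in auto)
    have 2: "((\<lambda>s. F (?p s t) - F (?p s 0)) has_vector_derivative
        integral {0..t} (\<lambda>\<tau>. Dvw (?p 0 \<tau>))) (at 0 within {-e..e})"
      by (rule has_vector_derivative_transform[OF _ _ 1[unfolded cbox_interval]]) (use e t int in auto)
    have 3: "((\<lambda>s. F (?p s t) - F (?p s 0)) has_vector_derivative (Dv (?p 0 t) - Dv (?p 0 0))) (at 0 within {-e..e})"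
      unfolding Dv_def by (intro has_vector_derivative_diff ds F) (use e t in auto)
    show ?thesis
      by (rule vector_derivative_unique_within_closed_interval[unfolded cbox_interval, OF _ _ 3 2]) (use e in auto)
  qed
  have 1: "((\<lambda>t. Dv (?p 0 t) - Dv (?p 0 0)) has_vector_derivative frechet_derivative Dv (at (?p 0 0)) w - 0) (at 0 within {0..e})"
    by (intro has_vector_derivative_diff dt Dv has_vector_derivative_const) (use e in auto)
  have "((\<lambda>t. integral {0..t} (\<lambda>\<tau>. Dvw (?p 0 \<tau>))) has_vector_derivative Dvw (?p 0 0)) (at 0 within {0..e})"
    by (rule integral_has_vector_derivative) (use e in \<open>auto intro!: cont1[where s=0, simplified] Dvw\<close>)
  then have 2: "((\<lambda>t. Dv (?p 0 t) - Dv (?p 0 0)) has_vector_derivative Dvw (?p 0 0)) (at 0 within {0..e})"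
    by (rule has_vector_derivative_transform[rotated 2]) (use e key in auto)
  have "frechet_derivative Dv (at (?p 0 0)) w - 0 = Dvw (?p 0 0)"
    by (rule vector_derivative_unique_within_closed_interval[unfolded cbox_interval, OF _ _ 1 2]) (use e in auto)
  then show ?thesis by (simp add: Dv_def Dvw_def Dw_def)
qed

section \<open>Matrix Lie groups\<close>

lemma bounded_bilinear_matrix_mult:
  "bounded_bilinear ((**) :: complex^'n^'m \<Rightarrow> complex^'p^'n \<Rightarrow> complex^'p^'m)"
  by (simp add: bilinear_conv_bounded_bilinear[symmetric] bilinear_def linear_iff vec_eq_iff
      matrix_matrix_mult_def algebra_simps sum.distrib scaleR_sum_right)

lemmas matrix_add_left = bounded_bilinear.add_left[OF bounded_bilinear_matrix_mult]
  and matrix_add_right = bounded_bilinear.add_right[OF bounded_bilinear_matrix_mult]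
  and matrix_diff_left = bounded_bilinear.diff_left[OF bounded_bilinear_matrix_mult]
  and matrix_diff_right = bounded_bilinear.diff_right[OF bounded_bilinear_matrix_mult]
  and matrix_minus_left = bounded_bilinear.minus_left[OF bounded_bilinear_matrix_mult]
  and matrix_minus_right = bounded_bilinear.minus_right[OF bounded_bilinear_matrix_mult]
  and matrix_scaleR_left = bounded_bilinear.scaleR_left[OF bounded_bilinear_matrix_mult]
  and matrix_scaleR_right = bounded_bilinear.scaleR_right[OF bounded_bilinear_matrix_mult]
  and matrix_zero_left = bounded_bilinear.zero_left[OF bounded_bilinear_matrix_mult]
  and matrix_zero_right = bounded_bilinear.zero_right[OF bounded_bilinear_matrix_mult]

lemmas matrix_simps = matrix_add_left matrix_add_right matrix_diff_left matrix_diff_right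
  matrix_minus_left matrix_minus_right matrix_scaleR_left matrix_scaleR_right
  matrix_zero_left matrix_zero_right

lemmas matrix_assoc = matrix_mul_assoc[symmetric]

lemma bounded_bilinear_cscale: "bounded_bilinear ((*\<^sub>C) :: complex \<Rightarrow> complex^'n^'n \<Rightarrow> _)"
  by (simp add: bilinear_conv_bounded_bilinear[symmetric] bilinear_def linear_iff vec_eq_iff
      cscale_def algebra_simps)

lemma cscale_cscale [simp]: "a *\<^sub>C b *\<^sub>C A = (a * b) *\<^sub>C A"
  by (simp add: vec_eq_iff cscale_def)

lemma cscale_of_real: "complex_of_real r *\<^sub>C A = r *\<^sub>R A"
  by (simp add: vec_eq_iff cscale_def) (simp add: scaleR_conv_of_real)

lemma cscale_conv_scaleR: "c *\<^sub>C A = Re c *\<^sub>R A + Im c *\<^sub>R (\<i> *\<^sub>C A)"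
  by (simp add: vec_eq_iff cscale_def) (simp add: scaleR_conv_of_real complex_eq_iff)

lemma matrix_cscale_left: "(c *\<^sub>C A) ** B = c *\<^sub>C (A ** B)"
  and matrix_cscale_right: "A ** (c *\<^sub>C B) = c *\<^sub>C (A ** B)"
  by (simp_all add: vec_eq_iff cscale_def matrix_matrix_mult_def sum_distrib_left mult_ac)

lemma matrix_inv_mult_cancel [simp]:
  fixes A :: "complex^'n^'n" assumes "invertible A"
  shows "A ** matrix_inv A = mat 1" "matrix_inv A ** A = mat 1"
    "A ** (matrix_inv A ** X) = X" "matrix_inv A ** (A ** X) = X"
  using assms by (simp_all add: matrix_inv_right matrix_inv_left matrix_mul_assoc)

lemma invertible_matrix_inv [simp]: "invertible (A :: complex^'n^'n) \<Longrightarrow> invertible (matrix_inv A)"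
  using matrix_inv_mult_cancel(1,2) invertible_def by blast

lemma matrix_inv_matrix_inv [simp]: "invertible (A :: complex^'n^'n) \<Longrightarrow> matrix_inv (matrix_inv A) = A"
  by (simp add: matrix_inv_unique)

lemma matrix_inv_mult:
  fixes A B :: "complex^'n^'n"
  assumes "invertible A" "invertible B"
  shows "matrix_inv (A ** B) = matrix_inv B ** matrix_inv A"
  by (rule matrix_inv_unique) (simp add: matrix_assoc assms)

lemma matrix_inv_one [simp]: "matrix_inv (mat 1 :: complex^'n^'n) = mat 1"
  by (simp add: matrix_inv_unique)

lemma Cinf_on_matrix_mult:
  "Cinf_on U A \<Longrightarrow> Cinf_on U B \<Longrightarrow> Cinf_on U (\<lambda>x. A x ** B x :: complex^'n^'n)"
  by (rule Cinf_on_bilinear[OF bounded_bilinear_matrix_mult])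

lemmas has_vector_derivative_matrix_mult =
  bounded_bilinear.has_vector_derivative[OF bounded_bilinear_matrix_mult]

lemma open_invertible: "open {A :: complex^'n^'n. invertible A}"
proof -
  have "Cinf_on UNIV (\<lambda>A :: complex^'n^'n. det A)"
    by (simp add: Cinf_on_def Ck_on_det Cinf_on_ident[unfolded Cinf_on_def])
  then have "continuous_on UNIV (\<lambda>A :: complex^'n^'n. det A)"
    by (rule Cinf_on_imp_continuous_on)
  then have "open ((\<lambda>A :: complex^'n^'n. det A) -` (- {0}))"
    by (intro open_vimage) auto
  then show ?thesis by (simp add: vimage_def invertible_det_nz)
qed

text \<open>A smooth family of group elements over a closed parameter set may leave the group on the
  neighbourhood where it is smooth. Invertibility is an open condition, so a smaller neighbourhood
  still admits inverses.\<close>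

lemma Cinf_on_invertible_nhd:
  fixes A :: "'a::euclidean_space \<Rightarrow> complex^'n^'n"
  assumes "Cinf_on U A"
  shows "Cinf_on {x \<in> U. invertible (A x)} A"
proof (rule Cinf_on_subset[OF assms])
  have "{x \<in> U. invertible (A x)} = U \<inter> A -` {A. invertible A}" by auto
  then show "open {x \<in> U. invertible (A x)}"
    using continuous_open_preimage[OF Cinf_on_imp_continuous_on[OF assms] Cinf_on_open[OF assms] open_invertible]
    by (simp add: vimage_def)
qed auto

text \<open>Existence of the derivative is the smoothness of inversion; its value follows by
  differentiating \<open>F y ** matrix_inv (F y) = mat 1\<close>.\<close>

lemma has_derivative_matrix_inv:
  fixes F :: "'a::euclidean_space \<Rightarrow> complex^'n^'n"
  assumes F: "Cinf_on U F" "x \<in> U" and inv: "\<And>y. y \<in> U \<Longrightarrow> invertible (F y)"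
  shows "((\<lambda>y. matrix_inv (F y)) has_derivative
    (\<lambda>u. - (matrix_inv (F x) ** frechet_derivative F (at x) u ** matrix_inv (F x)))) (at x)"
proof -
  let ?D = "\<lambda>u. frechet_derivative F (at x) u"
  obtain I where I: "((\<lambda>y. matrix_inv (F y)) has_derivative I) (at x)"
    using Cinf_on_has_derivative[OF Cinf_on_matrix_inv[OF F(1) inv] F(2)] by blast
  have "((\<lambda>y. F y ** matrix_inv (F y)) has_derivative (\<lambda>u. F x ** I u + ?D u ** matrix_inv (F x))) (at x)"
    by (rule bounded_bilinear.FDERIV[OF bounded_bilinear_matrix_mult Cinf_on_has_derivative[OF F] I])
  then have "((\<lambda>y. mat 1) has_derivative (\<lambda>u. F x ** I u + ?D u ** matrix_inv (F x))) (at x)"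
    by (rule has_derivative_transform_within_open[OF _ Cinf_on_open[OF F(1)] F(2)]) (simp add: inv)
  then have "(\<lambda>u. F x ** I u + ?D u ** matrix_inv (F x)) = (\<lambda>u. 0)"
    by (rule has_derivative_unique[OF _ has_derivative_const])
  then have "F x ** I u + ?D u ** matrix_inv (F x) = 0" for u
    by (rule fun_cong)
  then have "matrix_inv (F x) ** (F x ** I u + ?D u ** matrix_inv (F x)) = 0" for u
    by (simp add: matrix_zero_right)
  then have "I = (\<lambda>u. - (matrix_inv (F x) ** ?D u ** matrix_inv (F x)))"
    using inv[OF F(2)] by (simp add: fun_eq_iff matrix_add_right matrix_assoc eq_neg_iff_add_eq_0)
  with I show ?thesis by simp
qed

lemma has_vector_derivative_matrix_inv:
  fixes A :: "real \<Rightarrow> complex^'n^'n"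
  assumes A: "Cinf_on U A" "s \<in> U" and inv: "\<And>x. x \<in> U \<Longrightarrow> invertible (A x)"
    and A': "(A has_vector_derivative A') (at s)"
  shows "((\<lambda>x. matrix_inv (A x)) has_vector_derivative - (matrix_inv (A s) ** A' ** matrix_inv (A s))) (at s)"
proof -
  have "frechet_derivative A (at s) = (\<lambda>r. r *\<^sub>R A')"
    using frechet_derivative_at[OF A'[unfolded has_vector_derivative_def]] by simp
  then show ?thesis
    using has_derivative_matrix_inv[OF A inv] by (simp add: has_vector_derivative_def matrix_simps)
qed

text \<open>The retraction serves twice: it keeps derivatives inside the Lie algebra, and it extends
  the form beyond the Lie algebra.\<close>

lemma subspace_projection:
  fixes S :: "'a::euclidean_space set"
  assumes "subspace S"
  obtains P :: "'a \<Rightarrow> 'a" where "linear P" "\<And>x. P x \<in> S" "\<And>x. x \<in> S \<Longrightarrow> P x = x"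
  using linear_exists_left_inverse_on[OF linear_id assms] by (auto simp: id_def)

text \<open>A linear retraction \<open>P\<close> onto \<open>S\<close> fixes the curve near
  \<open>s\<close>, so \<open>P v\<close> is also its derivative, and uniqueness gives
  \<open>v = P v\<close>.\<close>

lemma has_vector_derivative_in_subspace:
  fixes c :: "real \<Rightarrow> 'a::euclidean_space"
  assumes S: "subspace S" and c: "(c has_vector_derivative v) (at s)"
    and U: "open U" "s \<in> U" "\<And>x. x \<in> U \<Longrightarrow> c x \<in> S"
  shows "v \<in> S"
proof -
  obtain P where P: "linear P" "\<And>x. P x \<in> S" "\<And>x. x \<in> S \<Longrightarrow> P x = x"
    using subspace_projection[OF S] by blast
  have "((\<lambda>x. P (c x)) has_vector_derivative P v) (at s)"
    by (rule bounded_linear.has_vector_derivative[OF linear_conv_bounded_linear[THEN iffD1, OF P(1)] c])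
  then have "(c has_vector_derivative P v) (at s)"
    by (rule has_vector_derivative_transform_within_open[OF _ U(1,2)]) (simp add: U(3) P(3))
  then have "v = P v" using c vector_derivative_unique_at by blast
  then show ?thesis using P(2) by metis
qed

lemma Cinf_on_has_vector_derivative:
  fixes \<gamma> :: "real \<Rightarrow> 'b::real_normed_vector"
  assumes "Cinf_on U \<gamma>" "s \<in> U"
  shows "(\<gamma> has_vector_derivative vector_derivative \<gamma> (at s)) (at s)"
  using Cinf_on_has_derivative[OF assms] differentiable_def vector_derivative_works by blast

lemma Cinf_on_vector_derivative:
  fixes \<gamma> :: "real \<Rightarrow> 'b::real_normed_vector"
  assumes "Cinf_on U \<gamma>"
  shows "Cinf_on U (\<lambda>s. vector_derivative \<gamma> (at s))"
proof (rule Cinf_on_cong[OF Cinf_on_derivative[OF assms, of 1]])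
  fix s assume "s \<in> U"
  then have "\<gamma> differentiable at s"
    using Cinf_on_has_derivative[OF assms] by (auto simp: differentiable_def)
  then show "frechet_derivative \<gamma> (at s) 1 = vector_derivative \<gamma> (at s)"
    by (simp add: frechet_derivative_eq_vector_derivative)
qed

lemma Cinf_on_scaleR_right: "open U \<Longrightarrow> Cinf_on U (\<lambda>s::real. c * s)"
  using Cinf_on_linear[OF bounded_linear_mult_right Cinf_on_ident] .

lemma Cinf_on_shift: "open U \<Longrightarrow> Cinf_on U (\<lambda>s. c + s)"
  by (intro Cinf_on_add Cinf_on_const Cinf_on_ident)

lemma matrix_lie_algebra_iff:
  "X \<in> matrix_lie_algebra G \<longleftrightarrow> (\<exists>\<gamma> \<epsilon>. \<epsilon> > 0 \<and> Cinf_on {-\<epsilon><..<\<epsilon>} \<gamma> \<and> (\<forall>s\<in>{-\<epsilon><..<\<epsilon>}. \<gamma> s \<in> G) \<and>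
        \<gamma> 0 = mat 1 \<and> (\<gamma> has_vector_derivative X) (at (0::real)))"
  by (simp add: matrix_lie_algebra_def smooth_on_open_iff)

text \<open>The summand \<open>1\<close> in the denominator keeps the bound meaningful for
  \<open>c = 0\<close> and makes the inequality strict.\<close>

lemma scaled_interval:
  fixes c :: real assumes "\<bar>s\<bar> < e / (\<bar>c\<bar> + 1)" shows "c * s \<in> {-e<..<e}"
proof -
  have "\<bar>c * s\<bar> \<le> (\<bar>c\<bar> + 1) * \<bar>s\<bar>" by (simp add: abs_mult algebra_simps)
  also have "\<dots> < (\<bar>c\<bar> + 1) * (e / (\<bar>c\<bar> + 1))" using assms by (intro mult_strict_left_mono) auto
  also have "\<dots> = e" by (simp add: add_nonneg_eq_0_iff)
  finally show ?thesis by auto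
qed

section \<open>The Lie algebra of a closed complex matrix group\<close>

locale lie_group =
  fixes G :: "(complex^'n::finite^'n) set"
  assumes G: "complex_matrix_lie_group G"
begin

lemma invertible_G [simp]: "A \<in> G \<Longrightarrow> invertible A"
  and one_G [simp]: "mat 1 \<in> G"
  and mult_G [simp]: "A \<in> G \<Longrightarrow> A' \<in> G \<Longrightarrow> A ** A' \<in> G"
  and inv_G [simp]: "A \<in> G \<Longrightarrow> matrix_inv A \<in> G"
  using G by (auto simp: complex_matrix_lie_group_def)

text \<open>Left translation by the inverse of \<open>\<gamma> s0\<close>, together with a shift of
  the parameter, turns the curve into one through the identity at time \<open>0\<close>, as the
  definition of the Lie algebra demands.\<close>

lemma left_log_derivative_in:
  assumes \<gamma>: "Cinf_on U \<gamma>" "s0 \<in> U" "\<And>s. s \<in> U \<Longrightarrow> \<gamma> s \<in> G" and X: "(\<gamma> has_vector_derivative X) (at s0)"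
  shows "matrix_inv (\<gamma> s0) ** X \<in> matrix_lie_algebra G"
proof -
  obtain e where e: "e > 0" "ball s0 e \<subseteq> U"
    using Cinf_on_open[OF \<gamma>(1)] \<gamma>(2) open_contains_ball by blast
  have U: "s0 + s \<in> U" if "s \<in> {-e<..<e}" for s
    using that e(2) by (auto simp: subset_iff dist_norm)
  let ?c = "\<lambda>s. matrix_inv (\<gamma> s0) ** \<gamma> (s0 + s)"
  have "Cinf_on {-e<..<e} ?c"
    by (intro Cinf_on_matrix_mult Cinf_on_const Cinf_on_compose[OF \<gamma>(1)] Cinf_on_shift) (auto simp: U)
  moreover have "(?c has_vector_derivative matrix_inv (\<gamma> s0) ** X) (at 0)"
  proof (intro bounded_linear.has_vector_derivative[OF bounded_bilinear.bounded_linear_right[OF bounded_bilinear_matrix_mult]])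
    have "((\<lambda>s. s0 + s) has_vector_derivative 1) (at 0)"
      by (auto intro!: derivative_eq_intros)
    from vector_diff_chain_at[OF this, of \<gamma> X] show "((\<lambda>s. \<gamma> (s0 + s)) has_vector_derivative X) (at 0)"
      using X by (simp add: o_def)
  qed
  moreover have "?c s \<in> G" if "s \<in> {-e<..<e}" for s
    using \<gamma> U[OF that] by simp
  ultimately show ?thesis
    unfolding matrix_lie_algebra_iff using e \<gamma> by (intro exI[of _ ?c] exI[of _ e]) auto
qed

lemma Ad_in: "A \<in> G \<Longrightarrow> X \<in> matrix_lie_algebra G \<Longrightarrow> A ** X ** matrix_inv A \<in> matrix_lie_algebra G"
proof -
  assume A: "A \<in> G" and "X \<in> matrix_lie_algebra G"
  then obtain \<gamma> e where \<gamma>: "e > 0" "Cinf_on {-e<..<e} \<gamma>" "\<And>s. s\<in>{-e<..<e} \<Longrightarrow> \<gamma> s \<in> G" "\<gamma> 0 = mat 1"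
      "(\<gamma> has_vector_derivative X) (at (0::real))"
    unfolding matrix_lie_algebra_iff by blast
  have "((\<lambda>s. A ** \<gamma> s ** matrix_inv A) has_vector_derivative A ** X ** matrix_inv A) (at 0)"
    by (intro bounded_linear.has_vector_derivative[OF bounded_bilinear.bounded_linear_right[OF bounded_bilinear_matrix_mult]]
        bounded_linear.has_vector_derivative[OF bounded_bilinear.bounded_linear_left[OF bounded_bilinear_matrix_mult]] \<gamma>)
  with \<gamma> A show ?thesis
    unfolding matrix_lie_algebra_iff
    by (intro exI[of _ "\<lambda>s. A ** \<gamma> s ** matrix_inv A"] exI[of _ e])
       (auto intro!: Cinf_on_matrix_mult Cinf_on_const)
qed

lemma Ad_inv_in: "A \<in> G \<Longrightarrow> X \<in> matrix_lie_algebra G \<Longrightarrow> matrix_inv A ** X ** A \<in> matrix_lie_algebra G"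
  using Ad_in[of "matrix_inv A" X] by simp

lemma right_log_derivative_in:
  assumes "Cinf_on U \<gamma>" "s0 \<in> U" "\<And>s. s \<in> U \<Longrightarrow> \<gamma> s \<in> G" "(\<gamma> has_vector_derivative X) (at s0)"
  shows "X ** matrix_inv (\<gamma> s0) \<in> matrix_lie_algebra G"
  using Ad_in[OF assms(3)[OF assms(2)] left_log_derivative_in[OF assms]] assms(3)[OF assms(2)]
  by (simp add: matrix_assoc)

text \<open>Sums come from pointwise products of curves, real multiples from reparametrised
  curves.\<close>

lemma subspace_lie_algebra: "subspace (matrix_lie_algebra G)"
proof (rule subspaceI)
  show "0 \<in> matrix_lie_algebra G"
    unfolding matrix_lie_algebra_iff
    by (intro exI[of _ "\<lambda>s. mat 1"] exI[of _ 1]) (auto intro: Cinf_on_const)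
next
  fix X Y assume "X \<in> matrix_lie_algebra G" "Y \<in> matrix_lie_algebra G"
  then obtain \<gamma> e \<delta> d where \<gamma>: "e > 0" "Cinf_on {-e<..<e} \<gamma>" "\<And>s. s\<in>{-e<..<e} \<Longrightarrow> \<gamma> s \<in> G" "\<gamma> 0 = mat 1"
      "(\<gamma> has_vector_derivative X) (at (0::real))"
    and \<delta>: "d > 0" "Cinf_on {-d<..<d} \<delta>" "\<And>s. s\<in>{-d<..<d} \<Longrightarrow> \<delta> s \<in> G" "\<delta> 0 = mat 1"
      "(\<delta> has_vector_derivative Y) (at (0::real))"
    unfolding matrix_lie_algebra_iff by metis
  have "((\<lambda>s. \<gamma> s ** \<delta> s) has_vector_derivative \<gamma> 0 ** Y + X ** \<delta> 0) (at 0)"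
    by (intro has_vector_derivative_matrix_mult \<gamma> \<delta>)
  moreover have "Cinf_on {-min e d<..<min e d} (\<lambda>s. \<gamma> s ** \<delta> s)"
    by (intro Cinf_on_matrix_mult Cinf_on_subset[OF \<gamma>(2)] Cinf_on_subset[OF \<delta>(2)]) auto
  ultimately show "X + Y \<in> matrix_lie_algebra G"
    unfolding matrix_lie_algebra_iff using \<gamma> \<delta>
    by (intro exI[of _ "\<lambda>s. \<gamma> s ** \<delta> s"] exI[of _ "min e d"]) (auto simp: add.commute)
next
  fix c X assume "X \<in> matrix_lie_algebra G"
  then obtain \<gamma> e where \<gamma>: "e > 0" "Cinf_on {-e<..<e} \<gamma>" "\<And>s. s\<in>{-e<..<e} \<Longrightarrow> \<gamma> s \<in> G" "\<gamma> 0 = mat 1"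
      "(\<gamma> has_vector_derivative X) (at (0::real))"
    unfolding matrix_lie_algebra_iff by blast
  define d where "d = e / (\<bar>c\<bar> + 1)"
  have d: "d > 0" using \<gamma> by (simp add: d_def)
  have in_e: "c * s \<in> {-e<..<e}" if "s \<in> {-d<..<d}" for s
    using scaled_interval[of s e c] that by (simp add: d_def abs_less_iff)
  have "((\<lambda>s. c * s) has_vector_derivative c) (at 0)"
    by (auto intro!: derivative_eq_intros simp: has_vector_derivative_def)
  from vector_diff_chain_at[OF this, of \<gamma> X]
  have "((\<lambda>s. \<gamma> (c * s)) has_vector_derivative c *\<^sub>R X) (at 0)"
    using \<gamma> by (simp add: o_def)
  moreover have "Cinf_on {-d<..<d} (\<lambda>s. \<gamma> (c * s))"
    by (intro Cinf_on_compose[OF \<gamma>(2)] Cinf_on_scaleR_right) (use in_e in auto)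
  ultimately show "c *\<^sub>R X \<in> matrix_lie_algebra G"
    unfolding matrix_lie_algebra_iff using \<gamma> d in_e
    by (intro exI[of _ "\<lambda>s. \<gamma> (c * s)"] exI[of _ d]) auto
qed

lemmas add_lie_algebra = subspace_add[OF subspace_lie_algebra]
  and scaleR_lie_algebra = subspace_scale[OF subspace_lie_algebra]

text \<open>Closure under multiplication by the imaginary unit is part of the definition of a
  complex group; the real subspace structure supplies the rest.\<close>

lemma cscale_lie_algebra: "X \<in> matrix_lie_algebra G \<Longrightarrow> c *\<^sub>C X \<in> matrix_lie_algebra G"
  using G by (subst cscale_conv_scaleR)
    (auto simp: complex_matrix_lie_group_def intro!: add_lie_algebra scaleR_lie_algebra)

text \<open>The commutator is the derivative at \<open>0\<close> of the conjugates of
  \<open>Y\<close> along a curve with velocity \<open>X\<close>, and these conjugates stay in a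
  linear subspace.\<close>

lemma commutator_lie_algebra:
  assumes X: "X \<in> matrix_lie_algebra G" and Y: "Y \<in> matrix_lie_algebra G"
  shows "commutator X Y \<in> matrix_lie_algebra G"
proof -
  obtain \<gamma> e where \<gamma>: "e > 0" "Cinf_on {-e<..<e} \<gamma>" "\<And>s. s\<in>{-e<..<e} \<Longrightarrow> \<gamma> s \<in> G" "\<gamma> 0 = mat 1"
      "(\<gamma> has_vector_derivative X) (at (0::real))"
    using X unfolding matrix_lie_algebra_iff by blast
  have inv: "((\<lambda>s. matrix_inv (\<gamma> s)) has_vector_derivative - (matrix_inv (\<gamma> 0) ** X ** matrix_inv (\<gamma> 0))) (at 0)"
    by (rule has_vector_derivative_matrix_inv[OF \<gamma>(2) _ _ \<gamma>(5)]) (use \<gamma> in auto)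
  have "((\<lambda>s. (\<gamma> s ** Y) ** matrix_inv (\<gamma> s)) has_vector_derivative
      (\<gamma> 0 ** Y) ** (- (matrix_inv (\<gamma> 0) ** X ** matrix_inv (\<gamma> 0))) + (\<gamma> 0 ** 0 + X ** Y) ** matrix_inv (\<gamma> 0)) (at 0)"
    by (intro has_vector_derivative_matrix_mult inv \<gamma> has_vector_derivative_const)
  then have "((\<lambda>s. (\<gamma> s ** Y) ** matrix_inv (\<gamma> s)) has_vector_derivative commutator X Y) (at 0)"
    by (simp add: \<gamma> commutator_def matrix_simps)
  then show ?thesis
    by (rule has_vector_derivative_in_subspace[OF subspace_lie_algebra, where U="{-e<..<e}"])
       (use \<gamma> Y Ad_in in auto)
qed

end

section \<open>Lie algebras of loop groups\<close>

lemma smooth_loops_iff: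
  "f \<in> smooth_loops S \<longleftrightarrow> Cinf_on UNIV f \<and> (\<forall>\<theta>. f (\<theta> + 2 * pi) = f \<theta>) \<and> (\<forall>\<theta>. f \<theta> \<in> S)"
  by (simp add: smooth_loops_def smooth_on_open_iff)

lemma loop_curve_iff:
  "loop_curve \<epsilon> H \<gamma> \<longleftrightarrow> Cinf_on ({-\<epsilon><..<\<epsilon>} \<times> UNIV) (\<lambda>(s,\<theta>). \<gamma> s \<theta>) \<and> (\<forall>s\<in>{-\<epsilon><..<\<epsilon>}. \<gamma> s \<in> H)"
  by (simp add: loop_curve_def smooth_on_open_iff open_Times)

lemmas loop_ops = lmul_def linv_def ladd_def lneg_def lone_def

lemma has_vector_derivative_partial_fst:
  fixes F :: "real \<Rightarrow> 'a::euclidean_space \<Rightarrow> 'b::real_normed_vector"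
  assumes "Cinf_on U (\<lambda>(s,x). F s x)" "(s, x) \<in> U"
  shows "((\<lambda>s. F s x) has_vector_derivative frechet_derivative (\<lambda>(s,x). F s x) (at (s,x)) (1,0)) (at s)"
proof -
  have "((\<lambda>s. (s, x)) has_vector_derivative (1, 0)) (at s)"
    by (auto intro!: derivative_eq_intros simp: has_vector_derivative_def)
  from has_vector_derivative_along[OF assms(1) _ this] show ?thesis using assms(2) by simp
qed

lemma has_vector_derivative_partial_snd:
  fixes F :: "'a::euclidean_space \<Rightarrow> real \<Rightarrow> 'b::real_normed_vector"
  assumes "Cinf_on U (\<lambda>(x,s). F x s)" "(x, s) \<in> U"
  shows "((\<lambda>s. F x s) has_vector_derivative frechet_derivative (\<lambda>(x,s). F x s) (at (x,s)) (0,1)) (at s)"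
proof -
  have "((\<lambda>s. (x, s)) has_vector_derivative (0, 1)) (at s)"
    by (auto intro!: derivative_eq_intros simp: has_vector_derivative_def)
  from has_vector_derivative_along[OF assms(1) _ this] show ?thesis using assms(2) by simp
qed

lemma Cinf_on_section:
  assumes "Cinf_on U (\<lambda>(s,x). F s x)" "open V" "\<And>x. x \<in> V \<Longrightarrow> (s, x) \<in> U"
  shows "Cinf_on V (F s)"
  using Cinf_on_compose[OF assms(1) Cinf_on_Pair[OF Cinf_on_const[OF assms(2)] Cinf_on_ident[OF assms(2)]]]
    assms(3) by simp

lemma Cinf_on_cis: "Cinf_on UNIV cis"
proof -
  have "Ck_on n UNIV cis" for n
  proof (induction n)
    case 0
    show ?case by (simp add: continuous_on_cis)
  next
    case (Suc n)
    have "(cis has_derivative (\<lambda>v. (v * 1) *\<^sub>R (\<i> * cis \<theta>))) (at \<theta>)" for \<theta>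
      using has_derivative_cis[of "\<lambda>x. x" "\<lambda>v. v" \<theta> UNIV] by simp
    then have "(cis has_derivative (\<lambda>v. v *\<^sub>R (\<i> * cis \<theta>))) (at \<theta>)" for \<theta> by simp
    then show ?case
      by (rule Ck_on_SucI[OF open_UNIV])
         (intro Ck_on_bilinear[OF _ bounded_bilinear_scaleR] Ck_on_bilinear[OF _ bounded_bilinear_mult] Ck_on_const Suc, auto)
  qed
  then show ?thesis by (simp add: Cinf_on_def)
qed

lemma inverse_i_cis: "1 / (\<i> * cis \<theta>) = - \<i> * cis (- \<theta>)"
  by (simp add: field_simps cis_mult)

lemma Cinf_on_cis_mult: "Cinf_on UNIV (\<lambda>\<theta>. cis (c * \<theta>))"
  by (rule Cinf_on_compose[OF Cinf_on_cis Cinf_on_scaleR_right]) auto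

lemma cis_periodic: "cis (\<theta> + 2 * pi) = cis \<theta>"
  by (simp add: cis.ctr)

text \<open>\<open>vector_derivative\<close> is a choice among all candidates and no
  differentiability is assumed, so the candidate sets at the two points are shown to coincide. That
  takes a shift by the period in both directions.\<close>

lemma vector_derivative_periodic:
  assumes "\<And>\<theta>. f (\<theta> + 2 * pi) = f \<theta>"
  shows "vector_derivative f (at (\<theta> + 2 * pi)) = vector_derivative f (at \<theta>)"
proof -
  have shift: "(f has_vector_derivative d) (at \<phi>)"
    if "(f has_vector_derivative d) (at (\<phi> + c))" "\<And>\<theta>. f (\<theta> + c) = f \<theta>" for d \<phi> c
  proof -
    have "((\<lambda>\<theta>. \<theta> + c) has_vector_derivative 1) (at \<phi>)"
      by (auto intro!: derivative_eq_intros)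
    from vector_diff_chain_at[OF this that(1)] show ?thesis by (simp add: o_def that(2))
  qed
  have "f (\<theta> + - (2 * pi)) = f \<theta>" for \<theta>
    using assms[of "\<theta> - 2 * pi"] by simp
  then have "(f has_vector_derivative d) (at (\<theta> + 2 * pi)) \<longleftrightarrow> (f has_vector_derivative d) (at \<theta>)" for d
    using shift[of d "\<theta> + 2 * pi" "- (2 * pi)"] shift[of d \<theta> "2 * pi"] assms by auto
  then show ?thesis by (simp add: vector_derivative_def)
qed

lemma Cinf_on_loop:
  assumes "Cinf_on UNIV f" "open U" shows "Cinf_on U (\<lambda>x. f (snd x))"
  using Cinf_on_compose[OF assms(1) Cinf_on_snd[OF assms(2)]] by simp

section \<open>Membership in the loop algebra of the ingredients of the vector field\<close>

context lie_group
begin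

lemma right_log_derivative_loop:
  assumes f: "f \<in> loop_group G"
  shows "dlam f \<odot> linv f \<in> loop_algebra G"
proof -
  have f': "Cinf_on UNIV f" "\<And>\<theta>. f (\<theta> + 2 * pi) = f \<theta>" "\<And>\<theta>. f \<theta> \<in> G"
    using f by (auto simp: loop_group_def smooth_loops_iff)
  have eq: "dlam f \<odot> linv f = (\<lambda>\<theta>. (- \<i> * cis (-1 * \<theta>)) *\<^sub>C (vector_derivative f (at \<theta>) ** matrix_inv (f \<theta>)))"
    by (simp add: loop_ops dlam_def inverse_i_cis matrix_cscale_left)
  have "Cinf_on UNIV (\<lambda>\<theta>. (- \<i> * cis (-1 * \<theta>)) *\<^sub>C (vector_derivative f (at \<theta>) ** matrix_inv (f \<theta>)))"
    by (intro Cinf_on_bilinear[OF bounded_bilinear_cscale] Cinf_on_bilinear[OF bounded_bilinear_mult]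
        Cinf_on_matrix_mult Cinf_on_vector_derivative Cinf_on_matrix_inv Cinf_on_const Cinf_on_cis_mult f')
       (use f' in auto)
  moreover have "vector_derivative f (at \<theta>) ** matrix_inv (f \<theta>) \<in> matrix_lie_algebra G" for \<theta>
    using right_log_derivative_in[OF f'(1) _ f'(3) Cinf_on_has_vector_derivative[OF f'(1)]] by simp
  moreover have "cis (-1 * (\<theta> + 2 * pi)) = cis (-1 * \<theta>)" for \<theta>
    by (simp add: cis.ctr cos_diff sin_diff)
  ultimately show ?thesis
    unfolding eq loop_algebra_def smooth_loops_iff vector_derivative_periodic[of f, OF f'(2)] f'(2)
    by (simp only: cscale_lie_algebra simp_thms)
qed

lemma Ad_loop_algebra:
  assumes f: "f \<in> loop_group G" and \<xi>: "\<xi> \<in> loop_algebra G"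
  shows "f \<odot> \<xi> \<odot> linv f \<in> loop_algebra G"
  using assms unfolding loop_ops loop_group_def loop_algebra_def smooth_loops_iff
  by (auto intro!: Cinf_on_matrix_mult Cinf_on_matrix_inv Ad_in)

lemma lpow_loop_algebra:
  assumes \<xi>: "\<xi> \<in> loop_algebra G"
  shows "lpow k \<xi> \<in> loop_algebra G"
  using assms unfolding lpow_def loop_algebra_def smooth_loops_iff
  by (auto intro!: cscale_lie_algebra Cinf_on_bilinear[OF bounded_bilinear_cscale] Cinf_on_cis_mult simp: cis_periodic)
     (simp add: cis_power_int Cinf_on_cis_mult)

lemma add_loop_algebra:
  assumes \<xi>: "\<xi> \<in> loop_algebra G" "\<eta> \<in> loop_algebra G"
  shows "\<xi> \<oplus> \<eta> \<in> loop_algebra G"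
  using assms unfolding loop_ops loop_algebra_def smooth_loops_iff
  by (auto intro!: add_lie_algebra Cinf_on_add)

lemma Cprime1_loop_algebra:
  assumes "local_group_hom G C"
  shows "Cprime1 C \<in> loop_algebra G"
proof -
  obtain e where e: "e > 0" "Cinf_on {-e<..<e} (\<lambda>\<theta>. C (cis \<theta>))" "\<And>z. z\<in>circle_arc e \<Longrightarrow> C z \<in> G"
    and mult: "\<And>z z'. z \<in> circle_arc e \<Longrightarrow> z'\<in>circle_arc e \<Longrightarrow> z * z' \<in> circle_arc e \<Longrightarrow> C (z * z') = C z ** C z'"
    using assms unfolding local_group_hom_def smooth_on_open_iff[OF open_greaterThanLessThan] by blast
  have arc: "cis \<theta> \<in> circle_arc e" if "\<theta> \<in> {-e<..<e}" for \<theta>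
    using that by (force simp: circle_arc_def)
  have 1: "1 \<in> circle_arc e" using arc[of 0] e by simp
  \<comment> \<open>Multiplicativity at \<open>1 * 1\<close> forces \<open>C 1\<close> to be the
    identity, so the left logarithmic derivative at angle \<open>0\<close> is the derivative
    itself.\<close>
  then have "C 1 = C 1 ** C 1" using mult[OF 1 1] by simp
  then have "matrix_inv (C 1) ** C 1 = matrix_inv (C 1) ** (C 1 ** C 1)" by simp
  then have C1: "C 1 = mat 1" using e(3)[OF 1] by simp
  have "((\<lambda>\<theta>. C (cis \<theta>)) has_vector_derivative vector_derivative (\<lambda>\<theta>. C (cis \<theta>)) (at 0)) (at 0)"
    by (rule Cinf_on_has_vector_derivative[OF e(2)]) (use e in auto)
  from left_log_derivative_in[OF e(2) _ _ this]
  have "vector_derivative (\<lambda>\<theta>. C (cis \<theta>)) (at 0) \<in> matrix_lie_algebra G"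
    using e arc by (simp add: C1)
  then show ?thesis
    by (simp add: Cprime1_def loop_algebra_def smooth_loops_iff dlam_def cscale_lie_algebra Cinf_on_const)
qed

section \<open>Lie algebras of subgroups of the loop group\<close>

lemma loop_subgroupD:
  assumes "loop_subgroup G H" "h \<in> H"
  shows "Cinf_on UNIV h" "h (\<theta> + 2 * pi) = h \<theta>" "h \<theta> \<in> G" "h \<in> loop_group G"
  using assms by (auto simp: loop_subgroup_def loop_group_def smooth_loops_iff)

text \<open>The loop version of the translation to the identity. The translated curve must again be
  jointly smooth in the parameter and in the angle, which is why joint smoothness of
  \<open>c\<close> is assumed.\<close>

lemma left_log_derivative_lie_algebra:
  assumes H: "loop_subgroup G H"
    and A: "open A" "s0 \<in> A" and c: "Cinf_on (A \<times> UNIV) (\<lambda>(s,\<theta>). c s \<theta>)" "\<And>s. s \<in> A \<Longrightarrow> c s \<in> H"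
  shows "linv (c s0) \<odot> (\<lambda>\<theta>. vector_derivative (\<lambda>s. c s \<theta>) (at s0)) \<in> lie_algebra H"
proof -
  obtain e where e: "e > 0" "ball s0 e \<subseteq> A" using A open_contains_ball by blast
  have inA: "s0 + s \<in> A" if "s \<in> {-e<..<e}" for s
    using that e(2) by (auto simp: subset_iff dist_norm)
  let ?\<gamma> = "\<lambda>s. linv (c s0) \<odot> c (s0 + s)"
  have s0: "c s0 \<in> H" using c(2) A(2) by simp
  have o: "open ({-e<..<e} \<times> (UNIV :: real set))" by (simp add: open_Times)
  have "Cinf_on ({-e<..<e} \<times> UNIV) (\<lambda>x. (\<lambda>(s,\<theta>). c s \<theta>) (s0 + fst x, snd x))"
    by (rule Cinf_on_compose[OF c(1)])
       (use inA in \<open>auto intro!: Cinf_on_Pair Cinf_on_add Cinf_on_const Cinf_on_fst Cinf_on_snd simp: o\<close>)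
  moreover have "Cinf_on UNIV (\<lambda>\<theta>. matrix_inv (c s0 \<theta>))"
    using loop_subgroupD[OF H s0] by (intro Cinf_on_matrix_inv) auto
  ultimately have "Cinf_on ({-e<..<e} \<times> UNIV) (\<lambda>x. matrix_inv (c s0 (snd x)) ** c (s0 + fst x) (snd x))"
    using o by (intro Cinf_on_matrix_mult Cinf_on_loop[of "\<lambda>\<theta>. matrix_inv (c s0 \<theta>)"]) auto
  then have "loop_curve e H ?\<gamma>"
    using H s0 c(2) inA unfolding loop_curve_iff loop_subgroup_def
    by (auto simp: loop_ops case_prod_unfold)
  moreover have "?\<gamma> 0 = lone"
    using loop_subgroupD(3)[OF H s0] by (simp add: loop_ops)
  moreover have "variation ?\<gamma> = linv (c s0) \<odot> (\<lambda>\<theta>. vector_derivative (\<lambda>s. c s \<theta>) (at s0))"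
  proof
    fix \<theta>
    have "((\<lambda>s. c s \<theta>) has_vector_derivative vector_derivative (\<lambda>s. c s \<theta>) (at s0)) (at s0)"
      using has_vector_derivative_partial_fst[OF c(1), of s0 \<theta>] A
      by (metis UNIV_I mem_Sigma_iff vector_derivative_at)
    moreover have "((\<lambda>s. s0 + s) has_vector_derivative 1) (at 0)"
      by (auto intro!: derivative_eq_intros)
    ultimately have "((\<lambda>s. c (s0 + s) \<theta>) has_vector_derivative vector_derivative (\<lambda>s. c s \<theta>) (at s0)) (at 0)"
      using vector_diff_chain_at[of "\<lambda>s. s0 + s" 1 0 "\<lambda>s. c s \<theta>"] by (simp add: o_def)
    then have "((\<lambda>s. matrix_inv (c s0 \<theta>) ** c (s0 + s) \<theta>) has_vector_derivative
         matrix_inv (c s0 \<theta>) ** vector_derivative (\<lambda>s. c s \<theta>) (at s0)) (at 0)"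
      by (rule bounded_linear.has_vector_derivative[OF bounded_bilinear.bounded_linear_right[OF bounded_bilinear_matrix_mult]])
    then show "variation ?\<gamma> \<theta> = (linv (c s0) \<odot> (\<lambda>\<theta>. vector_derivative (\<lambda>s. c s \<theta>) (at s0))) \<theta>"
      by (simp add: variation_def loop_ops vector_derivative_at)
  qed
  ultimately show ?thesis
    unfolding lie_algebra_def using e(1) by (metis (mono_tags, lifting) mem_Collect_eq)
qed

text \<open>Replaces the choice hidden in \<open>variation\<close> by an actual derivative at every
  angle, which joint smoothness guarantees.\<close>

lemma lie_algebraE:
  assumes "X \<in> lie_algebra H"
  obtains \<gamma> e where "e > 0" "Cinf_on ({-e<..<e} \<times> UNIV) (\<lambda>(s,\<theta>). \<gamma> s \<theta>)"
    "\<And>s. s \<in> {-e<..<e} \<Longrightarrow> \<gamma> s \<in> H" "\<gamma> 0 = lone"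
    "\<And>\<theta>. ((\<lambda>s. \<gamma> s \<theta>) has_vector_derivative X \<theta>) (at 0)"
proof -
  obtain \<gamma> e where \<gamma>: "e > 0" "loop_curve e H \<gamma>" "\<gamma> 0 = lone" "X = variation \<gamma>"
    using assms unfolding lie_algebra_def by blast
  have "((\<lambda>s. \<gamma> s \<theta>) has_vector_derivative X \<theta>) (at 0)" for \<theta>
    using has_vector_derivative_partial_fst[of "{-e<..<e} \<times> UNIV" \<gamma> 0 \<theta>] \<gamma>
    by (auto simp: variation_def loop_curve_iff vector_derivative_at)
  then show ?thesis using that \<gamma> unfolding loop_curve_iff by blast
qed

lemma lie_algebraI:
  assumes "e > 0" "Cinf_on ({-e<..<e} \<times> UNIV) (\<lambda>(s,\<theta>). \<gamma> s \<theta>)"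
    "\<And>s. s \<in> {-e<..<e} \<Longrightarrow> \<gamma> s \<in> H" "\<gamma> 0 = lone"
    "\<And>\<theta>. ((\<lambda>s. \<gamma> s \<theta>) has_vector_derivative X \<theta>) (at 0)"
  shows "X \<in> lie_algebra H"
proof -
  have "X = variation \<gamma>" using vector_derivative_at[OF assms(5)] by (simp add: fun_eq_iff variation_def)
  then show ?thesis using assms unfolding lie_algebra_def loop_curve_iff by blast
qed

lemma zero_in_lie_algebra: "loop_subgroup G H \<Longrightarrow> (\<lambda>\<theta>. 0) \<in> lie_algebra H"
  by (rule lie_algebraI[where \<gamma>="\<lambda>s. lone" and e=1])
     (auto simp: loop_subgroup_def lone_def case_prod_unfold intro!: Cinf_on_const open_Times)

lemma add_in_lie_algebra:
  assumes H: "loop_subgroup G H" and X: "X \<in> lie_algebra H" and Y: "Y \<in> lie_algebra H"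
  shows "X \<oplus> Y \<in> lie_algebra H"
proof -
  obtain \<gamma> e where \<gamma>: "e > 0" "Cinf_on ({-e<..<e} \<times> UNIV) (\<lambda>(s,\<theta>). \<gamma> s \<theta>)"
    "\<And>s. s \<in> {-e<..<e} \<Longrightarrow> \<gamma> s \<in> H" "\<gamma> 0 = lone"
    "\<And>\<theta>. ((\<lambda>s. \<gamma> s \<theta>) has_vector_derivative X \<theta>) (at 0)"
    by (rule lie_algebraE[OF X], rule that)
  obtain \<delta> d where \<delta>: "d > 0" "Cinf_on ({-d<..<d} \<times> UNIV) (\<lambda>(s,\<theta>). \<delta> s \<theta>)"
    "\<And>s. s \<in> {-d<..<d} \<Longrightarrow> \<delta> s \<in> H" "\<delta> 0 = lone"
    "\<And>\<theta>. ((\<lambda>s. \<delta> s \<theta>) has_vector_derivative Y \<theta>) (at 0)"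
    by (rule lie_algebraE[OF Y], rule that)
  let ?e = "min e d"
  have "Cinf_on ({-?e<..<?e} \<times> UNIV) (\<lambda>x. (\<lambda>(s,\<theta>). \<gamma> s \<theta>) x ** (\<lambda>(s,\<theta>). \<delta> s \<theta>) x)"
    by (intro Cinf_on_matrix_mult Cinf_on_subset[OF \<gamma>(2)] Cinf_on_subset[OF \<delta>(2)]) (auto simp: open_Times)
  moreover have "((\<lambda>s. \<gamma> s \<theta> ** \<delta> s \<theta>) has_vector_derivative \<gamma> 0 \<theta> ** Y \<theta> + X \<theta> ** \<delta> 0 \<theta>) (at 0)" for \<theta>
    by (intro has_vector_derivative_matrix_mult \<gamma> \<delta>)
  ultimately show ?thesis using H \<gamma> \<delta>
    by (intro lie_algebraI[where \<gamma>="\<lambda>s. \<gamma> s \<odot> \<delta> s" and e="?e"])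
       (auto simp: loop_subgroup_def loop_ops case_prod_unfold add.commute)
qed

lemma scaleR_in_lie_algebra:
  assumes X: "X \<in> lie_algebra H"
  shows "(\<lambda>\<theta>. c *\<^sub>R X \<theta>) \<in> lie_algebra H"
proof -
  obtain \<gamma> e where \<gamma>: "e > 0" "Cinf_on ({-e<..<e} \<times> UNIV) (\<lambda>(s,\<theta>). \<gamma> s \<theta>)"
    "\<And>s. s \<in> {-e<..<e} \<Longrightarrow> \<gamma> s \<in> H" "\<gamma> 0 = lone"
    "\<And>\<theta>. ((\<lambda>s. \<gamma> s \<theta>) has_vector_derivative X \<theta>) (at 0)"
    by (rule lie_algebraE[OF X], rule that)
  define d where "d = e / (\<bar>c\<bar> + 1)"
  have d: "d > 0" using \<gamma>(1) by (simp add: d_def)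
  have in_e: "c * s \<in> {-e<..<e}" if "s \<in> {-d<..<d}" for s
    using scaled_interval[of s e c] that by (simp add: d_def abs_less_iff)
  have "Cinf_on ({-d<..<d} \<times> UNIV) (\<lambda>x. (\<lambda>(s,\<theta>). \<gamma> s \<theta>) (c * fst x, snd x))"
    by (rule Cinf_on_compose[OF \<gamma>(2)])
       (use in_e in \<open>auto intro!: Cinf_on_Pair Cinf_on_linear[OF bounded_linear_mult_right] Cinf_on_fst Cinf_on_snd simp: open_Times\<close>)
  moreover have "((\<lambda>s. \<gamma> (c * s) \<theta>) has_vector_derivative c *\<^sub>R X \<theta>) (at 0)" for \<theta>
  proof -
    have "((\<lambda>s. c * s) has_vector_derivative c) (at 0)"
      by (auto intro!: derivative_eq_intros simp: has_vector_derivative_def)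
    from vector_diff_chain_at[OF this, of "\<lambda>s. \<gamma> s \<theta>"] show ?thesis using \<gamma>(5)[of \<theta>] by (simp add: o_def)
  qed
  ultimately show ?thesis using \<gamma>(3,4) d in_e
    by (intro lie_algebraI[where \<gamma>="\<lambda>s. \<gamma> (c * s)" and e="d"]) (auto simp: case_prod_unfold)
qed

lemma neg_in_lie_algebra: "X \<in> lie_algebra H \<Longrightarrow> lneg X \<in> lie_algebra H"
  using scaleR_in_lie_algebra[of X H "-1"] by (simp add: lneg_def)

lemma Ad_in_lie_algebra:
  assumes H: "loop_subgroup G H" and h: "h \<in> H" and X: "X \<in> lie_algebra H"
  shows "h \<odot> X \<odot> linv h \<in> lie_algebra H"
proof -
  obtain \<gamma> e where \<gamma>: "e > 0" "Cinf_on ({-e<..<e} \<times> UNIV) (\<lambda>(s,\<theta>). \<gamma> s \<theta>)"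
    "\<And>s. s \<in> {-e<..<e} \<Longrightarrow> \<gamma> s \<in> H" "\<gamma> 0 = lone"
    "\<And>\<theta>. ((\<lambda>s. \<gamma> s \<theta>) has_vector_derivative X \<theta>) (at 0)"
    by (rule lie_algebraE[OF X], rule that)
  note hD = loop_subgroupD[OF H h]
  have "Cinf_on UNIV (\<lambda>\<theta>. matrix_inv (h \<theta>))"
    using hD by (intro Cinf_on_matrix_inv) auto
  then have "Cinf_on ({-e<..<e} \<times> UNIV) (\<lambda>x. h (snd x) ** (\<lambda>(s,\<theta>). \<gamma> s \<theta>) x ** matrix_inv (h (snd x)))"
    by (intro Cinf_on_matrix_mult \<gamma> Cinf_on_loop[OF hD(1)] Cinf_on_loop[of "\<lambda>\<theta>. matrix_inv (h \<theta>)"])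
       (auto simp: open_Times)
  moreover have "((\<lambda>s. h \<theta> ** \<gamma> s \<theta> ** matrix_inv (h \<theta>)) has_vector_derivative h \<theta> ** X \<theta> ** matrix_inv (h \<theta>)) (at 0)" for \<theta>
    by (intro bounded_linear.has_vector_derivative[OF bounded_bilinear.bounded_linear_right[OF bounded_bilinear_matrix_mult]]
        bounded_linear.has_vector_derivative[OF bounded_bilinear.bounded_linear_left[OF bounded_bilinear_matrix_mult]] \<gamma>)
  ultimately show ?thesis using \<gamma> H h hD(3)
    by (intro lie_algebraI[where \<gamma>="\<lambda>s. h \<odot> \<gamma> s \<odot> linv h" and e="e"])
       (auto simp: loop_subgroup_def loop_ops case_prod_unfold)
qed

lemma right_log_derivative_lie_algebra:
  assumes H: "loop_subgroup G H"
    and A: "open A" "s0 \<in> A" and c: "Cinf_on (A \<times> UNIV) (\<lambda>(s,\<theta>). c s \<theta>)" "\<And>s. s \<in> A \<Longrightarrow> c s \<in> H"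
  shows "(\<lambda>\<theta>. vector_derivative (\<lambda>s. c s \<theta>) (at s0)) \<odot> linv (c s0) \<in> lie_algebra H"
  using Ad_in_lie_algebra[OF H c(2)[OF A(2)] left_log_derivative_lie_algebra[OF H A c]]
    loop_subgroupD(3)[OF H c(2)[OF A(2)]]
  by (simp add: loop_ops matrix_assoc)

end

section \<open>Consequences of the splitting\<close>

locale loop_splitting = lie_group G for G :: "(complex^'n::finite^'n) set" +
  fixes Lp Lm :: "'n loop set"
  assumes splitting: "splitting G Lp Lm"
begin

lemma subgroup_plus: "loop_subgroup G Lp" and subgroup_minus: "loop_subgroup G Lm"
  using splitting by (auto simp: splitting_def)

text \<open>The inclusion is read off from the sum decomposition of the loop algebra by adding the
  zero element of the other summand.\<close>

lemma lie_algebra_plus_loop_algebra: "\<xi> \<in> lie_algebra Lp \<Longrightarrow> \<xi> \<in> loop_algebra G"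
proof -
  assume "\<xi> \<in> lie_algebra Lp"
  moreover have "\<xi> = \<xi> \<oplus> (\<lambda>\<theta>. 0)" by (simp add: ladd_def)
  ultimately show ?thesis
    using splitting zero_in_lie_algebra[OF subgroup_minus] unfolding splitting_def by blast
qed

lemma lie_algebra_minus_loop_algebra: "\<eta> \<in> lie_algebra Lm \<Longrightarrow> \<eta> \<in> loop_algebra G"
proof -
  assume "\<eta> \<in> lie_algebra Lm"
  moreover have "\<eta> = (\<lambda>\<theta>. 0) \<oplus> \<eta>" by (simp add: ladd_def)
  ultimately show ?thesis
    using splitting zero_in_lie_algebra[OF subgroup_plus] unfolding splitting_def by blast
qed

text \<open>Two decompositions differ by an element of both Lie algebras, hence by zero. This makes
  the definite description in \<open>proj_minus\<close> determinate.\<close>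

lemma proj_minus_eq:
  assumes "\<xi> \<in> lie_algebra Lp" "\<eta> \<in> lie_algebra Lm"
  shows "proj_minus Lp Lm (\<xi> \<oplus> \<eta>) = \<eta>"
  unfolding proj_minus_def
proof (rule the_equality)
  show "\<eta> \<in> lie_algebra Lm \<and> (\<exists>\<xi>'\<in>lie_algebra Lp. \<xi> \<oplus> \<eta> = \<xi>' \<oplus> \<eta>)" using assms by blast
next
  fix \<eta>' assume "\<eta>' \<in> lie_algebra Lm \<and> (\<exists>\<xi>'\<in>lie_algebra Lp. \<xi> \<oplus> \<eta> = \<xi>' \<oplus> \<eta>')"
  then obtain \<xi>' where *: "\<eta>' \<in> lie_algebra Lm" "\<xi>' \<in> lie_algebra Lp" "\<xi> \<oplus> \<eta> = \<xi>' \<oplus> \<eta>'" by blast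
  have "\<xi> \<oplus> lneg \<xi>' = \<eta>' \<oplus> lneg \<eta>"
  proof
    fix \<theta>
    have "\<xi> \<theta> + \<eta> \<theta> = \<xi>' \<theta> + \<eta>' \<theta>" using fun_cong[OF *(3)] by (simp add: ladd_def)
    then show "(\<xi> \<oplus> lneg \<xi>') \<theta> = (\<eta>' \<oplus> lneg \<eta>) \<theta>"
      by (simp add: loop_ops algebra_simps)
  qed
  moreover have "\<xi> \<oplus> lneg \<xi>' \<in> lie_algebra Lp" "\<eta>' \<oplus> lneg \<eta> \<in> lie_algebra Lm"
    using assms * by (auto intro!: add_in_lie_algebra neg_in_lie_algebra subgroup_plus subgroup_minus)
  ultimately have "\<eta>' \<oplus> lneg \<eta> \<in> {\<lambda>\<theta>. 0}" using splitting unfolding splitting_def by auto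
  then show "\<eta>' = \<eta>" by (simp add: loop_ops fun_eq_iff)
qed

lemma splittingE:
  assumes "\<zeta> \<in> loop_algebra G"
  obtains \<xi> \<eta> where "\<xi> \<in> lie_algebra Lp" "\<eta> \<in> lie_algebra Lm" "\<zeta> = \<xi> \<oplus> \<eta>" "proj_minus Lp Lm \<zeta> = \<eta>"
proof -
  obtain \<xi> \<eta> where "\<xi> \<in> lie_algebra Lp" "\<eta> \<in> lie_algebra Lm" "\<zeta> = \<xi> \<oplus> \<eta>"
    using assms splitting unfolding splitting_def by blast
  then show ?thesis using that proj_minus_eq by blast
qed

text \<open>The quotient of the two minus factors equals that of the two plus factors, so it lies in
  both subgroups and is the identity. This will identify the factors occurring in
  \<open>mu_value\<close> with the reduced frame and the frame.\<close>

lemma factorization_unique: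
  assumes "p \<in> Lp" "p' \<in> Lp" "m \<in> Lm" "m' \<in> Lm" and eq: "linv m \<odot> p = linv m' \<odot> p'"
  shows "m = m'" "p = p'"
proof -
  have G: "m \<theta> \<in> G" "m' \<theta> \<in> G" "p \<theta> \<in> G" "p' \<theta> \<in> G" for \<theta>
    using assms loop_subgroupD(3) subgroup_plus subgroup_minus by blast+
  have eq': "matrix_inv (m \<theta>) ** p \<theta> = matrix_inv (m' \<theta>) ** p' \<theta>" for \<theta>
    using fun_cong[OF eq, of \<theta>] by (simp add: loop_ops)
  have "m' \<theta> ** (matrix_inv (m \<theta>) ** p \<theta>) ** matrix_inv (p \<theta>) = m' \<theta> ** (matrix_inv (m' \<theta>) ** p' \<theta>) ** matrix_inv (p \<theta>)" for \<theta>
    by (simp add: eq')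
  then have "m' \<odot> linv m = p' \<odot> linv p"
    using G by (simp add: loop_ops fun_eq_iff matrix_assoc)
  moreover have "m' \<odot> linv m \<in> Lm" "p' \<odot> linv p \<in> Lp"
    using assms subgroup_plus subgroup_minus by (auto simp: loop_subgroup_def)
  ultimately have 1: "m' \<odot> linv m = lone" "p' \<odot> linv p = lone"
    using splitting unfolding splitting_def by auto
  have "m' \<theta> ** matrix_inv (m \<theta>) ** m \<theta> = m \<theta>" "p' \<theta> ** matrix_inv (p \<theta>) ** p \<theta> = p \<theta>" for \<theta>
    using fun_cong[OF 1(1), of \<theta>] fun_cong[OF 1(2), of \<theta>] by (simp_all add: loop_ops)
  then show "m = m'" "p = p'" using G by (auto simp: fun_eq_iff matrix_assoc)
qed

end

section \<open>Variations of the frame and of the reduced frame\<close>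

locale dressing = loop_splitting G Lp Lm
  for G :: "(complex^'n::finite^'n) set" and Lp Lm :: "'n loop set" +
  fixes V :: "'n loop" and f M E :: "real \<Rightarrow> 'n loop" and \<epsilon> :: real
  assumes eps: "\<epsilon> > 0"
    and f_curve: "loop_curve \<epsilon> Lm f"
    and M_curve: "loop_curve \<epsilon> Lm M"
    and E_in: "u \<in> {-\<epsilon><..<\<epsilon>} \<Longrightarrow> E u \<in> Lp"
    and factor: "u \<in> {-\<epsilon><..<\<epsilon>} \<Longrightarrow> V \<odot> linv (f u) = linv (M u) \<odot> E u"
begin

lemma f_in: "u \<in> {-\<epsilon><..<\<epsilon>} \<Longrightarrow> f u \<in> Lm" and M_in: "u \<in> {-\<epsilon><..<\<epsilon>} \<Longrightarrow> M u \<in> Lm"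
  and Cinf_f: "Cinf_on ({-\<epsilon><..<\<epsilon>} \<times> UNIV) (\<lambda>(u,\<theta>). f u \<theta>)"
  and Cinf_M: "Cinf_on ({-\<epsilon><..<\<epsilon>} \<times> UNIV) (\<lambda>(u,\<theta>). M u \<theta>)"
  using f_curve M_curve by (auto simp: loop_curve_iff)

lemma in_G: assumes "u \<in> {-\<epsilon><..<\<epsilon>}" shows "f u \<theta> \<in> G" "M u \<theta> \<in> G" "E u \<theta> \<in> G"
  using assms f_in M_in E_in loop_subgroupD(3) subgroup_plus subgroup_minus by blast+

lemma zero_in: "0 \<in> {-\<epsilon><..<\<epsilon>}" using eps by simp

lemma factor_at: "u \<in> {-\<epsilon><..<\<epsilon>} \<Longrightarrow> V \<theta> ** matrix_inv (f u \<theta>) = matrix_inv (M u \<theta>) ** E u \<theta>"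
  using fun_cong[OF factor, of u \<theta>] by (simp add: loop_ops)

lemma V_eq: "u \<in> {-\<epsilon><..<\<epsilon>} \<Longrightarrow> V \<theta> = matrix_inv (M u \<theta>) ** E u \<theta> ** f u \<theta>"
  using factor_at[of u \<theta>, symmetric] in_G(1)[of u \<theta>] by (simp add: matrix_assoc)

lemma E_eq: "u \<in> {-\<epsilon><..<\<epsilon>} \<Longrightarrow> E u \<theta> = M u \<theta> ** V \<theta> ** matrix_inv (f u \<theta>)"
  using factor_at[of u \<theta>] in_G(2)[of u \<theta>] by (simp add: matrix_assoc)

text \<open>In this locale \<open>V\<close> is an arbitrary function; that it is a smooth loop
  follows from solving the factorization at \<open>u = 0\<close> for it.\<close>

lemma V_in: "V \<in> loop_group G"
proof -
  have "V = linv (M 0) \<odot> E 0 \<odot> f 0"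
    using V_eq[OF zero_in] by (simp add: loop_ops fun_eq_iff)
  moreover have "Cinf_on UNIV (linv (M 0) \<odot> E 0 \<odot> f 0)"
    unfolding loop_ops
    by (intro Cinf_on_matrix_mult Cinf_on_matrix_inv)
       (use zero_in f_in M_in E_in subgroup_plus subgroup_minus loop_subgroupD in_G in auto)
  ultimately show ?thesis
    using loop_subgroupD(2)[OF subgroup_plus E_in[OF zero_in]] loop_subgroupD(2)[OF subgroup_minus f_in[OF zero_in]]
      loop_subgroupD(2)[OF subgroup_minus M_in[OF zero_in]] in_G[OF zero_in]
    by (auto simp: loop_group_def smooth_loops_iff loop_ops)
qed

text \<open>Joint smoothness of the frame is not assumed but obtained from
  \<open>E = M V f^(-1)\<close>, where \<open>V\<close> does not depend on \<open>u\<close>.\<close>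

lemma Cinf_E: "Cinf_on ({-\<epsilon><..<\<epsilon>} \<times> UNIV) (\<lambda>(u,\<theta>). E u \<theta>)"
proof (rule Cinf_on_cong)
  have "Cinf_on UNIV V" using V_in by (simp add: loop_group_def smooth_loops_iff)
  then show "Cinf_on ({-\<epsilon><..<\<epsilon>} \<times> UNIV)
      (\<lambda>x. (\<lambda>(u,\<theta>). M u \<theta>) x ** V (snd x) ** matrix_inv ((\<lambda>(u,\<theta>). f u \<theta>) x))"
    by (intro Cinf_on_matrix_mult Cinf_M Cinf_on_matrix_inv Cinf_f Cinf_on_loop)
       (auto simp: open_Times in_G)
qed (auto simp: E_eq)

lemma has_variation:
  assumes "Cinf_on ({-\<epsilon><..<\<epsilon>} \<times> UNIV) (\<lambda>(u,\<theta>). c u \<theta>)"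
  shows "((\<lambda>u. c u \<theta>) has_vector_derivative variation c \<theta>) (at 0)"
proof -
  have "(0, \<theta>) \<in> {-\<epsilon><..<\<epsilon>} \<times> UNIV" using zero_in by simp
  from has_vector_derivative_partial_fst[OF assms this] show ?thesis
    by (metis variation_def vector_derivative_at)
qed

text \<open>Differentiate \<open>M V = E f\<close> at \<open>u = 0\<close>, with \<open>V\<close>
  constant in \<open>u\<close>, and multiply on the right by the inverses of \<open>f 0\<close> and
  \<open>E 0\<close>.\<close>

lemma variation_identity:
  "variation M \<theta> ** matrix_inv (M 0 \<theta>) =
   E 0 \<theta> ** (variation f \<theta> ** matrix_inv (f 0 \<theta>)) ** matrix_inv (E 0 \<theta>) + variation E \<theta> ** matrix_inv (E 0 \<theta>)"
proof -
  have "((\<lambda>u. E u \<theta> ** f u \<theta>) has_vector_derivative E 0 \<theta> ** variation f \<theta> + variation E \<theta> ** f 0 \<theta>) (at 0)"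
    by (intro has_vector_derivative_matrix_mult has_variation Cinf_E Cinf_f)
  then have "((\<lambda>u. M u \<theta> ** V \<theta>) has_vector_derivative E 0 \<theta> ** variation f \<theta> + variation E \<theta> ** f 0 \<theta>) (at 0)"
    by (rule has_vector_derivative_transform_within_open[OF _ _ zero_in])
       (use in_G in \<open>auto simp: E_eq matrix_assoc\<close>)
  moreover have "((\<lambda>u. M u \<theta> ** V \<theta>) has_vector_derivative variation M \<theta> ** V \<theta>) (at 0)"
    by (intro bounded_linear.has_vector_derivative[OF bounded_bilinear.bounded_linear_left[OF bounded_bilinear_matrix_mult]]
        has_variation Cinf_M)
  ultimately have "variation M \<theta> ** V \<theta> = E 0 \<theta> ** variation f \<theta> + variation E \<theta> ** f 0 \<theta>"
    using vector_derivative_unique_at by blast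
  then have "variation M \<theta> ** V \<theta> ** matrix_inv (f 0 \<theta>) ** matrix_inv (E 0 \<theta>) =
    (E 0 \<theta> ** variation f \<theta> + variation E \<theta> ** f 0 \<theta>) ** matrix_inv (f 0 \<theta>) ** matrix_inv (E 0 \<theta>)"
    by simp
  then show ?thesis
    using in_G[OF zero_in, of \<theta>] by (simp add: V_eq[OF zero_in] matrix_assoc matrix_simps)
qed

lemma variation_E_in: "variation E \<odot> linv (E 0) \<in> lie_algebra Lp"
  unfolding variation_def
  by (rule right_log_derivative_lie_algebra[OF subgroup_plus _ zero_in Cinf_E]) (auto simp: E_in)

lemma variation_M_in: "variation M \<odot> linv (M 0) \<in> lie_algebra Lm"
  unfolding variation_def
  by (rule right_log_derivative_lie_algebra[OF subgroup_minus _ zero_in Cinf_M]) (auto simp: M_in)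

text \<open>Conjugating \<open>X_-\<close> by \<open>E 0\<close> gives the right logarithmic
  variation of \<open>E\<close> minus that of \<open>M\<close>; conjugating \<open>X_+\<close> stays
  in the plus algebra. The full decomposition is recorded, not just its projection, because the tau
  computation compares the plus part with another element of that algebra.\<close>

lemma dressed_field_decomposition:
  assumes X: "X \<in> loop_algebra G" and f': "variation f = lneg (proj_minus Lp Lm X) \<odot> f 0"
  obtains \<xi> where "\<xi> \<in> lie_algebra Lp" "E 0 \<odot> X \<odot> linv (E 0) = \<xi> \<oplus> lneg (variation M \<odot> linv (M 0))"
proof -
  obtain \<xi> \<eta> where X: "\<xi> \<in> lie_algebra Lp" "\<eta> \<in> lie_algebra Lm" "X = \<xi> \<oplus> \<eta>" "proj_minus Lp Lm X = \<eta>"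
    using splittingE[OF X] .
  have "variation M \<theta> ** matrix_inv (M 0 \<theta>) =
      variation E \<theta> ** matrix_inv (E 0 \<theta>) - E 0 \<theta> ** (\<eta> \<theta> ** matrix_inv (E 0 \<theta>))" for \<theta>
    using variation_identity[of \<theta>] in_G[OF zero_in, of \<theta>]
    by (simp add: f' X(4) loop_ops matrix_assoc matrix_simps)
  then have "E 0 \<odot> X \<odot> linv (E 0) = ((E 0 \<odot> \<xi> \<odot> linv (E 0)) \<oplus> (variation E \<odot> linv (E 0)))
      \<oplus> lneg (variation M \<odot> linv (M 0))"
    by (simp add: X(3) loop_ops fun_eq_iff matrix_simps matrix_assoc)
  moreover have "(E 0 \<odot> \<xi> \<odot> linv (E 0)) \<oplus> (variation E \<odot> linv (E 0)) \<in> lie_algebra Lp"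
    by (intro add_in_lie_algebra Ad_in_lie_algebra subgroup_plus X variation_E_in E_in zero_in)
  ultimately show ?thesis using that by blast
qed

lemma proj_minus_dressed:
  assumes "\<xi> \<in> lie_algebra Lp" "Y = \<xi> \<oplus> lneg (variation M \<odot> linv (M 0))"
  shows "variation M \<odot> linv (M 0) = lneg (proj_minus Lp Lm Y)"
proof -
  have "proj_minus Lp Lm Y = lneg (variation M \<odot> linv (M 0))"
    unfolding assms(2) by (intro proj_minus_eq assms neg_in_lie_algebra subgroup_minus variation_M_in)
  then show ?thesis by (simp add: lneg_def)
qed

end

section \<open>The cocycle\<close>

text \<open>Expresses the derivative of a conjugate as a commutator, the form in which infinitesimal
  invariance of \<open>B\<close> can be applied.\<close>

lemma has_vector_derivative_commutator:
  fixes A :: "real \<Rightarrow> complex^'n^'n"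
  assumes A: "Cinf_on U A" "s \<in> U" and inv: "\<And>x. x \<in> U \<Longrightarrow> invertible (A x)"
    and A': "(A has_vector_derivative A') (at s)"
  shows "((\<lambda>x. matrix_inv (A x) ** X ** A x) has_vector_derivative
    - commutator (matrix_inv (A s) ** A') (matrix_inv (A s) ** X ** A s)) (at s)"
proof -
  have "((\<lambda>x. (matrix_inv (A x) ** X) ** A x) has_vector_derivative
     (matrix_inv (A s) ** X) ** A' + (matrix_inv (A s) ** 0 + (- (matrix_inv (A s) ** A' ** matrix_inv (A s))) ** X) ** A s) (at s)"
    by (intro has_vector_derivative_matrix_mult has_vector_derivative_matrix_inv[OF A inv] A' has_vector_derivative_const)
  moreover have "(matrix_inv (A s) ** X) ** A' + (matrix_inv (A s) ** 0 + (- (matrix_inv (A s) ** A' ** matrix_inv (A s))) ** X) ** A s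
     = - commutator (matrix_inv (A s) ** A') (matrix_inv (A s) ** X ** A s)"
    using inv[OF A(2)] by (simp add: commutator_def matrix_simps matrix_assoc)
  ultimately show ?thesis by metis
qed

text \<open>The pullback under \<open>F\<close> of the left Maurer-Cartan form, evaluated on the
  constant direction \<open>v\<close>.\<close>

definition left_log_deriv ::
  "('a::euclidean_space \<Rightarrow> complex^'n^'n) \<Rightarrow> 'a \<Rightarrow> 'a \<Rightarrow> complex^'n^'n" where
  "left_log_deriv F v x = matrix_inv (F x) ** frechet_derivative F (at x) v"

lemma Cinf_on_left_log_deriv:
  "Cinf_on U F \<Longrightarrow> (\<And>x. x \<in> U \<Longrightarrow> invertible (F x)) \<Longrightarrow> Cinf_on U (left_log_deriv F v)"
  unfolding left_log_deriv_def
  by (intro Cinf_on_matrix_mult Cinf_on_matrix_inv Cinf_on_derivative)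

text \<open>With subscripts for directional derivatives, both sides equal
  \<open>F_vw F^(-1) - F_w F^(-1) F_v F^(-1)\<close>, once the second derivatives in
  \<open>v\<close> and \<open>w\<close> are exchanged.\<close>

lemma right_log_deriv_derivative:
  fixes F :: "'a::euclidean_space \<Rightarrow> complex^'n^'n"
  assumes F: "Cinf_on U F" "x \<in> U" and inv: "\<And>y. y \<in> U \<Longrightarrow> invertible (F y)"
  shows "frechet_derivative (\<lambda>y. frechet_derivative F (at y) w ** matrix_inv (F y)) (at x) v =
         F x ** frechet_derivative (left_log_deriv F v) (at x) w ** matrix_inv (F x)"
proof -
  let ?D = "\<lambda>v y. frechet_derivative F (at y) v"
  note mm = bounded_bilinear.FDERIV[OF bounded_bilinear_matrix_mult]
  note dinv = has_derivative_matrix_inv[OF F inv]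
  have D: "(?D v has_derivative frechet_derivative (?D v) (at x)) (at x)" for v
    by (rule Cinf_on_has_derivative[OF Cinf_on_derivative[OF F(1)] F(2)])
  have 1: "frechet_derivative (\<lambda>y. ?D w y ** matrix_inv (F y)) (at x) v =
     ?D w x ** (- (matrix_inv (F x) ** ?D v x ** matrix_inv (F x))) + frechet_derivative (?D w) (at x) v ** matrix_inv (F x)"
    using frechet_derivative_at[OF mm[OF D dinv], of w] by (metis (no_types, lifting))
  have 2: "frechet_derivative (left_log_deriv F v) (at x) w =
     matrix_inv (F x) ** frechet_derivative (?D v) (at x) w + (- (matrix_inv (F x) ** ?D w x ** matrix_inv (F x))) ** ?D v x"
    unfolding left_log_deriv_def
    using frechet_derivative_at[OF mm[OF dinv D], of v] by (metis (no_types, lifting))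
  show ?thesis
    unfolding 1 2 Cinf_on_derivative_commute[OF F, of v w]
    using inv[OF F(2)] by (simp add: matrix_simps matrix_assoc)
qed

text \<open>The difference quotient at \<open>0\<close> is \<open>K u\<close> itself, so continuity
  of \<open>K\<close> at \<open>0\<close> is enough. It is applied to the integral over a square of
  width proportional to \<open>u\<close>.\<close>

lemma continuous_has_vector_derivative_mult:
  fixes K :: "real \<Rightarrow> 'a::real_normed_vector"
  assumes "isCont K 0"
  shows "((\<lambda>u. u *\<^sub>R K u) has_vector_derivative K 0) (at 0)"
proof -
  have "((\<lambda>u. norm (K u - K 0)) \<longlongrightarrow> norm (K 0 - K 0)) (at 0)"
    using assms by (intro tendsto_intros) (simp add: isCont_def)
  moreover have "\<forall>\<^sub>F u in at 0. norm (K u - K 0) = norm (u *\<^sub>R K u - u *\<^sub>R K 0) / norm u"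
    by (auto simp: eventually_at_filter scaleR_diff_right[symmetric])
  ultimately have "((\<lambda>u. norm (u *\<^sub>R K u - u *\<^sub>R K 0) / norm u) \<longlongrightarrow> 0) (at 0)"
    using tendsto_cong by fastforce
  then show ?thesis
    unfolding has_vector_derivative_def
    by (simp add: has_derivative_at2 has_derivative_iff_norm bounded_linear_scaleR_left)
qed

lemma Cinf_on_integrable:
  fixes f :: "real \<Rightarrow> 'a::euclidean_space"
  assumes "Cinf_on UNIV f" shows "f integrable_on {a..b}"
  by (rule integrable_continuous_real[OF continuous_on_subset[OF Cinf_on_imp_continuous_on[OF assms] subset_UNIV]])

section \<open>The invariant form and its cocycle\<close>

locale lie_group_form = lie_group G for G :: "(complex^'n::finite^'n) set" +
  fixes B :: "complex^'n^'n \<Rightarrow> complex^'n^'n \<Rightarrow> complex"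
  assumes form: "invariant_form (matrix_lie_algebra G) B"
begin

text \<open>Off the Lie algebra \<open>B\<close> is unconstrained, so it is precomposed in both
  slots with a linear retraction. The hypotheses give linearity in the first slot; symmetry
  transfers it to the second, and finite dimension gives boundedness.\<close>

lemma form_extension:
  "\<exists>B'. bounded_bilinear B' \<and> (\<forall>X\<in>matrix_lie_algebra G. \<forall>Y\<in>matrix_lie_algebra G. B' X Y = B X Y)"
proof -
  obtain P where P: "linear P" "\<And>x. P x \<in> matrix_lie_algebra G" "\<And>x. x \<in> matrix_lie_algebra G \<Longrightarrow> P x = x"
    using subspace_projection[OF subspace_lie_algebra] by blast
  have add: "B (X + Y) Z = B X Z + B Y Z" and scale: "B (c *\<^sub>C X) Y = c * B X Y" and sym: "B X Y = B Y X"
    if "X \<in> matrix_lie_algebra G" "Y \<in> matrix_lie_algebra G" "Z \<in> matrix_lie_algebra G" for X Y Z c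
    using form that unfolding invariant_form_def by blast+
  have scaleR: "B (r *\<^sub>R X) Y = r *\<^sub>R B X Y"
    if "X \<in> matrix_lie_algebra G" "Y \<in> matrix_lie_algebra G" for X Y r
    using scale[OF that(1,2,2), of "of_real r"] by (simp add: cscale_of_real scaleR_conv_of_real)
  have lin: "linear (\<lambda>X. B (P X) (P Y))" for Y
    using P(1,2) add scaleR by (simp add: linear_iff)
  moreover have "(\<lambda>X. B (P Y) (P X)) = (\<lambda>X. B (P X) (P Y))" for Y
    by (rule ext) (rule sym[OF P(2) P(2) P(2)])
  ultimately have "linear (\<lambda>X. B (P Y) (P X))" for Y
    by simp
  then have "bilinear (\<lambda>X Y. B (P X) (P Y))"
    using lin by (simp add: bilinear_def)
  then have "bounded_bilinear (\<lambda>X Y. B (P X) (P Y))"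
    using bilinear_conv_bounded_bilinear by blast
  then show ?thesis using P(3) by (intro exI[of _ "\<lambda>X Y. B (P X) (P Y)"]) auto
qed

definition B_ext :: "complex^'n^'n \<Rightarrow> complex^'n^'n \<Rightarrow> complex" where
  "B_ext = (SOME B'. bounded_bilinear B' \<and> (\<forall>X\<in>matrix_lie_algebra G. \<forall>Y\<in>matrix_lie_algebra G. B' X Y = B X Y))"

lemma bounded_bilinear_B_ext: "bounded_bilinear B_ext"
  and B_ext_eq: "X \<in> matrix_lie_algebra G \<Longrightarrow> Y \<in> matrix_lie_algebra G \<Longrightarrow> B_ext X Y = B X Y"
  using someI_ex[OF form_extension] unfolding B_ext_def by blast+

lemma B_sym: "X \<in> matrix_lie_algebra G \<Longrightarrow> Y \<in> matrix_lie_algebra G \<Longrightarrow> B X Y = B Y X"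
  and B_cscale_left: "X \<in> matrix_lie_algebra G \<Longrightarrow> Y \<in> matrix_lie_algebra G \<Longrightarrow> B (c *\<^sub>C X) Y = c * B X Y"
  and B_invariant: "X \<in> matrix_lie_algebra G \<Longrightarrow> Y \<in> matrix_lie_algebra G \<Longrightarrow> Z \<in> matrix_lie_algebra G \<Longrightarrow>
    B (commutator Z X) Y + B X (commutator Z Y) = 0"
  using form unfolding invariant_form_def by blast+

lemma B_cscale_right: "X \<in> matrix_lie_algebra G \<Longrightarrow> Y \<in> matrix_lie_algebra G \<Longrightarrow> B X (c *\<^sub>C Y) = c * B X Y"
  using B_sym B_cscale_left cscale_lie_algebra by metis

lemmas B_ext_simps = bounded_bilinear.add_left[OF bounded_bilinear_B_ext] bounded_bilinear.add_right[OF bounded_bilinear_B_ext]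
  bounded_bilinear.minus_left[OF bounded_bilinear_B_ext] bounded_bilinear.minus_right[OF bounded_bilinear_B_ext]
  bounded_bilinear.scaleR_left[OF bounded_bilinear_B_ext] bounded_bilinear.scaleR_right[OF bounded_bilinear_B_ext]
  bounded_bilinear.zero_left[OF bounded_bilinear_B_ext] bounded_bilinear.zero_right[OF bounded_bilinear_B_ext]

text \<open>Pathwise, because for disconnected \<open>G\<close> the form need not be invariant under all of \<open>G\<close>.\<close>

lemma Ad_invariance_along_path:
  fixes A :: "real \<Rightarrow> complex^'n^'n"
  assumes A: "Cinf_on U A" "{0..1} \<subseteq> U" "\<And>b. b \<in> {0..1} \<Longrightarrow> A b \<in> G" "A 0 = mat 1"
    and b: "b \<in> {0..1}" and X: "X \<in> matrix_lie_algebra G" and Y: "Y \<in> matrix_lie_algebra G"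
  shows "B (matrix_inv (A b) ** X ** A b) (matrix_inv (A b) ** Y ** A b) = B X Y"
proof -
  define W where "W = {x \<in> U. invertible (A x)}"
  have A': "Cinf_on W A" unfolding W_def by (rule Cinf_on_invertible_nhd[OF A(1)])
  have W: "x \<in> W" if "x \<in> {0..1}" for x using that A(2,3) by (auto simp: W_def)
  have inv: "x \<in> W \<Longrightarrow> invertible (A x)" for x by (simp add: W_def)
  let ?Ad = "\<lambda>X x. matrix_inv (A x) ** X ** A x"
  let ?k = "\<lambda>x. B_ext (?Ad X x) (?Ad Y x)"
  have "Cinf_on W ?k"
    by (intro Cinf_on_bilinear[OF bounded_bilinear_B_ext] Cinf_on_matrix_mult Cinf_on_matrix_inv A' inv
        Cinf_on_const Cinf_on_open[OF A'])
  then have "continuous_on W ?k" by (rule Cinf_on_imp_continuous_on)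
  then have cont: "continuous_on {0..b} ?k" by (rule continuous_on_subset) (use W b in auto)
  have "(?k has_vector_derivative 0) (at x)" if x: "x \<in> {0<..<b}" for x
  proof -
    have xW: "x \<in> W" using W x b by auto
    let ?\<eta> = "matrix_inv (A x) ** vector_derivative A (at x)"
    have vd: "(A has_vector_derivative vector_derivative A (at x)) (at x)"
      by (rule Cinf_on_has_vector_derivative[OF A' xW])
    \<comment> \<open>\<open>A\<close> takes values in the group over the closed unit interval only,
      so its logarithmic derivative is placed in the Lie algebra at interior points. The interior
      form of the fundamental theorem needs no more.\<close>
    have "Cinf_on {0<..<1} A" using Cinf_on_subset[OF A'] W by (auto simp: subset_iff)
    then have \<eta>: "?\<eta> \<in> matrix_lie_algebra G"
      by (rule left_log_derivative_in[OF _ _ _ vd]) (use A(3) x b in auto)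
    have Ad: "?Ad X x \<in> matrix_lie_algebra G" "?Ad Y x \<in> matrix_lie_algebra G"
      using Ad_inv_in X Y A(3)[of x] x b by auto
    have "(?k has_vector_derivative B_ext (?Ad X x) (- commutator ?\<eta> (?Ad Y x)) + B_ext (- commutator ?\<eta> (?Ad X x)) (?Ad Y x)) (at x)"
      by (rule bounded_bilinear.has_vector_derivative[OF bounded_bilinear_B_ext
          has_vector_derivative_commutator[OF A' xW inv vd] has_vector_derivative_commutator[OF A' xW inv vd]])
    moreover have "B_ext (?Ad X x) (- commutator ?\<eta> (?Ad Y x)) + B_ext (- commutator ?\<eta> (?Ad X x)) (?Ad Y x) =
       - (B (commutator ?\<eta> (?Ad X x)) (?Ad Y x) + B (?Ad X x) (commutator ?\<eta> (?Ad Y x)))"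
      using Ad \<eta> by (simp add: B_ext_simps B_ext_eq commutator_lie_algebra)
    then have "B_ext (?Ad X x) (- commutator ?\<eta> (?Ad Y x)) + B_ext (- commutator ?\<eta> (?Ad X x)) (?Ad Y x) = 0"
      by (simp only: B_invariant[OF Ad \<eta>] neg_0_equal_iff_equal neg_equal_0_iff_equal)
    ultimately show ?thesis by simp
  qed
  then have "((\<lambda>x. 0) has_integral ?k b - ?k 0) {0..b}"
    by (intro fundamental_theorem_of_calculus_interior cont) (use b in auto)
  then have "?k b = ?k 0" using has_integral_unique[OF has_integral_0] by fastforce
  then show ?thesis
    using Ad_inv_in[OF A(3)[OF b] X] Ad_inv_in[OF A(3)[OF b] Y] X Y A(4) by (simp add: B_ext_eq)
qed

lemma loop_derivative_in:
  assumes "\<And>\<theta>. \<xi> \<theta> \<in> matrix_lie_algebra G" "(\<xi> has_vector_derivative \<xi>') (at \<theta>)"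
  shows "\<xi>' \<in> matrix_lie_algebra G"
  using has_vector_derivative_in_subspace[OF subspace_lie_algebra assms(2) open_UNIV] assms(1) by simp

text \<open>The factor \<open>\<lambda>\<close> extracting the coefficient of degree
  \<open>-1\<close> cancels the one in \<open>1 / (\<i> * cis \<theta>)\<close> from
  \<open>dlam\<close>, leaving an integral in the angle with constant
  \<open>1 / (2 pi i)\<close>.\<close>

lemma cocycle_eq:
  assumes \<xi>: "\<And>\<theta>. \<xi> \<theta> \<in> matrix_lie_algebra G" "\<And>\<theta>. (\<xi> has_vector_derivative \<xi>' \<theta>) (at \<theta>)"
    and \<eta>: "\<And>\<theta>. \<eta> \<theta> \<in> matrix_lie_algebra G"
  shows "cocycle B \<xi> \<eta> = - \<i> / (2 * pi) * integral {0..2*pi} (\<lambda>\<theta>. B_ext (\<xi>' \<theta>) (\<eta> \<theta>))"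
proof -
  have "cis (- of_int (-1) * \<theta>) * B (dlam \<xi> \<theta>) (\<eta> \<theta>) = - \<i> * B_ext (\<xi>' \<theta>) (\<eta> \<theta>)" for \<theta>
    using loop_derivative_in[OF \<xi>] \<eta>
    by (simp add: dlam_def inverse_i_cis B_cscale_left B_ext_eq vector_derivative_at[OF \<xi>(2)])
       (simp add: cis_mult mult.left_commute[of "cis \<theta>"] flip: mult.assoc)
  then show ?thesis
    unfolding cocycle_def pairing_def by (simp only: integral_mult_right) simp
qed

text \<open>Integration by parts over the circle: the boundary terms cancel by periodicity, and
  symmetry of the form exchanges the arguments.\<close>

lemma cocycle_antisym:
  assumes \<xi>: "\<xi> \<in> loop_algebra G" and \<eta>: "\<eta> \<in> loop_algebra G"
  shows "cocycle B \<xi> \<eta> = - cocycle B \<eta> \<xi>"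
proof -
  note * = \<xi>[unfolded loop_algebra_def smooth_loops_iff] \<eta>[unfolded loop_algebra_def smooth_loops_iff]
  let ?D = "\<lambda>\<xi> \<theta>. vector_derivative \<xi> (at \<theta>)"
  have D: "(\<xi> has_vector_derivative ?D \<xi> \<theta>) (at \<theta>)" "(\<eta> has_vector_derivative ?D \<eta> \<theta>) (at \<theta>)" for \<theta>
    using * by (auto intro: Cinf_on_has_vector_derivative)
  have in_g: "\<xi> \<theta> \<in> matrix_lie_algebra G" "\<eta> \<theta> \<in> matrix_lie_algebra G" for \<theta> using * by auto
  have "Cinf_on UNIV (\<lambda>\<theta>. B_ext (?D \<xi> \<theta>) (\<eta> \<theta>))" "Cinf_on UNIV (\<lambda>\<theta>. B_ext (\<xi> \<theta>) (?D \<eta> \<theta>))"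
    using * by (auto intro!: Cinf_on_bilinear[OF bounded_bilinear_B_ext] Cinf_on_vector_derivative)
  then have int: "(\<lambda>\<theta>. B_ext (?D \<xi> \<theta>) (\<eta> \<theta>)) integrable_on {0..2*pi}" "(\<lambda>\<theta>. B_ext (\<xi> \<theta>) (?D \<eta> \<theta>)) integrable_on {0..2*pi}"
    by (auto intro: Cinf_on_integrable)
  have "((\<lambda>\<theta>. B_ext (\<xi> \<theta>) (?D \<eta> \<theta>) + B_ext (?D \<xi> \<theta>) (\<eta> \<theta>)) has_integral B_ext (\<xi> (2*pi)) (\<eta> (2*pi)) - B_ext (\<xi> 0) (\<eta> 0)) {0..2*pi}"
    by (rule fundamental_theorem_of_calculus)
       (simp, rule has_vector_derivative_at_within[OF bounded_bilinear.has_vector_derivative[OF bounded_bilinear_B_ext D]])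
  moreover have "\<xi> (2*pi) = \<xi> 0" "\<eta> (2*pi) = \<eta> 0" using *(1,2) by (metis add_0)+
  ultimately have "integral {0..2*pi} (\<lambda>\<theta>. B_ext (\<xi> \<theta>) (?D \<eta> \<theta>)) + integral {0..2*pi} (\<lambda>\<theta>. B_ext (?D \<xi> \<theta>) (\<eta> \<theta>)) = 0"
    using int by (simp add: integral_add[symmetric] integral_unique)
  moreover have "B_ext (\<xi> \<theta>) (?D \<eta> \<theta>) = B_ext (?D \<eta> \<theta>) (\<xi> \<theta>)" for \<theta>
    using in_g loop_derivative_in[OF in_g(2) D(2)] by (simp add: B_ext_eq B_sym)
  ultimately have "integral {0..2*pi} (\<lambda>\<theta>. B_ext (?D \<xi> \<theta>) (\<eta> \<theta>)) = - integral {0..2*pi} (\<lambda>\<theta>. B_ext (?D \<eta> \<theta>) (\<xi> \<theta>))"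
    by (simp add: add_eq_0_iff)
  then show ?thesis
    by (simp add: cocycle_eq[OF in_g(1) D(1) in_g(2)] cocycle_eq[OF in_g(2) D(2) in_g(1)])
qed

lemma cocycle_add_left:
  assumes "\<xi> \<in> loop_algebra G" "\<xi>' \<in> loop_algebra G" "\<eta> \<in> loop_algebra G"
  shows "cocycle B (\<xi> \<oplus> \<xi>') \<eta> = cocycle B \<xi> \<eta> + cocycle B \<xi>' \<eta>"
proof -
  note * = assms[unfolded loop_algebra_def smooth_loops_iff]
  let ?D = "\<lambda>\<xi> \<theta>. vector_derivative \<xi> (at \<theta>)"
  have D: "(\<xi> has_vector_derivative ?D \<xi> \<theta>) (at \<theta>)" "(\<xi>' has_vector_derivative ?D \<xi>' \<theta>) (at \<theta>)" for \<theta>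
    using * by (auto intro: Cinf_on_has_vector_derivative)
  have in_g: "\<xi> \<theta> \<in> matrix_lie_algebra G" "\<xi>' \<theta> \<in> matrix_lie_algebra G" "\<eta> \<theta> \<in> matrix_lie_algebra G" for \<theta> using * by auto
  have "Cinf_on UNIV (\<lambda>\<theta>. B_ext (?D \<xi> \<theta>) (\<eta> \<theta>))" "Cinf_on UNIV (\<lambda>\<theta>. B_ext (?D \<xi>' \<theta>) (\<eta> \<theta>))"
    using * by (auto intro!: Cinf_on_bilinear[OF bounded_bilinear_B_ext] Cinf_on_vector_derivative)
  then have int: "(\<lambda>\<theta>. B_ext (?D \<xi> \<theta>) (\<eta> \<theta>)) integrable_on {0..2*pi}" "(\<lambda>\<theta>. B_ext (?D \<xi>' \<theta>) (\<eta> \<theta>)) integrable_on {0..2*pi}"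
    by (auto intro: Cinf_on_integrable)
  have "cocycle B (\<xi> \<oplus> \<xi>') \<eta> = - \<i> / (2 * pi) * integral {0..2*pi} (\<lambda>\<theta>. B_ext (?D \<xi> \<theta> + ?D \<xi>' \<theta>) (\<eta> \<theta>))"
    by (rule cocycle_eq) (auto simp: ladd_def intro!: add_lie_algebra in_g has_vector_derivative_add D)
  then show ?thesis
    using int by (simp add: cocycle_eq[OF in_g(1) D(1) in_g(3)] cocycle_eq[OF in_g(2) D(2) in_g(3)]
        B_ext_simps integral_add distrib_left)
qed

text \<open>Since \<open>\<lambda>\<close> times the \<open>\<lambda>\<close>-derivative is
  \<open>- \<i>\<close> times the angular derivative, this pairing carries the same constant as the
  cocycle. That is how the primitive at the end of a path is recognised.\<close>

lemma pairing_log_derivative: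
  assumes Y: "\<And>\<theta>. Y \<theta> \<in> matrix_lie_algebra G" and g: "g \<in> loop_group G"
  shows "pairing B 0 Y (lpow 1 (dlam g \<odot> linv g)) =
    - \<i> / (2 * pi) * integral {0..2*pi} (\<lambda>\<theta>. B_ext (Y \<theta>) (vector_derivative g (at \<theta>) ** matrix_inv (g \<theta>)))"
proof -
  have g': "Cinf_on UNIV g" "\<And>\<theta>. g \<theta> \<in> G"
    using g by (auto simp: loop_group_def smooth_loops_iff)
  have in_g: "vector_derivative g (at \<theta>) ** matrix_inv (g \<theta>) \<in> matrix_lie_algebra G" for \<theta>
    using right_log_derivative_in[OF g'(1) _ g'(2) Cinf_on_has_vector_derivative[OF g'(1)]] by simp
  have "cis \<theta> * (1 / (\<i> * cis \<theta>)) = - \<i>" for \<theta>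
    by (simp add: field_simps)
  then have "lpow 1 (dlam g \<odot> linv g) \<theta> = (- \<i>) *\<^sub>C (vector_derivative g (at \<theta>) ** matrix_inv (g \<theta>))" for \<theta>
    by (simp add: lpow_def dlam_def loop_ops matrix_cscale_left del: times_divide_eq_right)
  then have "cis (- of_int 0 * \<theta>) * B (Y \<theta>) (lpow 1 (dlam g \<odot> linv g) \<theta>) =
      - \<i> * B_ext (Y \<theta>) (vector_derivative g (at \<theta>) ** matrix_inv (g \<theta>))" for \<theta>
    using Y in_g by (simp add: B_cscale_right B_ext_eq del: cscale_cscale)
  then show ?thesis
    unfolding pairing_def by (simp only: integral_mult_right) simp
qed

lemma loop_subgroup_loop_group: "loop_subgroup G (loop_group G)"
  by (auto simp: loop_subgroup_def loop_group_def smooth_loops_iff loop_ops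
      intro!: Cinf_on_const Cinf_on_matrix_mult Cinf_on_matrix_inv)

text \<open>Here \<open>p\<^sub>\<theta> p\<inverse>\<close> is a primitive in \<open>b\<close>: \<open>\<partial>\<^sub>b (p\<^sub>\<theta> p\<inverse>) = p (p\<inverse> p\<^sub>b)\<^sub>\<theta> p\<inverse>\<close>.\<close>

lemma integral_cocycle_path:
  assumes p: "path_in (loop_group G) lone g p" and Y: "Y \<in> loop_algebra G"
  shows "((\<lambda>b. cocycle B (linv (p b) \<odot> Y \<odot> p b) (linv (p b) \<odot> (\<lambda>\<theta>. vector_derivative (\<lambda>b. p b \<theta>) (at b))))
    has_integral - pairing B 0 Y (lpow 1 (dlam g \<odot> linv g))) {0..1}"
proof -
  let ?p = "\<lambda>(b,\<theta>). p b \<theta>"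
  obtain U0 where U0: "{0..1} \<times> UNIV \<subseteq> U0" "Cinf_on U0 ?p"
    using p unfolding path_in_def smooth_on_iff_Cinf_on by blast
  have pL: "p b \<in> loop_group G" if "b \<in> {0..1}" for b using p that by (auto simp: path_in_def)
  note pD = loop_subgroupD[OF loop_subgroup_loop_group pL]
  have p01: "p 0 = lone" "p 1 = g" using p by (auto simp: path_in_def)
  define U where "U = {x \<in> U0. invertible (?p x)}"
  have U: "Cinf_on U ?p" unfolding U_def by (rule Cinf_on_invertible_nhd[OF U0(2)])
  have inv: "x \<in> U \<Longrightarrow> invertible (?p x)" for x by (simp add: U_def)
  have inU: "(b,\<theta>) \<in> U" if "b \<in> {0..1}" for b \<theta> using U0(1) pD(3)[OF that] that by (auto simp: U_def)
  have Y': "Cinf_on UNIV Y" "\<And>\<theta>. Y (\<theta> + 2*pi) = Y \<theta>" "\<And>\<theta>. Y \<theta> \<in> matrix_lie_algebra G"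
    using Y by (auto simp: loop_algebra_def smooth_loops_iff)
  let ?D = "\<lambda>v x. frechet_derivative ?p (at x) v"
  define q where "q = (\<lambda>x. ?D (0,1) x ** matrix_inv (?p x))"
  define \<eta> where "\<eta> = left_log_deriv ?p (1,0)"
  have q: "Cinf_on U q" unfolding q_def by (intro Cinf_on_matrix_mult Cinf_on_derivative Cinf_on_matrix_inv U inv)
  have \<eta>: "Cinf_on U \<eta>" unfolding \<eta>_def by (rule Cinf_on_left_log_deriv[OF U inv])
  have Dp: "((\<lambda>b. p b \<theta>) has_vector_derivative ?D (1,0) (b,\<theta>)) (at b)"
    "((\<lambda>\<theta>. p b \<theta>) has_vector_derivative ?D (0,1) (b,\<theta>)) (at \<theta>)" if "b \<in> {0..1}" for b \<theta>
    using has_vector_derivative_partial_fst[OF U inU[OF that]] has_vector_derivative_partial_snd[OF U inU[OF that]] by auto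
  define q' where "q' = (\<lambda>x. frechet_derivative q (at x) (1,0))"
  have q': "Cinf_on U q'" unfolding q'_def by (rule Cinf_on_derivative[OF q])
  have q'_eq: "q' x = ?p x ** frechet_derivative \<eta> (at x) (0,1) ** matrix_inv (?p x)" if "x \<in> U" for x
    unfolding q'_def q_def \<eta>_def by (rule right_log_deriv_derivative[OF U that inv])
  \<comment> \<open>Up to the constant \<open>\<i> / (2 pi)\<close>, this is the primitive in
    \<open>b\<close> of the cocycle along the path.\<close>
  define \<phi> where "\<phi> = (\<lambda>b. integral (cbox 0 (2*pi)) (\<lambda>\<theta>. B_ext (Y \<theta>) (q (b,\<theta>))))"
  have contq: "continuous_on ({0..1} \<times> UNIV) (\<lambda>(b,\<theta>). B_ext (Y \<theta>) (r (b,\<theta>)))" if "Cinf_on U r" for r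
  proof -
    have "Cinf_on U (\<lambda>x. B_ext (Y (snd x)) (r x))"
      by (intro Cinf_on_bilinear[OF bounded_bilinear_B_ext] that Cinf_on_loop[OF Y'(1)] Cinf_on_open[OF U])
    then have "continuous_on U (\<lambda>x. B_ext (Y (snd x)) (r x))" by (rule Cinf_on_imp_continuous_on)
    then show ?thesis by (rule continuous_on_subset[THEN continuous_on_eq]) (use inU in auto)
  qed
  have \<phi>': "(\<phi> has_vector_derivative integral (cbox 0 (2*pi)) (\<lambda>\<theta>. B_ext (Y \<theta>) (q' (b,\<theta>)))) (at b within {0..1})"
    if b: "b \<in> {0..1}" for b
    unfolding \<phi>_def
  proof (rule leibniz_rule_vector_derivative[where fx="\<lambda>b \<theta>. B_ext (Y \<theta>) (q' (b,\<theta>))"])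
    fix b \<theta> :: real assume b: "b \<in> {0..1}"
    have "((\<lambda>b. q (b,\<theta>)) has_vector_derivative q' (b,\<theta>)) (at b)"
      using has_vector_derivative_partial_fst[of U "\<lambda>b \<theta>. q (b,\<theta>)" b \<theta>] q inU[OF b] by (simp add: q'_def)
    then show "((\<lambda>b. B_ext (Y \<theta>) (q (b,\<theta>))) has_vector_derivative B_ext (Y \<theta>) (q' (b,\<theta>))) (at b within {0..1})"
      by (rule has_vector_derivative_at_within[OF
          bounded_linear.has_vector_derivative[OF bounded_bilinear.bounded_linear_right[OF bounded_bilinear_B_ext]]])
  next
    fix b :: real assume b: "b \<in> {0..1}"
    have "continuous_on UNIV (\<lambda>\<theta>. (\<lambda>(b,\<theta>). B_ext (Y \<theta>) (q (b,\<theta>))) (b,\<theta>))"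
      by (rule continuous_on_compose2[OF contq[OF q]]) (use b in \<open>auto intro!: continuous_intros\<close>)
    then show "(\<lambda>\<theta>. B_ext (Y \<theta>) (q (b,\<theta>))) integrable_on cbox 0 (2*pi)"
      by (intro integrable_continuous) (auto intro: continuous_on_subset)
  next
    show "continuous_on ({0..1} \<times> cbox 0 (2*pi)) (\<lambda>(b,\<theta>). B_ext (Y \<theta>) (q' (b,\<theta>)))"
      by (rule continuous_on_subset[OF contq[OF q']]) auto
  qed (use b in auto)
  \<comment> \<open>Antisymmetry of the cocycle puts the angular derivative on
    \<open>\<eta>\<close>. Conjugating both arguments of the form by \<open>p b \<theta>\<close>
    then turns that derivative into \<open>q'\<close> and the conjugate of \<open>Y\<close> back
    into \<open>Y\<close>.\<close>
  have main: "integral (cbox 0 (2*pi)) (\<lambda>\<theta>. B_ext (Y \<theta>) (q' (b,\<theta>))) * (- \<i> / (2*pi)) =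
      - cocycle B (linv (p b) \<odot> Y \<odot> p b) (linv (p b) \<odot> (\<lambda>\<theta>. vector_derivative (\<lambda>b. p b \<theta>) (at b)))"
    if b: "b \<in> {0<..<1}" for b
  proof -
    have b': "b \<in> {0..1}" using b by simp
    have \<eta>b: "linv (p b) \<odot> (\<lambda>\<theta>. vector_derivative (\<lambda>b. p b \<theta>) (at b)) = (\<lambda>\<theta>. \<eta> (b,\<theta>))"
      by (simp add: loop_ops \<eta>_def left_log_deriv_def vector_derivative_at[OF Dp(1)[OF b']])
    have \<eta>g: "\<eta> (b,\<theta>) \<in> matrix_lie_algebra G" for \<theta>
    proof -
      have "Cinf_on {0<..<1} (\<lambda>b. ?p (b, \<theta>))"
        by (rule Cinf_on_compose[OF U]) (use inU in \<open>auto intro!: Cinf_on_Pair Cinf_on_const Cinf_on_ident\<close>)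
      then have "Cinf_on {0<..<1} (\<lambda>b. p b \<theta>)" by simp
      from left_log_derivative_in[OF this b _ Dp(1)[OF b']] show ?thesis
        using pD(3) by (simp add: \<eta>_def left_log_deriv_def)
    qed
    have \<eta>': "((\<lambda>\<theta>. \<eta> (b,\<theta>)) has_vector_derivative frechet_derivative \<eta> (at (b,\<theta>)) (0,1)) (at \<theta>)" for \<theta>
      using has_vector_derivative_partial_snd[of U "\<lambda>b \<theta>. \<eta> (b,\<theta>)" b \<theta>] \<eta> inU[OF b'] by simp
    note \<eta>'g = loop_derivative_in[OF \<eta>g \<eta>']
    have \<eta>L: "(\<lambda>\<theta>. \<eta> (b,\<theta>)) \<in> loop_algebra G"
    proof -
      have "(\<lambda>\<theta>. \<eta> (b,\<theta>)) (\<theta> + 2*pi) = \<eta> (b,\<theta>)" for \<theta>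
      proof -
        \<comment> \<open>Periodicity in the angle is known for \<open>b\<close> in the unit
          interval only; at an interior \<open>b\<close> the two functions agree nearby, hence have
          the same derivative.\<close>
        have "vector_derivative (\<lambda>b. p b (\<theta> + 2*pi)) (at b) = vector_derivative (\<lambda>b. p b \<theta>) (at b)"
          by (rule vector_derivative_cong_eq)
             (use b pD(2) in \<open>auto simp: eventually_nhds intro!: exI[of _ "{0<..<1}"]\<close>)
        then show ?thesis
          using fun_cong[OF \<eta>b, of \<theta>] fun_cong[OF \<eta>b, of "\<theta> + 2*pi"] pD(2)[OF b', of \<theta>] by (simp add: loop_ops)
      qed
      moreover have "Cinf_on UNIV (\<lambda>\<theta>. \<eta> (b,\<theta>))"
        by (rule Cinf_on_section[of U "\<lambda>b \<theta>. \<eta> (b,\<theta>)"]) (use \<eta> inU[OF b'] in auto)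
      ultimately show ?thesis using \<eta>g by (simp add: loop_algebra_def smooth_loops_iff)
    qed
    have YY: "linv (p b) \<odot> Y \<odot> p b \<in> loop_algebra G"
    proof -
      have "linv (p b) \<in> loop_group G" using loop_subgroup_loop_group pL[OF b'] by (auto simp: loop_subgroup_def)
      from Ad_loop_algebra[OF this Y] show ?thesis using pD(3)[OF b'] by (simp add: loop_ops)
    qed
    have "- cocycle B (linv (p b) \<odot> Y \<odot> p b) (\<lambda>\<theta>. \<eta> (b,\<theta>)) = cocycle B (\<lambda>\<theta>. \<eta> (b,\<theta>)) (linv (p b) \<odot> Y \<odot> p b)"
      using cocycle_antisym[OF \<eta>L YY] by simp
    also have "\<dots> = - \<i> / (2*pi) * integral {0..2*pi} (\<lambda>\<theta>. B_ext (frechet_derivative \<eta> (at (b,\<theta>)) (0,1)) ((linv (p b) \<odot> Y \<odot> p b) \<theta>))"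
      by (rule cocycle_eq[OF \<eta>g \<eta>']) (use YY in \<open>simp add: loop_algebra_def smooth_loops_iff\<close>)
    also have "(\<lambda>\<theta>. B_ext (frechet_derivative \<eta> (at (b,\<theta>)) (0,1)) ((linv (p b) \<odot> Y \<odot> p b) \<theta>)) = (\<lambda>\<theta>. B_ext (Y \<theta>) (q' (b,\<theta>)))"
    proof
      fix \<theta>
      let ?Z = "p b \<theta> ** frechet_derivative \<eta> (at (b,\<theta>)) (0,1) ** matrix_inv (p b \<theta>)"
      have Z: "?Z \<in> matrix_lie_algebra G" using Ad_in[OF pD(3)[OF b'] \<eta>'g] .
      have "open ((\<lambda>b. (b,\<theta>)) -` U)"
        by (intro open_vimage Cinf_on_open[OF U]) (auto intro!: continuous_intros)
      then have "Cinf_on ((\<lambda>b. (b,\<theta>)) -` U) (\<lambda>b. ?p (b, \<theta>))"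
        by (intro Cinf_on_compose[OF U] Cinf_on_Pair Cinf_on_const Cinf_on_ident) auto
      \<comment> \<open>At fixed angle, \<open>p\<close> is itself the path from the identity to
        \<open>p b \<theta>\<close> that invariance requires.\<close>
      then have "B (matrix_inv (p b \<theta>) ** Y \<theta> ** p b \<theta>) (matrix_inv (p b \<theta>) ** ?Z ** p b \<theta>) = B (Y \<theta>) ?Z"
        by (intro Ad_invariance_along_path[where A="\<lambda>b. p b \<theta>"])
           (use inU pD(3) Y'(3) Z b' p01 in \<open>auto simp: lone_def\<close>)
      moreover have "matrix_inv (p b \<theta>) ** ?Z ** p b \<theta> = frechet_derivative \<eta> (at (b,\<theta>)) (0,1)"
        using pD(3)[OF b'] by (simp add: matrix_assoc)
      ultimately show "B_ext (frechet_derivative \<eta> (at (b,\<theta>)) (0,1)) ((linv (p b) \<odot> Y \<odot> p b) \<theta>) = B_ext (Y \<theta>) (q' (b,\<theta>))"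
        using q'_eq[OF inU[OF b']] Z \<eta>'g Ad_inv_in[OF pD(3)[OF b'] Y'(3)] Y'(3)
        by (simp add: loop_ops B_ext_eq) (metis B_sym)
    qed
    finally show ?thesis unfolding \<eta>b by (simp add: mult.commute)
  qed
  have "continuous_on {0..1} \<phi>"
    using \<phi>' by (meson continuous_on_eq_continuous_within has_vector_derivative_continuous)
  then have cont: "continuous_on {0..1} (\<lambda>b. \<phi> b * (\<i> / (2*pi)))"
    by (intro continuous_intros)
  have "((\<lambda>b. cocycle B (linv (p b) \<odot> Y \<odot> p b) (linv (p b) \<odot> (\<lambda>\<theta>. vector_derivative (\<lambda>b. p b \<theta>) (at b))))
    has_integral \<phi> 1 * (\<i> / (2*pi)) - \<phi> 0 * (\<i> / (2*pi))) {0..1}"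
  proof (rule fundamental_theorem_of_calculus_interior[OF _ cont])
    fix b :: real assume b: "b \<in> {0<..<1}"
    then have "(\<phi> has_vector_derivative integral (cbox 0 (2*pi)) (\<lambda>\<theta>. B_ext (Y \<theta>) (q' (b,\<theta>)))) (at b)"
      using \<phi>'[of b] by (simp add: at_within_Icc_at)
    then have "((\<lambda>b. \<phi> b * (\<i> / (2*pi))) has_vector_derivative
        integral (cbox 0 (2*pi)) (\<lambda>\<theta>. B_ext (Y \<theta>) (q' (b,\<theta>))) * (\<i> / (2*pi))) (at b)"
      by (rule bounded_linear.has_vector_derivative[OF bounded_linear_mult_left])
    then show "((\<lambda>b. \<phi> b * (\<i> / (2*pi))) has_vector_derivative
        cocycle B (linv (p b) \<odot> Y \<odot> p b) (linv (p b) \<odot> (\<lambda>\<theta>. vector_derivative (\<lambda>b. p b \<theta>) (at b)))) (at b)"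
      using main[OF b] by simp
  qed simp
  \<comment> \<open>The path starts at a constant loop, whose angular derivative vanishes.\<close>
  moreover have "\<phi> 0 = 0"
  proof -
    have "((\<lambda>\<theta>. p 0 \<theta>) has_vector_derivative 0) (at \<theta>)" for \<theta>
      by (simp add: p01 lone_def)
    then have "?D (0,1) (0,\<theta>) = 0" for \<theta>
      by (rule vector_derivative_unique_at[OF Dp(2), rotated]) simp
    then have "q (0,\<theta>) = 0" for \<theta>
      by (simp add: q_def matrix_zero_left)
    then show ?thesis by (simp add: \<phi>_def B_ext_simps)
  qed
  moreover have "\<phi> 1 * (\<i> / (2*pi)) = - pairing B 0 Y (lpow 1 (dlam g \<odot> linv g))"
  proof -
    have "q (1,\<theta>) = vector_derivative g (at \<theta>) ** matrix_inv (g \<theta>)" for \<theta>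
      using vector_derivative_at[OF Dp(2)[of 1 \<theta>]] by (simp add: q_def p01)
    then show ?thesis
      using pairing_log_derivative[of Y g] Y' pL[of 1] p01 by (simp add: \<phi>_def mult.commute)
  qed
  ultimately show ?thesis by simp
qed

end

section \<open>Integrals over squares\<close>

lemma smooth_on_matrix_mult:
  fixes A B :: "'a::euclidean_space \<Rightarrow> complex^'n^'n"
  assumes "smooth_on S A" "smooth_on S B" shows "smooth_on S (\<lambda>x. A x ** B x)"
proof -
  obtain U U' where "S \<subseteq> U" "Cinf_on U A" "S \<subseteq> U'" "Cinf_on U' B"
    using assms unfolding smooth_on_iff_Cinf_on by blast
  moreover from this have "open (U \<inter> U')" by (auto dest: Cinf_on_open)
  ultimately have "S \<subseteq> U \<inter> U'" "Cinf_on (U \<inter> U') (\<lambda>x. A x ** B x)"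
    by (auto intro!: Cinf_on_matrix_mult elim: Cinf_on_subset)
  then show ?thesis unfolding smooth_on_iff_Cinf_on by blast
qed

lemma smooth_on_matrix_inv:
  fixes A :: "'a::euclidean_space \<Rightarrow> complex^'n^'n"
  assumes "smooth_on S A" "\<And>x. x \<in> S \<Longrightarrow> invertible (A x)" shows "smooth_on S (\<lambda>x. matrix_inv (A x))"
proof -
  obtain U where U: "S \<subseteq> U" "Cinf_on U A"
    using assms unfolding smooth_on_iff_Cinf_on by blast
  then have "Cinf_on {x \<in> U. invertible (A x)} (\<lambda>x. matrix_inv (A x))"
    by (intro Cinf_on_matrix_inv Cinf_on_invertible_nhd) auto
  moreover have "S \<subseteq> {x \<in> U. invertible (A x)}" using U assms(2) by blast
  ultimately show ?thesis unfolding smooth_on_iff_Cinf_on by blast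
qed

lemma smooth_on_compose:
  assumes f: "smooth_on T f" and g: "Cinf_on V g" "S \<subseteq> V" "\<And>x. x \<in> S \<Longrightarrow> g x \<in> T"
  shows "smooth_on S (\<lambda>x. f (g x))"
proof -
  obtain U where U: "T \<subseteq> U" "Cinf_on U f" using f unfolding smooth_on_iff_Cinf_on by blast
  have o: "open (V \<inter> g -` U)"
    by (rule continuous_open_preimage[OF Cinf_on_imp_continuous_on[OF g(1)] Cinf_on_open[OF g(1)] Cinf_on_open[OF U(2)]])
  have "Cinf_on (V \<inter> g -` U) (\<lambda>x. f (g x))"
    by (rule Cinf_on_compose[OF U(2) Cinf_on_subset[OF g(1) o]]) auto
  moreover have "S \<subseteq> V \<inter> g -` U" using g U(1) by blast
  ultimately show ?thesis unfolding smooth_on_iff_Cinf_on by blast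
qed

lemma has_vector_derivative_triple:
  fixes S :: "real \<Rightarrow> real \<Rightarrow> real \<Rightarrow> 'b::real_normed_vector"
  assumes "Cinf_on U (\<lambda>(s,b,\<theta>). S s b \<theta>)" "(s,b,\<theta>) \<in> U"
  shows "((\<lambda>s. S s b \<theta>) has_vector_derivative frechet_derivative (\<lambda>(s,b,\<theta>). S s b \<theta>) (at (s,b,\<theta>)) (1,0,0)) (at s)"
    and "((\<lambda>b. S s b \<theta>) has_vector_derivative frechet_derivative (\<lambda>(s,b,\<theta>). S s b \<theta>) (at (s,b,\<theta>)) (0,1,0)) (at b)"
    and "((\<lambda>\<theta>. S s b \<theta>) has_vector_derivative frechet_derivative (\<lambda>(s,b,\<theta>). S s b \<theta>) (at (s,b,\<theta>)) (0,0,1)) (at \<theta>)"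
proof -
  have "((\<lambda>s. (s, b, \<theta>)) has_vector_derivative (1, 0, 0)) (at s)"
    "((\<lambda>b. (s, b, \<theta>)) has_vector_derivative (0, 1, 0)) (at b)"
    "((\<lambda>\<theta>. (s, b, \<theta>)) has_vector_derivative (0, 0, 1)) (at \<theta>)"
    by (auto intro!: derivative_eq_intros simp: has_vector_derivative_def zero_prod_def)
  from this[THEN has_vector_derivative_along[OF assms(1), rotated]] assms(2)
  show "((\<lambda>s. S s b \<theta>) has_vector_derivative frechet_derivative (\<lambda>(s,b,\<theta>). S s b \<theta>) (at (s,b,\<theta>)) (1,0,0)) (at s)"
    and "((\<lambda>b. S s b \<theta>) has_vector_derivative frechet_derivative (\<lambda>(s,b,\<theta>). S s b \<theta>) (at (s,b,\<theta>)) (0,1,0)) (at b)"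
    and "((\<lambda>\<theta>. S s b \<theta>) has_vector_derivative frechet_derivative (\<lambda>(s,b,\<theta>). S s b \<theta>) (at (s,b,\<theta>)) (0,0,1)) (at \<theta>)"
    by simp_all
qed

lemma scaled_in_interval: "a \<in> {0..1} \<Longrightarrow> u \<in> {-e<..<e} \<Longrightarrow> a * u \<in> {-e<..<e::real}"
proof -
  assume "a \<in> {0..1}" "u \<in> {-e<..<e}"
  moreover from this have "\<bar>a * u\<bar> \<le> \<bar>u\<bar>" by (simp add: abs_mult mult_left_le_one_le)
  ultimately show ?thesis by auto
qed

lemma box_unit_square: "box (0,0) (1::real,1::real) = {0<..<1} \<times> {0<..<1}"
  and cbox_unit_square: "cbox (0,0) (1::real,1::real) = {0..1} \<times> {0..1}"
  by (auto simp: box_def cbox_def Basis_prod_def)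

context lie_group
begin

text \<open>The fixed factor \<open>g\<close> cancels in both left logarithmic derivatives, leaving
  those of \<open>h\<close>, which lie in the Lie algebra of \<open>H\<close> at interior points.
  The boundary of the square, past which \<open>h\<close> may leave \<open>H\<close>, is a null
  set.\<close>

lemma square_integral_zero:
  assumes H: "loop_subgroup G H"
    and w0: "\<And>\<xi> \<eta>. \<xi> \<in> lie_algebra H \<Longrightarrow> \<eta> \<in> lie_algebra H \<Longrightarrow> w \<xi> \<eta> = 0"
    and g: "\<And>\<theta>. g \<theta> \<in> G"
    and h: "smooth_on ({0..1} \<times> {0..1} \<times> UNIV) (\<lambda>(a,b,\<theta>). h a b \<theta>)"
    and hH: "\<And>a b. a \<in> {0..1} \<Longrightarrow> b \<in> {0..1} \<Longrightarrow> h a b \<in> H"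
  shows "square_integral w (\<lambda>a b. g \<odot> h a b) = 0"
proof -
  obtain U where U: "{0..1} \<times> {0..1} \<times> UNIV \<subseteq> U" "Cinf_on U (\<lambda>(a,b,\<theta>). h a b \<theta>)"
    using h unfolding smooth_on_iff_Cinf_on by blast
  have inU: "(a,b,\<theta>) \<in> U" if "a \<in> {0<..<1}" "b \<in> {0<..<1}" for a b \<theta>
    using U(1) that by auto
  let ?w = "\<lambda>(a,b). w (linv (g \<odot> h a b) \<odot> (\<lambda>\<theta>. vector_derivative (\<lambda>a'. (g \<odot> h a' b) \<theta>) (at a)))
       (linv (g \<odot> h a b) \<odot> (\<lambda>\<theta>. vector_derivative (\<lambda>b'. (g \<odot> h a b') \<theta>) (at b)))"
  have "?w (a,b) = 0" if ab: "a \<in> {0<..<1}" "b \<in> {0<..<1}" for a b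
  proof -
    have ab': "a \<in> {0..1}" "b \<in> {0..1}" using ab by auto
    note D = has_vector_derivative_triple[OF U(2) inU[OF ab]]
    have inv: "invertible (h a b \<theta>)" "invertible (g \<theta>)" for \<theta>
      using loop_subgroupD(3)[OF H hH[OF ab']] g by auto
    have vd: "vector_derivative (\<lambda>a'. (g \<odot> h a' b) \<theta>) (at a) = g \<theta> ** vector_derivative (\<lambda>a'. h a' b \<theta>) (at a)"
       "vector_derivative (\<lambda>b'. (g \<odot> h a b') \<theta>) (at b) = g \<theta> ** vector_derivative (\<lambda>b'. h a b' \<theta>) (at b)" for \<theta>
      unfolding lmul_def vector_derivative_at[OF D(1)] vector_derivative_at[OF D(2)]
      by (rule vector_derivative_at[OF bounded_linear.has_vector_derivative[OF
            bounded_bilinear.bounded_linear_right[OF bounded_bilinear_matrix_mult] D(1)]]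
          vector_derivative_at[OF bounded_linear.has_vector_derivative[OF
            bounded_bilinear.bounded_linear_right[OF bounded_bilinear_matrix_mult] D(2)]])+
    have o: "open ({0<..<1::real} \<times> (UNIV::real set))" by (simp add: open_Times)
    have "Cinf_on ({0<..<1} \<times> UNIV) (\<lambda>x. (\<lambda>(a,b,\<theta>). h a b \<theta>) (fst x, b, snd x))"
      by (rule Cinf_on_compose[OF U(2)])
         (use inU ab in \<open>auto intro!: Cinf_on_Pair Cinf_on_fst Cinf_on_snd Cinf_on_const simp: o\<close>)
    then have "Cinf_on ({0<..<1} \<times> UNIV) (\<lambda>(a,\<theta>). h a b \<theta>)" by (simp add: case_prod_unfold)
    from left_log_derivative_lie_algebra[OF H _ ab(1) this]
    have 1: "linv (h a b) \<odot> (\<lambda>\<theta>. vector_derivative (\<lambda>a. h a b \<theta>) (at a)) \<in> lie_algebra H"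
      using hH ab by simp
    have "Cinf_on ({0<..<1} \<times> UNIV) (\<lambda>x. (\<lambda>(a,b,\<theta>). h a b \<theta>) (a, fst x, snd x))"
      by (rule Cinf_on_compose[OF U(2)])
         (use inU ab in \<open>auto intro!: Cinf_on_Pair Cinf_on_fst Cinf_on_snd Cinf_on_const Cinf_on_ident simp: o\<close>)
    then have "Cinf_on ({0<..<1} \<times> UNIV) (\<lambda>(b,\<theta>). h a b \<theta>)" by (simp add: case_prod_unfold)
    from left_log_derivative_lie_algebra[OF H _ ab(2) this]
    have 2: "linv (h a b) \<odot> (\<lambda>\<theta>. vector_derivative (\<lambda>b. h a b \<theta>) (at b)) \<in> lie_algebra H"
      using hH ab by simp
    have "linv (g \<odot> h a b) \<odot> (\<lambda>\<theta>. g \<theta> ** X \<theta>) = linv (h a b) \<odot> X" for X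
      using inv by (simp add: loop_ops matrix_inv_mult matrix_assoc)
    then show ?thesis using w0[OF 1 2] by (simp add: vd)
  qed
  then have "(?w has_integral 0) (cbox (0,0) (1,1))"
    by (intro has_integral_spike_interior[OF has_integral_0]) (auto simp: box_unit_square)
  then show ?thesis by (simp add: square_integral_def integral_unique)
qed

end

context lie_group_form
begin

text \<open>Substituting \<open>s = a * u\<close> makes the derivative in \<open>a\<close> equal to
  \<open>u\<close> times the derivative in \<open>s\<close>. The integral is therefore
  \<open>u *\<^sub>R K u\<close> with \<open>K\<close> continuous, and its derivative at
  \<open>0\<close> is \<open>K 0\<close>.\<close>

lemma square_integral_scaled:
  fixes S :: "real \<Rightarrow> real \<Rightarrow> 'n loop"
  assumes S: "smooth_on ({-e<..<e} \<times> {0..1} \<times> UNIV) (\<lambda>(s,b,\<theta>). S s b \<theta>)" and e: "e > 0"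
    and SL: "\<And>s b. s \<in> {-e<..<e} \<Longrightarrow> b \<in> {0..1} \<Longrightarrow> S s b \<in> loop_group G"
    and w: "((\<lambda>b. cocycle B (linv (S 0 b) \<odot> (\<lambda>\<theta>. vector_derivative (\<lambda>s. S s b \<theta>) (at 0)))
      (linv (S 0 b) \<odot> (\<lambda>\<theta>. vector_derivative (\<lambda>b. S 0 b \<theta>) (at b)))) has_integral I) {0..1}"
  shows "((\<lambda>u. square_integral (cocycle B) (\<lambda>a b. S (a * u) b)) has_vector_derivative I) (at 0)"
proof -
  let ?S = "\<lambda>(s,b,\<theta>). S s b \<theta>"
  obtain U0 where U0: "{-e<..<e} \<times> {0..1} \<times> UNIV \<subseteq> U0" "Cinf_on U0 ?S"
    using S unfolding smooth_on_iff_Cinf_on by blast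
  define U where "U = {x \<in> U0. invertible (?S x)}"
  have U: "Cinf_on U ?S" unfolding U_def by (rule Cinf_on_invertible_nhd[OF U0(2)])
  have inv: "x \<in> U \<Longrightarrow> invertible (?S x)" for x by (simp add: U_def)
  note SG = loop_subgroupD(3)[OF loop_subgroup_loop_group SL]
  have inU: "(s,b,\<theta>) \<in> U" if "s \<in> {-e<..<e}" "b \<in> {0..1}" for s b \<theta>
    using U0(1) SG[OF that] that by (auto simp: U_def)
  note D = has_vector_derivative_triple[OF U inU]
  define \<sigma> where "\<sigma> = left_log_deriv ?S (1,0,0)"
  define \<beta> where "\<beta> = left_log_deriv ?S (0,1,0)"
  define \<sigma>' where "\<sigma>' = (\<lambda>x. frechet_derivative \<sigma> (at x) (0,0,1))"
  have \<sigma>: "Cinf_on U \<sigma>" and \<beta>: "Cinf_on U \<beta>"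
    using Cinf_on_left_log_deriv[OF U inv] by (simp_all add: \<sigma>_def \<beta>_def)
  have \<sigma>': "Cinf_on U \<sigma>'" unfolding \<sigma>'_def by (rule Cinf_on_derivative[OF \<sigma>])
  define W where "W = (\<lambda>s b. - \<i> / (2*pi) * integral (cbox 0 (2*pi)) (\<lambda>\<theta>. B_ext (\<sigma>' (s,b,\<theta>)) (\<beta> (s,b,\<theta>))))"
  have contW: "continuous_on ({-e<..<e} \<times> {0..1}) (\<lambda>(s,b). W s b)"
  proof -
    have "Cinf_on U (\<lambda>x. B_ext (\<sigma>' x) (\<beta> x))"
      by (intro Cinf_on_bilinear[OF bounded_bilinear_B_ext] \<sigma>' \<beta>)
    then have "continuous_on U (\<lambda>x. B_ext (\<sigma>' x) (\<beta> x))" by (rule Cinf_on_imp_continuous_on)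
    then have "continuous_on (({-e<..<e} \<times> {0..1}) \<times> cbox 0 (2*pi))
        (\<lambda>x. (\<lambda>x. B_ext (\<sigma>' x) (\<beta> x)) (fst (fst x), snd (fst x), snd x))"
      by (rule continuous_on_compose2) (use inU in \<open>auto intro!: continuous_intros\<close>)
    then have "continuous_on (({-e<..<e} \<times> {0..1}) \<times> cbox 0 (2*pi))
        (\<lambda>(x,\<theta>). B_ext (\<sigma>' (fst x, snd x, \<theta>)) (\<beta> (fst x, snd x, \<theta>)))"
      by (simp add: case_prod_unfold)
    from integral_continuous_on_param[OF this] show ?thesis
      unfolding W_def case_prod_unfold by (intro continuous_intros) auto
  qed
  \<comment> \<open>The factor \<open>u\<close> anticipates the derivative of \<open>a * u\<close>
    in \<open>a\<close>. The identity is claimed for interior \<open>b\<close>, where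
    \<open>\<beta>\<close> is known to lie in the Lie algebra; \<open>W\<close> itself is continuous
    up to the ends.\<close>
  have W: "cocycle B (linv (S s b) \<odot> (\<lambda>\<theta>. u *\<^sub>R vector_derivative (\<lambda>s. S s b \<theta>) (at s)))
      (linv (S s b) \<odot> (\<lambda>\<theta>. vector_derivative (\<lambda>b. S s b \<theta>) (at b))) = u *\<^sub>R W s b"
    if s: "s \<in> {-e<..<e}" and b: "b \<in> {0<..<1}" for s b u
  proof -
    have b': "b \<in> {0..1}" using b by simp
    have \<beta>eq: "linv (S s b) \<odot> (\<lambda>\<theta>. vector_derivative (\<lambda>b. S s b \<theta>) (at b)) = (\<lambda>\<theta>. \<beta> (s,b,\<theta>))"
      by (simp add: loop_ops \<beta>_def left_log_deriv_def vector_derivative_at[OF D(2)[OF s b']])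
    have \<sigma>eq: "linv (S s b) \<odot> (\<lambda>\<theta>. u *\<^sub>R vector_derivative (\<lambda>s. S s b \<theta>) (at s)) = (\<lambda>\<theta>. u *\<^sub>R \<sigma> (s,b,\<theta>))"
      by (simp add: loop_ops \<sigma>_def left_log_deriv_def vector_derivative_at[OF D(1)[OF s b']] matrix_simps)
    have \<sigma>g: "\<sigma> (s,b,\<theta>) \<in> matrix_lie_algebra G" for \<theta>
    proof -
      have "Cinf_on {-e<..<e} (\<lambda>s. ?S (s, b, \<theta>))"
        by (rule Cinf_on_compose[OF U]) (use inU b' in \<open>auto intro!: Cinf_on_Pair Cinf_on_const Cinf_on_ident\<close>)
      then have "Cinf_on {-e<..<e} (\<lambda>s. S s b \<theta>)" by simp
      from left_log_derivative_in[OF this s _ D(1)[OF s b']] show ?thesis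
        using SG b' by (simp add: \<sigma>_def left_log_deriv_def)
    qed
    have \<beta>g: "\<beta> (s,b,\<theta>) \<in> matrix_lie_algebra G" for \<theta>
    proof -
      have "Cinf_on {0<..<1} (\<lambda>b. ?S (s, b, \<theta>))"
        by (rule Cinf_on_compose[OF U]) (use inU s in \<open>auto intro!: Cinf_on_Pair Cinf_on_const Cinf_on_ident\<close>)
      then have "Cinf_on {0<..<1} (\<lambda>b. S s b \<theta>)" by simp
      from left_log_derivative_in[OF this b _ D(2)[OF s b']] show ?thesis
        using SG s by (simp add: \<beta>_def left_log_deriv_def)
    qed
    have "((\<lambda>\<theta>. \<sigma> (s,b,\<theta>)) has_vector_derivative \<sigma>' (s,b,\<theta>)) (at \<theta>)" for \<theta>
      using has_vector_derivative_triple(3)[of U "\<lambda>s b \<theta>. \<sigma> (s,b,\<theta>)" s b \<theta>] \<sigma> inU[OF s b'] by (simp add: \<sigma>'_def)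
    then have "((\<lambda>\<theta>. u *\<^sub>R \<sigma> (s,b,\<theta>)) has_vector_derivative u *\<^sub>R \<sigma>' (s,b,\<theta>)) (at \<theta>)" for \<theta>
      by (rule bounded_linear.has_vector_derivative[OF bounded_linear_scaleR_right])
    then have "cocycle B (\<lambda>\<theta>. u *\<^sub>R \<sigma> (s,b,\<theta>)) (\<lambda>\<theta>. \<beta> (s,b,\<theta>)) =
        - \<i> / (2*pi) * integral {0..2*pi} (\<lambda>\<theta>. B_ext (u *\<^sub>R \<sigma>' (s,b,\<theta>)) (\<beta> (s,b,\<theta>)))"
      by (intro cocycle_eq scaleR_lie_algebra \<sigma>g \<beta>g)
    then show ?thesis
      unfolding \<beta>eq \<sigma>eq by (simp add: W_def B_ext_simps)
  qed
  define K where "K = (\<lambda>u. integral (cbox (0,0) (1,1)) (\<lambda>(a,b). W (a * u) b))"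
  have sq: "square_integral (cocycle B) (\<lambda>a b. S (a * u) b) = u *\<^sub>R K u" if u: "u \<in> {-e<..<e}" for u
  proof -
    have "continuous_on (cbox (0,0) (1,1)) (\<lambda>x. (\<lambda>(s,b). W s b) (fst x * u, snd x))"
      by (rule continuous_on_compose2[OF contW]) (use scaled_in_interval u in \<open>auto intro!: continuous_intros simp: cbox_unit_square\<close>)
    then have "((\<lambda>(a,b). W (a * u) b) has_integral K u) (cbox (0,0) (1,1))"
      unfolding K_def by (intro integrable_integral integrable_continuous) (simp add: case_prod_unfold)
    then have "((\<lambda>x. u *\<^sub>R (\<lambda>(a,b). W (a * u) b) x) has_integral u *\<^sub>R K u) (cbox (0,0) (1,1))"
      by (rule has_integral_cmul)
    then have "((\<lambda>(a,b). cocycle B (linv (S (a * u) b) \<odot> (\<lambda>\<theta>. vector_derivative (\<lambda>a'. S (a' * u) b \<theta>) (at a)))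
       (linv (S (a * u) b) \<odot> (\<lambda>\<theta>. vector_derivative (\<lambda>b'. S (a * u) b' \<theta>) (at b)))) has_integral u *\<^sub>R K u) (cbox (0,0) (1,1))"
    proof (rule has_integral_spike_interior)
      fix x :: "real \<times> real" assume "x \<in> box (0,0) (1,1)"
      then obtain a b where x: "x = (a,b)" and ab: "a \<in> {0<..<1}" "b \<in> {0<..<1}"
        by (auto simp: box_unit_square)
      then have au: "a * u \<in> {-e<..<e}" using scaled_in_interval u by simp
      have "vector_derivative (\<lambda>a'. S (a' * u) b \<theta>) (at a) = u *\<^sub>R vector_derivative (\<lambda>s. S s b \<theta>) (at (a * u))" for \<theta>
      proof -
        have "((\<lambda>a. a * u) has_vector_derivative u) (at a)"
          by (auto intro!: derivative_eq_intros simp: has_vector_derivative_def)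
        from vector_diff_chain_at[OF this, of "\<lambda>s. S s b \<theta>"] D(1)[OF au, of b \<theta>] ab
        show ?thesis by (auto simp: o_def vector_derivative_at[OF D(1)[OF au]] intro!: vector_derivative_at)
      qed
      then show "(\<lambda>(a,b). cocycle B (linv (S (a * u) b) \<odot> (\<lambda>\<theta>. vector_derivative (\<lambda>a'. S (a' * u) b \<theta>) (at a)))
       (linv (S (a * u) b) \<odot> (\<lambda>\<theta>. vector_derivative (\<lambda>b'. S (a * u) b' \<theta>) (at b)))) x =
        u *\<^sub>R (\<lambda>(a,b). W (a * u) b) x"
        using W[OF au ab(2)] by (simp add: x)
    qed
    then show ?thesis by (simp add: square_integral_def integral_unique)
  qed
  have "continuous_on ({-e<..<e} \<times> cbox (0,0) (1,1)) (\<lambda>x. (\<lambda>(s,b). W s b) (fst (snd x) * fst x, snd (snd x)))"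
    by (rule continuous_on_compose2[OF contW]) (use scaled_in_interval in \<open>auto intro!: continuous_intros simp: cbox_unit_square\<close>)
  then have "continuous_on {-e<..<e} K"
    unfolding K_def by (intro integral_continuous_on_param) (simp add: case_prod_unfold)
  then have "isCont K 0" using e by (simp add: continuous_on_eq_continuous_at)
  from continuous_has_vector_derivative_mult[OF this]
  have "((\<lambda>u. square_integral (cocycle B) (\<lambda>a b. S (a * u) b)) has_vector_derivative K 0) (at 0)"
    by (rule has_vector_derivative_transform_within_open[where S="{-e<..<e}"]) (use e sq in auto)
  \<comment> \<open>At \<open>u = 0\<close> the integrand no longer depends on \<open>a\<close>, so
    the double integral collapses to that of \<open>W 0\<close> over \<open>b\<close>. The latter
    agrees with the given integrand away from the end points.\<close>
  moreover have "K 0 = I"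
  proof -
    have c0: "continuous_on {0..1} (W 0)"
    proof -
      have "continuous_on {0..1} (\<lambda>b. (\<lambda>(s,b). W s b) (0, b))"
        by (rule continuous_on_compose2[OF contW]) (use e in \<open>auto intro!: continuous_intros\<close>)
      then show ?thesis by simp
    qed
    have "continuous_on (cbox (0,0) (1,1)) (\<lambda>x::real\<times>real. W 0 (snd x))"
      by (rule continuous_on_compose2[OF c0]) (auto intro!: continuous_intros simp: cbox_unit_square)
    from integral_prod_continuous[OF this]
    have "K 0 = integral {0..1} (W 0)" by (simp add: K_def case_prod_unfold)
    moreover have "(W 0 has_integral I) {0..1}"
      using W[of 0 _ 1] e
      by (intro has_integral_spike_interior[OF w[folded cbox_interval], unfolded cbox_interval]) auto
    ultimately show ?thesis by (simp add: integral_unique)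
  qed
  ultimately show ?thesis by simp
qed

end

section \<open>Variation of the tau function\<close>

lemma edge_cong: "(\<And>r. r \<in> {0..1} \<Longrightarrow> \<gamma> r = \<delta> r) \<Longrightarrow> edge \<gamma> e = edge \<delta> e"
  by (simp add: edge_def)

text \<open>A path matched by a constant one is itself constant on the unit interval, and
  \<open>edge\<close> discards those. This removes the sides of squares that collapse to a
  point.\<close>

lemma edge_const:
  assumes "\<And>r. r \<in> {0..1} \<Longrightarrow> \<gamma> r = x" shows "edge \<gamma> e = 0"
proof -
  have "\<forall>r\<in>{0..1}. e r = e 0" if "\<forall>r\<in>{0..1}. \<gamma> r = e r"
  proof
    fix r :: real assume "r \<in> {0..1}"
    then have "\<gamma> r = e r" "\<gamma> r = x" using that assms by blast+
    moreover have "(0::real) \<in> {0..1}" by simp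
    then have "\<gamma> 0 = e 0" "\<gamma> 0 = x" using that assms by blast+
    ultimately show "e r = e 0" by metis
  qed
  then show ?thesis unfolding edge_def by (metis (full_types))
qed

text \<open>Deforms a path \<open>\<gamma>\<close> from \<open>e\<close> to \<open>c 0\<close> into a path from \<open>e\<close> to \<open>c s\<close>.  A product of paths
  is used because a concatenation would not be smooth.\<close>

definition deform :: "(real \<Rightarrow> 'n::finite loop) \<Rightarrow> (real \<Rightarrow> 'n loop) \<Rightarrow> real \<Rightarrow> real \<Rightarrow> 'n loop" where
  "deform c \<gamma> s b = c (b * s) \<odot> linv (c 0) \<odot> \<gamma> b"

lemma Cinf_on_snd_snd: "Cinf_on UNIV (\<lambda>x :: 'a::euclidean_space \<times> 'b::euclidean_space \<times> 'c::euclidean_space. snd (snd x))"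
  and Cinf_on_fst_snd: "Cinf_on UNIV (\<lambda>x :: 'a::euclidean_space \<times> 'b::euclidean_space \<times> 'c::euclidean_space. fst (snd x))"
  using Cinf_on_linear[OF bounded_linear_snd Cinf_on_snd[OF open_UNIV]]
    Cinf_on_linear[OF bounded_linear_fst Cinf_on_snd[OF open_UNIV]] by auto

lemma smooth_on_scaled:
  fixes S :: "real \<Rightarrow> real \<Rightarrow> real \<Rightarrow> 'b::real_normed_vector"
  assumes "smooth_on ({-e<..<e} \<times> {0..1} \<times> UNIV) (\<lambda>(s,b,\<theta>). S s b \<theta>)" "u \<in> {-e<..<e}"
  shows "smooth_on ({0..1} \<times> {0..1} \<times> UNIV) (\<lambda>(a,b,\<theta>). S (a * u) b \<theta>)"
proof -
  have "Cinf_on UNIV (\<lambda>x::real \<times> real \<times> real. (fst x * u, snd x))"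
    by (intro Cinf_on_Pair Cinf_on_linear[OF bounded_linear_mult_left] Cinf_on_fst Cinf_on_snd) auto
  from smooth_on_compose[OF assms(1) this, of "{0..1} \<times> {0..1} \<times> UNIV"]
  show ?thesis using scaled_in_interval[OF _ assms(2)] by (auto simp: case_prod_unfold)
qed

lemma smooth_on_slice:
  fixes S :: "real \<Rightarrow> real \<Rightarrow> real \<Rightarrow> 'b::real_normed_vector"
  assumes "smooth_on ({-e<..<e} \<times> {0..1} \<times> UNIV) (\<lambda>(s,b,\<theta>). S s b \<theta>)" "u \<in> {-e<..<e}"
  shows "smooth_on ({0..1} \<times> UNIV) (\<lambda>(b,\<theta>). S u b \<theta>)"
proof -
  have "Cinf_on UNIV (\<lambda>x::real \<times> real. (u, x))"
    by (intro Cinf_on_Pair Cinf_on_const Cinf_on_ident) auto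
  from smooth_on_compose[where g="\<lambda>x. (u, x)", OF assms(1) this, of "{0..1} \<times> UNIV"]
  show ?thesis using assms(2) by (auto simp: case_prod_unfold)
qed

context lie_group
begin

lemma deform_in:
  assumes "loop_subgroup G H" "\<And>s. s \<in> {-e<..<e} \<Longrightarrow> c s \<in> H" "path_in H lone h \<gamma>"
    "s \<in> {-e<..<e}" "b \<in> {0..1}"
  shows "deform c \<gamma> s b \<in> H"
  using assms scaled_in_interval[of b s e] assms(2)[of 0]
  by (auto simp: deform_def loop_subgroup_def path_in_def)

lemma deform_start:
  assumes "loop_subgroup G H" "c 0 \<in> H" "path_in H lone h \<gamma>"
  shows "deform c \<gamma> s 0 = lone" "deform c \<gamma> 0 b = \<gamma> b" "deform c \<gamma> s 1 = c s \<odot> linv (c 0) \<odot> h"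
  using assms(3) loop_subgroupD(3)[OF assms(1,2)]
  by (auto simp: deform_def path_in_def loop_ops)

lemma smooth_on_deform:
  assumes H: "loop_subgroup G H" and c: "Cinf_on ({-e<..<e} \<times> UNIV) (\<lambda>(s,\<theta>). c s \<theta>)"
    "\<And>s. s \<in> {-e<..<e} \<Longrightarrow> c s \<in> H" and e: "e > 0" and \<gamma>: "path_in H lone h \<gamma>"
  shows "smooth_on ({-e<..<e} \<times> {0..1} \<times> UNIV) (\<lambda>(s,b,\<theta>). deform c \<gamma> s b \<theta>)"
proof -
  have c': "smooth_on ({-e<..<e} \<times> UNIV) (\<lambda>(s,\<theta>). c s \<theta>)"
    using c(1) by (auto simp: smooth_on_iff_Cinf_on)
  have 1: "smooth_on ({-e<..<e} \<times> {0..1} \<times> UNIV) (\<lambda>x. (\<lambda>(s,\<theta>). c s \<theta>) (fst (snd x) * fst x, snd (snd x)))"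
  proof (rule smooth_on_compose[OF c'])
    show "Cinf_on UNIV (\<lambda>x::real \<times> real \<times> real. (fst (snd x) * fst x, snd (snd x)))"
      by (intro Cinf_on_Pair Cinf_on_bilinear[OF bounded_bilinear_mult] Cinf_on_fst
          Cinf_on_fst_snd Cinf_on_snd_snd) auto
  qed (use scaled_in_interval in auto)
  have 2: "smooth_on ({-e<..<e} \<times> {0..1::real} \<times> UNIV) (\<lambda>x. (\<lambda>\<theta>. matrix_inv (c 0 \<theta>)) (snd (snd x)))"
  proof (rule smooth_on_compose[where T=UNIV and V=UNIV and g="\<lambda>x. snd (snd x)"])
    have "c 0 \<in> H" using c(2) e by simp
    then show "smooth_on UNIV (\<lambda>\<theta>. matrix_inv (c 0 \<theta>))"
      using loop_subgroupD[OF H] by (auto simp: smooth_on_open_iff intro!: Cinf_on_matrix_inv)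
    show "Cinf_on UNIV (\<lambda>x::real \<times> real \<times> real. snd (snd x))"
      by (rule Cinf_on_snd_snd)
  qed auto
  have 3: "smooth_on ({-e<..<e} \<times> {0..1} \<times> UNIV) (\<lambda>x. (\<lambda>(b,\<theta>). \<gamma> b \<theta>) (snd x))"
    by (rule smooth_on_compose[where T="{0..1} \<times> UNIV" and V=UNIV])
       (use \<gamma> in \<open>auto simp: path_in_def intro!: Cinf_on_snd\<close>)
  from smooth_on_matrix_mult[OF smooth_on_matrix_mult[OF 1 2] 3]
  show ?thesis by (simp add: deform_def loop_ops case_prod_unfold)
qed

end

section \<open>Moving the surface and differentiating its integral\<close>

locale tau_variation = dressing G Lp Lm V f M E \<epsilon> + lie_group_form G B
  for G :: "(complex^'n::finite^'n) set" and Lp Lm :: "'n loop set" and V :: "'n loop"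
    and f M E :: "real \<Rightarrow> 'n loop" and \<epsilon> :: real
    and B :: "complex^'n^'n \<Rightarrow> complex^'n^'n \<Rightarrow> complex" +
  assumes compatible: "compatible (cocycle B) Lp Lm"
    and well_defined: "mu_well_defined (cocycle B) (loop_group G) Lp Lm"
begin

lemma cocycle_zero_plus: "\<xi> \<in> lie_algebra Lp \<Longrightarrow> \<eta> \<in> lie_algebra Lp \<Longrightarrow> cocycle B \<xi> \<eta> = 0"
  and cocycle_zero_minus: "\<xi> \<in> lie_algebra Lm \<Longrightarrow> \<eta> \<in> lie_algebra Lm \<Longrightarrow> cocycle B \<xi> \<eta> = 0"
  using compatible by (auto simp: compatible_def)

lemma subgroup_loop_group: "loop_subgroup G H \<Longrightarrow> h \<in> H \<Longrightarrow> h \<in> loop_group G"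
  by (auto simp: loop_subgroup_def)

lemma Lm_mult: "p \<in> Lm \<Longrightarrow> q \<in> Lm \<Longrightarrow> p \<odot> q \<in> Lm"
  and Lm_inv: "p \<in> Lm \<Longrightarrow> linv p \<in> Lm"
  and L_mult: "p \<in> loop_group G \<Longrightarrow> q \<in> loop_group G \<Longrightarrow> p \<odot> q \<in> loop_group G"
  and L_inv: "p \<in> loop_group G \<Longrightarrow> linv p \<in> loop_group G"
  using subgroup_plus subgroup_minus loop_subgroup_loop_group by (auto simp: loop_subgroup_def)

context
  fixes gp :: "real \<Rightarrow> 'n loop"
  assumes gp: "path_in Lp lone (E 0) gp"
begin

text \<open>For fixed \<open>s\<close> this is the deformed version of the path from
  \<open>M(s)^(-1)\<close> that runs along translates of plus elements. It ends at
  \<open>M(s)^(-1) E(s)\<close>, that is, at the argument of \<open>mu\<close> for parameter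
  \<open>s\<close>.\<close>

definition strip :: "real \<Rightarrow> real \<Rightarrow> 'n loop" where
  "strip s b = linv (M s) \<odot> deform E gp s b"

lemma strip_in: "s \<in> {-\<epsilon><..<\<epsilon>} \<Longrightarrow> b \<in> {0..1} \<Longrightarrow> strip s b \<in> loop_group G"
  unfolding strip_def using deform_in[OF subgroup_plus E_in gp] M_in
  by (auto intro!: L_mult L_inv intro: subgroup_loop_group[OF subgroup_plus] subgroup_loop_group[OF subgroup_minus])

lemma smooth_strip: "smooth_on ({-\<epsilon><..<\<epsilon>} \<times> {0..1} \<times> UNIV) (\<lambda>(s,b,\<theta>). strip s b \<theta>)"
proof -
  have "smooth_on ({-\<epsilon><..<\<epsilon>} \<times> {0..1::real} \<times> UNIV) (\<lambda>x. (\<lambda>(s,\<theta>). matrix_inv (M s \<theta>)) (fst x, snd (snd x)))"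
  proof (rule smooth_on_compose[where T="{-\<epsilon><..<\<epsilon>} \<times> UNIV" and V=UNIV and g="\<lambda>x. (fst x, snd (snd x))"])
    have "Cinf_on ({-\<epsilon><..<\<epsilon>} \<times> UNIV) (\<lambda>x. matrix_inv ((\<lambda>(s,\<theta>). M s \<theta>) x))"
      by (intro Cinf_on_matrix_inv Cinf_M) (auto simp: in_G)
    then show "smooth_on ({-\<epsilon><..<\<epsilon>} \<times> UNIV) (\<lambda>(s,\<theta>). matrix_inv (M s \<theta>))"
      by (auto simp: smooth_on_iff_Cinf_on case_prod_unfold)
    show "Cinf_on UNIV (\<lambda>x::real \<times> real \<times> real. (fst x, snd (snd x)))"
      by (intro Cinf_on_Pair Cinf_on_fst Cinf_on_snd_snd) auto
  qed auto
  from smooth_on_matrix_mult[OF this smooth_on_deform[OF subgroup_plus Cinf_E E_in eps gp]]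
  show ?thesis by (simp add: strip_def loop_ops case_prod_unfold)
qed

text \<open>Conjugated back by \<open>gp b\<close>, the logarithmic \<open>s\<close>-derivative at
  \<open>0\<close> is \<open>\<zeta>\<close> minus the logarithmic variation of \<open>M\<close>. It
  differs from \<open>Y\<close> by \<open>\<xi> - \<zeta>\<close> in the plus algebra. The
  \<open>b\<close>-derivative is also in the plus algebra, so compatibility makes the difference
  invisible to the cocycle.\<close>

lemma strip_cocycle:
  assumes X: "\<xi> \<in> lie_algebra Lp" and Y: "Y = \<xi> \<oplus> lneg (variation M \<odot> linv (M 0))" and b: "b \<in> {0<..<1}"
  shows "cocycle B (linv (strip 0 b) \<odot> (\<lambda>\<theta>. vector_derivative (\<lambda>s. strip s b \<theta>) (at 0)))
      (linv (strip 0 b) \<odot> (\<lambda>\<theta>. vector_derivative (\<lambda>b. strip 0 b \<theta>) (at b))) =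
    cocycle B (linv (gp b) \<odot> Y \<odot> gp b) (linv (gp b) \<odot> (\<lambda>\<theta>. vector_derivative (\<lambda>b. gp b \<theta>) (at b)))"
proof -
  have b': "b \<in> {0..1}" using b by simp
  have gpL: "gp b \<in> Lp" if "b \<in> {0..1}" for b using gp that by (simp add: path_in_def)
  have gpG: "gp b \<theta> \<in> G" if "b \<in> {0..1}" for b \<theta> using loop_subgroupD(3)[OF subgroup_plus gpL[OF that]] .
  note G0 = in_G[OF zero_in]
  obtain U where U: "{0..1} \<times> UNIV \<subseteq> U" "Cinf_on U (\<lambda>(b,\<theta>). gp b \<theta>)"
    using gp unfolding path_in_def smooth_on_iff_Cinf_on by blast
  have strip0: "strip 0 b = linv (M 0) \<odot> gp b" for b
    using deform_start[where c=E, OF subgroup_plus E_in[OF zero_in] gp] by (simp add: strip_def)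
  have vd: "((\<lambda>b. gp b \<theta>) has_vector_derivative vector_derivative (\<lambda>b. gp b \<theta>) (at b)) (at b)" for \<theta>
    using has_vector_derivative_partial_fst[OF U(2), of b \<theta>] U(1) b' vector_derivative_at by fastforce
  have \<eta>: "linv (strip 0 b) \<odot> (\<lambda>\<theta>. vector_derivative (\<lambda>b. strip 0 b \<theta>) (at b)) =
      linv (gp b) \<odot> (\<lambda>\<theta>. vector_derivative (\<lambda>b. gp b \<theta>) (at b))" (is "_ = ?\<eta>")
  proof
    fix \<theta>
    have "vector_derivative (\<lambda>b. strip 0 b \<theta>) (at b) = matrix_inv (M 0 \<theta>) ** vector_derivative (\<lambda>b. gp b \<theta>) (at b)"
      unfolding strip0 loop_ops
      by (rule vector_derivative_at[OF bounded_linear.has_vector_derivative[OF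
            bounded_bilinear.bounded_linear_right[OF bounded_bilinear_matrix_mult] vd]])
    then show "(linv (strip 0 b) \<odot> (\<lambda>\<theta>. vector_derivative (\<lambda>b. strip 0 b \<theta>) (at b))) \<theta> = ?\<eta> \<theta>"
      using G0 gpG[OF b'] by (simp add: strip0 loop_ops matrix_inv_mult matrix_assoc)
  qed
  \<comment> \<open>The factor \<open>b\<close> comes from differentiating \<open>E (b * s)\<close>
    in \<open>s\<close>.\<close>
  define \<zeta> where "\<zeta> = (\<lambda>\<theta>. b *\<^sub>R (variation E \<odot> linv (E 0)) \<theta>)"
  have \<zeta>: "\<zeta> \<in> lie_algebra Lp" unfolding \<zeta>_def by (rule scaleR_in_lie_algebra[OF variation_E_in])
  let ?Ad = "\<lambda>X. linv (gp b) \<odot> X \<odot> gp b"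
  have Ad: "?Ad X \<in> lie_algebra Lp" if "X \<in> lie_algebra Lp" for X
  proof -
    have "linv (gp b) \<in> Lp" using gpL[OF b'] subgroup_plus by (auto simp: loop_subgroup_def)
    from Ad_in_lie_algebra[OF subgroup_plus this that] show ?thesis
      using gpG[OF b'] by (simp add: loop_ops)
  qed
  have AdL: "?Ad X \<in> loop_algebra G" if "X \<in> loop_algebra G" for X
  proof -
    have "linv (gp b) \<in> loop_group G" using gpL[OF b'] by (intro L_inv subgroup_loop_group[OF subgroup_plus])
    from Ad_loop_algebra[OF this that] show ?thesis using gpG[OF b'] by (simp add: loop_ops)
  qed
  let ?n = "lneg (variation M \<odot> linv (M 0))"
  have \<xi>: "linv (strip 0 b) \<odot> (\<lambda>\<theta>. vector_derivative (\<lambda>s. strip s b \<theta>) (at 0)) = ?Ad (\<zeta> \<oplus> ?n)"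
  proof
    fix \<theta>
    have "((\<lambda>s. matrix_inv (M s \<theta>)) has_vector_derivative - (matrix_inv (M 0 \<theta>) ** variation M \<theta> ** matrix_inv (M 0 \<theta>))) (at 0)"
    proof (rule has_vector_derivative_matrix_inv[OF _ zero_in _ has_variation[OF Cinf_M]])
      have "Cinf_on {-\<epsilon><..<\<epsilon>} (\<lambda>s. (\<lambda>(s,\<theta>). M s \<theta>) (s, \<theta>))"
        by (rule Cinf_on_compose[OF Cinf_M]) (auto intro!: Cinf_on_Pair Cinf_on_const Cinf_on_ident)
      then show "Cinf_on {-\<epsilon><..<\<epsilon>} (\<lambda>s. M s \<theta>)" by simp
    qed (simp add: in_G)
    moreover have "((\<lambda>s. (E (b * s) \<theta> ** matrix_inv (E 0 \<theta>)) ** gp b \<theta>) has_vector_derivative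
        ((b *\<^sub>R variation E \<theta>) ** matrix_inv (E 0 \<theta>)) ** gp b \<theta>) (at 0)"
    proof -
      have "((\<lambda>s. b * s) has_vector_derivative b) (at 0)"
        by (auto intro!: derivative_eq_intros simp: has_vector_derivative_def)
      from vector_diff_chain_at[OF this, of "\<lambda>s. E s \<theta>"] has_variation[OF Cinf_E, of \<theta>]
      have "((\<lambda>s. E (b * s) \<theta>) has_vector_derivative b *\<^sub>R variation E \<theta>) (at 0)" by (simp add: o_def)
      then show ?thesis
        by (rule bounded_linear.has_vector_derivative[OF bounded_bilinear.bounded_linear_left[OF bounded_bilinear_matrix_mult]
              bounded_linear.has_vector_derivative[OF bounded_bilinear.bounded_linear_left[OF bounded_bilinear_matrix_mult]]])
    qed
    ultimately have "((\<lambda>s. matrix_inv (M s \<theta>) ** ((E (b * s) \<theta> ** matrix_inv (E 0 \<theta>)) ** gp b \<theta>)) has_vector_derivative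
       matrix_inv (M 0 \<theta>) ** (((b *\<^sub>R variation E \<theta>) ** matrix_inv (E 0 \<theta>)) ** gp b \<theta>) +
       (- (matrix_inv (M 0 \<theta>) ** variation M \<theta> ** matrix_inv (M 0 \<theta>))) ** ((E (b * 0) \<theta> ** matrix_inv (E 0 \<theta>)) ** gp b \<theta>)) (at 0)"
      by (rule has_vector_derivative_matrix_mult)
    from vector_derivative_at[OF this]
    show "(linv (strip 0 b) \<odot> (\<lambda>\<theta>. vector_derivative (\<lambda>s. strip s b \<theta>) (at 0))) \<theta> = ?Ad (\<zeta> \<oplus> ?n) \<theta>"
      unfolding strip0 unfolding strip_def deform_def
      using G0[of \<theta>] gpG[OF b', of \<theta>]
      by (simp add: loop_ops \<zeta>_def matrix_simps matrix_assoc matrix_inv_mult)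
  qed
  have o: "open ({0<..<1::real} \<times> (UNIV::real set))" by (simp add: open_Times)
  have "Cinf_on ({0<..<1} \<times> UNIV) (\<lambda>(b,\<theta>). gp b \<theta>)"
    by (rule Cinf_on_subset[OF U(2) o]) (use U(1) in auto)
  from left_log_derivative_lie_algebra[OF subgroup_plus _ b this]
  have \<eta>L: "?\<eta> \<in> lie_algebra Lp" using gpL by simp
  have diff: "\<xi> \<oplus> lneg \<zeta> \<in> lie_algebra Lp"
    by (intro add_in_lie_algebra neg_in_lie_algebra X \<zeta> subgroup_plus)
  have n: "?n \<in> loop_algebra G"
    by (intro lie_algebra_minus_loop_algebra neg_in_lie_algebra variation_M_in)
  have "?Ad Y = ?Ad (\<zeta> \<oplus> ?n) \<oplus> ?Ad (\<xi> \<oplus> lneg \<zeta>)"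
    by (simp add: Y loop_ops fun_eq_iff matrix_simps)
  moreover have "cocycle B (?Ad (\<zeta> \<oplus> ?n) \<oplus> ?Ad (\<xi> \<oplus> lneg \<zeta>)) ?\<eta> =
      cocycle B (?Ad (\<zeta> \<oplus> ?n)) ?\<eta> + cocycle B (?Ad (\<xi> \<oplus> lneg \<zeta>)) ?\<eta>"
    by (intro cocycle_add_left AdL add_loop_algebra lie_algebra_plus_loop_algebra[OF diff]
        lie_algebra_plus_loop_algebra[OF \<zeta>] n lie_algebra_plus_loop_algebra[OF \<eta>L])
  ultimately show ?thesis
    using cocycle_zero_plus[OF Ad[OF diff] \<eta>L] unfolding \<xi> \<eta> by simp
qed

lemma strip_variation:
  assumes "\<xi> \<in> lie_algebra Lp" "Y = \<xi> \<oplus> lneg (variation M \<odot> linv (M 0))" "Y \<in> loop_algebra G"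
  shows "((\<lambda>u. square_integral (cocycle B) (\<lambda>a b. strip (a * u) b)) has_vector_derivative
    - pairing B 0 Y (lpow 1 (dlam (E 0) \<odot> linv (E 0)))) (at 0)"
proof (rule square_integral_scaled[OF smooth_strip eps strip_in])
  have "path_in (loop_group G) lone (E 0) gp"
    using gp subgroup_loop_group[OF subgroup_plus] by (auto simp: path_in_def)
  from integral_cocycle_path[OF this assms(3)]
  show "((\<lambda>b. cocycle B (linv (strip 0 b) \<odot> (\<lambda>\<theta>. vector_derivative (\<lambda>s. strip s b \<theta>) (at 0)))
      (linv (strip 0 b) \<odot> (\<lambda>\<theta>. vector_derivative (\<lambda>b. strip 0 b \<theta>) (at b)))) has_integral
      - pairing B 0 Y (lpow 1 (dlam (E 0) \<odot> linv (E 0)))) {0..1}"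
    unfolding cbox_interval[symmetric]
    by (rule has_integral_spike_interior) (use strip_cocycle[OF assms(1,2)] in simp)
qed

end

text \<open>The constant \<open>c\<close> is the integral over a surface that is admissible at
  \<open>u = 0\<close>. For every other \<open>u\<close> the surface is that one with three squares
  attached, of which only the strip has a nonzero contribution.\<close>

lemma mu_value_along_curve:
  assumes "V \<odot> linv (f 0) \<in> mu_domain (cocycle B) (loop_group G) Lp Lm"
  obtains gp c where "path_in Lp lone (E 0) gp"
    "\<And>u. u \<in> {-\<epsilon><..<\<epsilon>} \<Longrightarrow> mu_value (cocycle B) (loop_group G) Lp Lm (V \<odot> linv (f u))
       (exp (c - square_integral (cocycle B) (\<lambda>a b. strip gp (a * u) b)))"
proof -
  let ?w = "cocycle B"
  obtain fp fm g1 g2 \<gamma>p \<gamma>m gp gm \<Omega> where mem: "fp \<in> Lp" "fm \<in> Lm" "g1 \<in> Lp" "g2 \<in> Lm"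
    and Vf: "V \<odot> linv (f 0) = fp \<odot> linv fm" and Vg: "V \<odot> linv (f 0) = linv g2 \<odot> g1"
    and paths: "path_in Lp lone fp \<gamma>p" "path_in Lm lone fm \<gamma>m" "path_in Lp lone g1 gp" "path_in Lm lone g2 gm"
    and \<Omega>: "is_surface (loop_group G) \<Omega>"
    and bd: "\<And>e. surface_boundary \<Omega> e = edge \<gamma>p e + edge (\<lambda>r. fp \<odot> linv (\<gamma>m r)) e
               - edge (\<lambda>r. linv g2 \<odot> gp r) e - edge (\<lambda>r. linv (gm r)) e"
    using assms unfolding mu_domain_def mu_value_def by blast
  \<comment> \<open>By uniqueness of this factorization, the paths \<open>gp\<close> and
    \<open>gm\<close> of the given surface end at \<open>E 0\<close> and \<open>M 0\<close>, so they
    can be deformed along \<open>E\<close> and \<open>M\<close>.\<close>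
  have "linv g2 \<odot> g1 = linv (M 0) \<odot> E 0" using Vg factor[OF zero_in] by simp
  then have g: "g2 = M 0" "g1 = E 0"
    using factorization_unique[OF mem(3) E_in[OF zero_in] mem(4) M_in[OF zero_in]] by auto
  note gp = paths(3)[unfolded g] and gm = paths(4)[unfolded g] and \<gamma>m = paths(2)
  note f0 = f_in[OF zero_in] and M0 = M_in[OF zero_in] and E0 = E_in[OF zero_in]
  note Df = deform_start[where c=f, OF subgroup_minus f0 \<gamma>m] and DM = deform_start[where c=M, OF subgroup_minus M0 gm]
    and DE = deform_start[where c=E, OF subgroup_plus E0 gp]
  have smf: "smooth_on ({-\<epsilon><..<\<epsilon>} \<times> {0..1} \<times> UNIV) (\<lambda>(s,b,\<theta>). deform f \<gamma>m s b \<theta>)"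
    by (rule smooth_on_deform[OF subgroup_minus Cinf_f f_in eps \<gamma>m])
  have inf: "deform f \<gamma>m s b \<in> Lm" if "s \<in> {-\<epsilon><..<\<epsilon>}" "b \<in> {0..1}" for s b
    by (rule deform_in[OF subgroup_minus f_in \<gamma>m that])
  have smM: "smooth_on ({-\<epsilon><..<\<epsilon>} \<times> {0..1} \<times> UNIV) (\<lambda>(s,b,\<theta>). deform M gm s b \<theta>)"
    by (rule smooth_on_deform[OF subgroup_minus Cinf_M M_in eps gm])
  have inM: "deform M gm s b \<in> Lm" if "s \<in> {-\<epsilon><..<\<epsilon>}" "b \<in> {0..1}" for s b
    by (rule deform_in[OF subgroup_minus M_in gm that])
  have smE: "smooth_on ({-\<epsilon><..<\<epsilon>} \<times> {0..1} \<times> UNIV) (\<lambda>(s,b,\<theta>). deform E gp s b \<theta>)"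
    by (rule smooth_on_deform[OF subgroup_plus Cinf_E E_in eps gp])
  have inE: "deform E gp s b \<in> Lp" if "s \<in> {-\<epsilon><..<\<epsilon>}" "b \<in> {0..1}" for s b
    by (rule deform_in[OF subgroup_plus E_in gp that])
  have fpG: "fp \<theta> \<in> G" and fmG: "fm \<theta> \<in> G" for \<theta>
    using loop_subgroupD(3) subgroup_plus subgroup_minus mem by blast+
  \<comment> \<open>The factors \<open>fp\<close> and \<open>fm\<close> are kept as given: only the
    product of \<open>fp\<close> with the inverse of \<open>fm\<close> is known. Multiplying
    \<open>fm\<close> on the left by \<open>f(u) f(0)^(-1)\<close> absorbs the motion of
    \<open>f\<close> while \<open>fp\<close> stays fixed.\<close>
  have fend: "fp \<odot> linv (f u \<odot> linv (f 0) \<odot> fm) = V \<odot> linv (f u)" if u: "u \<in> {-\<epsilon><..<\<epsilon>}" for u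
  proof
    fix \<theta>
    have "V \<theta> ** matrix_inv (f 0 \<theta>) = fp \<theta> ** matrix_inv (fm \<theta>)"
      using fun_cong[OF Vf, of \<theta>] by (simp add: loop_ops)
    then have "V \<theta> ** matrix_inv (f 0 \<theta>) ** f 0 \<theta> ** matrix_inv (f u \<theta>) = fp \<theta> ** matrix_inv (fm \<theta>) ** f 0 \<theta> ** matrix_inv (f u \<theta>)"
      by simp
    then show "(fp \<odot> linv (f u \<odot> linv (f 0) \<odot> fm)) \<theta> = (V \<odot> linv (f u)) \<theta>"
      using in_G[OF zero_in] in_G[OF u] fmG by (simp add: loop_ops matrix_inv_mult matrix_assoc)
  qed
  have Eend: "linv (M u) \<odot> (E u \<odot> linv (E 0) \<odot> E 0) = V \<odot> linv (f u)" if u: "u \<in> {-\<epsilon><..<\<epsilon>}" for u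
    using factor[OF u] in_G[OF zero_in] by (simp add: loop_ops matrix_assoc)
  have Mend: "M u \<odot> linv (M 0) \<odot> M 0 = M u" for u
    using in_G[OF zero_in] by (simp add: loop_ops matrix_assoc)
  have smooth_inv: "smooth_on ({-\<epsilon><..<\<epsilon>} \<times> {0..1} \<times> UNIV) (\<lambda>(s,b,\<theta>). linv (deform c \<gamma> s b) \<theta>)"
    if "smooth_on ({-\<epsilon><..<\<epsilon>} \<times> {0..1} \<times> UNIV) (\<lambda>(s,b,\<theta>). deform c \<gamma> s b \<theta>)"
      "\<And>s b. s \<in> {-\<epsilon><..<\<epsilon>} \<Longrightarrow> b \<in> {0..1} \<Longrightarrow> deform c \<gamma> s b \<in> Lm" for c \<gamma>
  proof -
    have "smooth_on ({-\<epsilon><..<\<epsilon>} \<times> {0..1} \<times> UNIV) (\<lambda>x. matrix_inv ((\<lambda>(s,b,\<theta>). deform c \<gamma> s b \<theta>) x))"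
      by (rule smooth_on_matrix_inv[OF that(1)])
         (use loop_subgroupD(3)[OF subgroup_minus that(2)] in auto)
    then show ?thesis by (simp add: linv_def case_prod_unfold)
  qed
  have smf': "smooth_on ({-\<epsilon><..<\<epsilon>} \<times> {0..1} \<times> UNIV) (\<lambda>(s,b,\<theta>). linv (deform f \<gamma>m s b) \<theta>)"
    by (rule smooth_inv[OF smf inf])
  have smM': "smooth_on ({-\<epsilon><..<\<epsilon>} \<times> {0..1} \<times> UNIV) (\<lambda>(s,b,\<theta>). linv (deform M gm s b) \<theta>)"
    by (rule smooth_inv[OF smM inM])
  have smf'': "smooth_on ({-\<epsilon><..<\<epsilon>} \<times> {0..1} \<times> UNIV) (\<lambda>(s,b,\<theta>). (fp \<odot> linv (deform f \<gamma>m s b)) \<theta>)"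
  proof -
    have "smooth_on ({-\<epsilon><..<\<epsilon>} \<times> {0..1::real} \<times> UNIV) (\<lambda>x. fp (snd (snd x)))"
    proof (rule smooth_on_compose[where T=UNIV and V=UNIV and g="\<lambda>x. snd (snd x)"])
      show "smooth_on UNIV fp" using loop_subgroupD(1)[OF subgroup_plus mem(1)] by (simp add: smooth_on_open_iff)
      show "Cinf_on UNIV (\<lambda>x::real \<times> real \<times> real. snd (snd x))"
        by (rule Cinf_on_snd_snd)
    qed auto
    from smooth_on_matrix_mult[OF this smf'] show ?thesis by (simp add: lmul_def case_prod_unfold)
  qed
  define \<sigma>1 \<sigma>2 \<sigma>3 where "\<sigma>1 u a b = fp \<odot> linv (deform f \<gamma>m (a * u) b)"
    and "\<sigma>2 u a b = strip gp (a * u) b" and "\<sigma>3 u a b = linv (deform M gm (a * u) b)" for u a b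
  show ?thesis
  proof (rule that[OF gp])
    fix u assume u: "u \<in> {-\<epsilon><..<\<epsilon>}"
    note au = scaled_in_interval[OF _ u]
    \<comment> \<open>With these signs the auxiliary sides cancel: the curve
      \<open>V f(ru)^(-1)\<close> is shared by the first two squares and \<open>M(ru)^(-1)\<close>
      by the last two. The sides left over exchange the old paths for the deformed ones.\<close>
    let ?\<Omega> = "(1, \<sigma>1 u) # (-1, \<sigma>2 u) # (-1, \<sigma>3 u) # \<Omega>"
    have "square_integral ?w (\<lambda>a b. fp \<odot> linv (deform f \<gamma>m (a * u) b)) = 0"
      by (rule square_integral_zero[OF subgroup_minus cocycle_zero_minus fpG smooth_on_scaled[OF smf' u]])
         (auto intro!: Lm_inv inf au)
    then have s1: "square_integral ?w (\<sigma>1 u) = 0" by (simp add: \<sigma>1_def[abs_def])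
    \<comment> \<open>The factor \<open>lone\<close> presents the third square as a translate, the
      shape to which the vanishing lemma applies.\<close>
    have "square_integral ?w (\<lambda>a b. lone \<odot> linv (deform M gm (a * u) b)) = 0"
      by (rule square_integral_zero[OF subgroup_minus cocycle_zero_minus _ smooth_on_scaled[OF smM' u]])
         (auto intro!: Lm_inv inM au simp: lone_def)
    then have s3: "square_integral ?w (\<sigma>3 u) = 0" by (simp add: \<sigma>3_def[abs_def] lone_def lmul_def)
    have "fp \<odot> linv (deform f \<gamma>m (a * u) b) \<in> loop_group G" "strip gp (a * u) b \<in> loop_group G"
      "linv (deform M gm (a * u) b) \<in> loop_group G" if "a \<in> {0..1}" "b \<in> {0..1}" for a b
      using subgroup_loop_group[OF subgroup_plus mem(1)] subgroup_loop_group[OF subgroup_minus inf[OF au[OF that(1)] that(2)]]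
        subgroup_loop_group[OF subgroup_minus inM[OF au[OF that(1)] that(2)]] strip_in[OF gp au[OF that(1)] that(2)]
      by (auto intro!: L_mult L_inv)
    then have surf: "is_surface (loop_group G) ?\<Omega>"
      using \<Omega> smooth_on_scaled[OF smf'' u] smooth_on_scaled[OF smooth_strip[OF gp] u] smooth_on_scaled[OF smM' u]
      by (simp add: is_surface_def \<sigma>1_def[abs_def] \<sigma>2_def[abs_def] \<sigma>3_def[abs_def])
    have bd1: "square_boundary (\<sigma>1 u) e = edge (\<lambda>r. fp \<odot> linv (deform f \<gamma>m u r)) e
        - edge (\<lambda>r. V \<odot> linv (f (r * u))) e - edge (\<lambda>r. fp \<odot> linv (\<gamma>m r)) e" for e
    proof -
      \<comment> \<open>At \<open>b = 0\<close> every deformed path is at the identity, so this side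
        rests at \<open>fp\<close> and is degenerate.\<close>
      have "edge (\<lambda>a. \<sigma>1 u a 0) e = 0"
        by (rule edge_const[of _ fp]) (simp add: \<sigma>1_def Df loop_ops)
      moreover have "edge (\<lambda>a. \<sigma>1 u a 1) e = edge (\<lambda>r. V \<odot> linv (f (r * u))) e"
        by (rule edge_cong) (simp only: \<sigma>1_def Df fend[OF au])
      ultimately show ?thesis by (simp add: square_boundary_def \<sigma>1_def Df)
    qed
    have bd2: "square_boundary (\<sigma>2 u) e = edge (\<lambda>r. linv (M (r * u))) e + edge (\<lambda>r. linv (M u) \<odot> deform E gp u r) e
        - edge (\<lambda>r. V \<odot> linv (f (r * u))) e - edge (\<lambda>r. linv g2 \<odot> gp r) e" for e
    proof -
      have "edge (\<lambda>a. \<sigma>2 u a 0) e = edge (\<lambda>r. linv (M (r * u))) e"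
        by (rule edge_cong) (simp add: \<sigma>2_def strip_def[OF gp] DE loop_ops)
      moreover have "edge (\<lambda>a. \<sigma>2 u a 1) e = edge (\<lambda>r. V \<odot> linv (f (r * u))) e"
        by (rule edge_cong) (simp only: \<sigma>2_def strip_def[OF gp] DE Eend[OF au])
      ultimately show ?thesis by (simp add: square_boundary_def \<sigma>2_def strip_def[OF gp] DE g)
    qed
    have bd3: "square_boundary (\<sigma>3 u) e = edge (\<lambda>r. linv (deform M gm u r)) e
        - edge (\<lambda>r. linv (M (r * u))) e - edge (\<lambda>r. linv (gm r)) e" for e
    proof -
      have "edge (\<lambda>a. \<sigma>3 u a 0) e = 0"
        by (rule edge_const[of _ lone]) (simp add: \<sigma>3_def DM loop_ops)
      moreover have "edge (\<lambda>a. \<sigma>3 u a 1) e = edge (\<lambda>r. linv (M (r * u))) e"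
        by (rule edge_cong) (simp only: \<sigma>3_def DM Mend)
      ultimately show ?thesis by (simp add: square_boundary_def \<sigma>3_def DM)
    qed
    have BD: "surface_boundary ?\<Omega> e = edge \<gamma>p e + edge (\<lambda>r. fp \<odot> linv (deform f \<gamma>m u r)) e
               - edge (\<lambda>r. linv (M u) \<odot> deform E gp u r) e - edge (\<lambda>r. linv (deform M gm u r)) e" for e
      using bd[of e] bd1[of e] bd2[of e] bd3[of e] by (simp add: surface_boundary_def)
    have EXP: "exp (surface_integral ?w \<Omega> - square_integral ?w (\<lambda>a b. strip gp (a * u) b)) = exp (surface_integral ?w ?\<Omega>)"
      by (simp add: surface_integral_def s1 s3 \<sigma>2_def[abs_def])
    have Pf: "path_in Lm lone (f u \<odot> linv (f 0) \<odot> fm) (deform f \<gamma>m u)"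
      using smooth_on_slice[OF smf u] inf[OF u] Df by (simp add: path_in_def)
    have PM: "path_in Lm lone (M u) (deform M gm u)"
      using smooth_on_slice[OF smM u] inM[OF u] DM Mend by (simp add: path_in_def)
    have PE: "path_in Lp lone (E u) (deform E gp u)"
      using smooth_on_slice[OF smE u] inE[OF u] DE in_G[OF zero_in] by (simp add: path_in_def loop_ops matrix_assoc)
    have Lf: "f u \<odot> linv (f 0) \<odot> fm \<in> Lm" using f_in[OF u] f0 mem by (intro Lm_mult Lm_inv)
    show "mu_value ?w (loop_group G) Lp Lm (V \<odot> linv (f u))
       (exp (surface_integral ?w \<Omega> - square_integral ?w (\<lambda>a b. strip gp (a * u) b)))"
      unfolding mu_value_def
      by (intro bexI[of _ fp] bexI[of _ "f u \<odot> linv (f 0) \<odot> fm"] bexI[of _ "E u"] bexI[of _ "M u"]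
          exI[of _ \<gamma>p] exI[of _ "deform f \<gamma>m u"] exI[of _ "deform E gp u"] exI[of _ "deform M gm u"] exI[of _ ?\<Omega>]
          conjI allI)
         (rule fend[OF u, symmetric] factor[OF u] paths(1) Pf PE PM surf BD EXP mem(1) Lf E_in[OF u] M_in[OF u])+
  qed
qed

text \<open>The exponent found along the curve is itself the local branch of the logarithm, and
  well-definedness identifies its exponential with \<open>mu\<close>. The sign of the strip in the
  surface cancels the sign of the primitive.\<close>

lemma log_variation_mu:
  assumes X: "\<xi> \<in> lie_algebra Lp" and Y: "Y = \<xi> \<oplus> lneg (variation M \<odot> linv (M 0))" "Y \<in> loop_algebra G"
    and dom: "V \<odot> linv (f 0) \<in> mu_domain (cocycle B) (loop_group G) Lp Lm"
  shows "has_log_variation (\<lambda>u. mu (cocycle B) (loop_group G) Lp Lm (V \<odot> linv (f u)))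
    (pairing B 0 Y (lpow 1 (dlam (E 0) \<odot> linv (E 0))))"
proof -
  obtain gp c where gp: "path_in Lp lone (E 0) gp"
    and val: "\<And>u. u \<in> {-\<epsilon><..<\<epsilon>} \<Longrightarrow> mu_value (cocycle B) (loop_group G) Lp Lm (V \<odot> linv (f u))
       (exp (c - square_integral (cocycle B) (\<lambda>a b. strip gp (a * u) b)))"
    by (rule mu_value_along_curve[OF dom], rule that)
  let ?\<rho> = "\<lambda>u. c - square_integral (cocycle B) (\<lambda>a b. strip gp (a * u) b)"
  have "mu (cocycle B) (loop_group G) Lp Lm (V \<odot> linv (f u)) = exp (?\<rho> u)" if "u \<in> {-\<epsilon><..<\<epsilon>}" for u
    unfolding mu_def
    using val[OF that] well_defined unfolding mu_well_defined_def by (intro the_equality) blast+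
  then have "\<forall>\<^sub>F u in nhds 0. exp (?\<rho> u) = mu (cocycle B) (loop_group G) Lp Lm (V \<odot> linv (f u))"
    unfolding eventually_nhds using eps by (intro exI[of _ "{-\<epsilon><..<\<epsilon>}"]) auto
  moreover have "(?\<rho> has_vector_derivative 0 - - pairing B 0 Y (lpow 1 (dlam (E 0) \<odot> linv (E 0)))) (at 0)"
    by (rule has_vector_derivative_diff[OF has_vector_derivative_const strip_variation[OF gp X Y]])
  ultimately show ?thesis unfolding has_log_variation_def by (intro exI[of _ ?\<rho>]) simp
qed

end

section \<open>The Virasoro action on reduced frames and tau functions\<close>

theorem theorem5p7:
  fixes G :: "(complex^'n::finite^'n) set"
    and B :: "complex^'n^'n \<Rightarrow> complex^'n^'n \<Rightarrow> complex"
    and L Lp Lm :: "'n loop set"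
    and w :: "'n loop \<Rightarrow> 'n loop \<Rightarrow> complex"
    and J :: "nat \<Rightarrow> 'n loop"
    and C :: "complex \<Rightarrow> complex^'n^'n"
    and l :: int and N :: nat and t :: "nat \<Rightarrow> real" and \<epsilon> :: real
    and f M E :: "real \<Rightarrow> 'n loop"
  assumes G: "complex_matrix_lie_group G"
    and B: "invariant_form (matrix_lie_algebra G) B"
    and L_def: "L = loop_group G"
    and Lp_def: "Lp = loop_plus G"
    and split: "splitting G Lp Lm"
    and w_def: "w = cocycle B"
    and w_compatible: "compatible w Lp Lm"
    and w_integral: "integral_class w L"
    and mu_wd: "mu_well_defined w L Lp Lm"
    and J: "vacuum_sequence Lp J"
    and C: "local_group_hom G C"
    and l: "l \<ge> -1"
    and eps: "\<epsilon> > 0"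
    and f_curve: "loop_curve \<epsilon> Lm f"
    and f_variation: "variation f = virasoro_field Lp Lm C l (f 0)"
    and M_curve: "loop_curve \<epsilon> Lm M"
    and E_in: "\<And>u. u \<in> {-\<epsilon><..<\<epsilon>} \<Longrightarrow> E u \<in> Lp"
    and factor: "\<And>u. u \<in> {-\<epsilon><..<\<epsilon>} \<Longrightarrow> vacuum_frame J N t \<odot> linv (f u) = linv (M u) \<odot> E u"
  shows "variation M \<odot> linv (M 0) =
           lneg (proj_minus Lp Lm
             (lpow l (E 0 \<odot> (lpow 1 (dlam (f 0) \<odot> linv (f 0)) \<oplus> f 0 \<odot> Cprime1 C \<odot> linv (f 0))
                       \<odot> linv (E 0))))
       \<and> (vacuum_frame J N t \<odot> linv (f 0) \<in> mu_domain w L Lp Lm \<longrightarrow>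
         has_log_variation (\<lambda>u. tau w L Lp Lm J N (f u) t)
           (pairing B 0
             (lpow l (E 0 \<odot> (lpow 1 (dlam (f 0) \<odot> linv (f 0)) \<oplus> f 0 \<odot> Cprime1 C \<odot> linv (f 0))
                       \<odot> linv (E 0)))
             (lpow 1 (dlam (E 0) \<odot> linv (E 0)))))"
proof -
  interpret tau_variation G Lp Lm "vacuum_frame J N t" f M E \<epsilon> B
    by unfold_locales
       (use G B split w_compatible mu_wd eps f_curve M_curve E_in factor in \<open>simp_all add: L_def w_def\<close>)
  define X where "X = lpow (l + 1) (dlam (f 0) \<odot> linv (f 0)) \<oplus> lpow l (f 0 \<odot> Cprime1 C \<odot> linv (f 0))"
  define Y where "Y = lpow l (E 0 \<odot> (lpow 1 (dlam (f 0) \<odot> linv (f 0)) \<oplus> f 0 \<odot> Cprime1 C \<odot> linv (f 0))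
                       \<odot> linv (E 0))"
  have f0: "f 0 \<in> loop_group G" and E0: "E 0 \<in> loop_group G"
    using subgroup_loop_group subgroup_plus subgroup_minus f_in[OF zero_in] E_in[OF zero_in] by auto
  have X: "X \<in> loop_algebra G"
    unfolding X_def
    by (intro add_loop_algebra lpow_loop_algebra right_log_derivative_loop Ad_loop_algebra
        Cprime1_loop_algebra f0 C)
  \<comment> \<open>Powers of \<open>\<lambda>\<close> are scalars and commute with conjugation by
    \<open>E 0\<close>. Factoring out the power \<open>l\<close> identifies the loop in the claim
    with the conjugate of \<open>X\<close>, the argument of the projection in the vector
    field.\<close>
  have "cis \<theta> powi (l + 1) = cis \<theta> powi l * cis \<theta> powi 1" for \<theta>
    by (simp add: power_int_add)
  then have YX: "Y = E 0 \<odot> X \<odot> linv (E 0)"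
    by (simp add: Y_def X_def lpow_def loop_ops fun_eq_iff matrix_simps matrix_cscale_left matrix_cscale_right
        bounded_bilinear.add_right[OF bounded_bilinear_cscale])
  have f': "variation f = lneg (proj_minus Lp Lm X) \<odot> f 0"
    using f_variation by (simp add: virasoro_field_def X_def)
  obtain \<xi> where \<xi>: "\<xi> \<in> lie_algebra Lp" "Y = \<xi> \<oplus> lneg (variation M \<odot> linv (M 0))"
    unfolding YX by (rule dressed_field_decomposition[OF X f'])
  have YL: "Y \<in> loop_algebra G" unfolding YX by (rule Ad_loop_algebra[OF E0 X])
  show ?thesis
    unfolding Y_def[symmetric] tau_def w_def L_def
    using proj_minus_dressed[OF \<xi>] log_variation_mu[OF \<xi> YL] by blast
qed

end
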